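(* Let $\gamma\ge 1$ and let $\Theta:\mathbb R^2\to[0,\infty)$ be a measurable function such that (i) $\Theta(tx,ty)=t^\gamma\Theta(x,y)$ for all $x,y\in\mathbb R$ and $t>0$; (ii) there are constants $0<c\le C$ with $c\le\Theta(x,y)\le C$ whenever $x^2+y^2=1$, and $\Theta(x,y)=\Theta(y,x)$ for all $x,y\in\mathbb R$; (iii) there are $\epsilon>0$ and $C>0$ such that $|\Theta(t,1)-\Theta(1,1)|\le C|t-1|$ for $t\in(1-\epsilon,1+\epsilon)$ and $|\Theta(t,-1)-\Theta(-1,-1)|\le C|t+1|$ for $t\in(-1-\epsilon,-1+\epsilon)$. For $\alpha>0$ let $\mathbf B_\alpha$ be the integral operator on $L^2(\mathbb R)$ with kernel $$B_\alpha(x,y)=\frac{\alpha}{\pi}\,\frac{1}{\alpha^2+(x-y)^2+\alpha^3\Theta(x,y)},$$ let $\mu_\alpha$ be its maximal eigenvalue and $\psi_\alpha$ the corresponding normalized, almost everywhere positive eigenfunction. Let $\lambda_1$ be the lowest eigenvalue of the operator $\mathbf A=|D_x|+\frac12\Theta(x,x)$ on $L^2(\mathbb R)$, and $\phi_1$ the corresponding normalized, almost everywhere non-negative eigenfunction. Then $$\lim_{\alpha\to0}\alpha^{-1}(1-\mu_\alpha)=\lambda_1 .$$ Moreover, the eigenfunctions $\psi_\alpha$ converge to $\phi_1$ in the norm of $L^2(\mathbb R)$ as $\alpha\to0$.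
   Context: Under (i), (ii) the operator $\mathbf B_\alpha$ is self-adjoint and compact on $L^2(\mathbb R)$, and it is positivity improving; hence its maximal eigenvalue is non-degenerate and the normalized eigenfunction $\psi_\alpha$ is uniquely determined by requiring $\psi_\alpha>0$ a.e. The operator $\mathbf A$ is $(\mathbf Au)(x)=(|D_x|u)(x)+\frac12\theta(x)u(x)$, where $\theta(x)=\Theta(x,x)$ and $|D_x|$ is the Fourier multiplier by $|\xi|$, i.e. $\widehat{|D_x|u}(\xi)=|\xi|\hat u(\xi)$ with $\hat u(\xi)=(2\pi)^{-1/2}\int e^{-i\xi x}u(x)\,dx$. It is essentially self-adjoint on $C_0^\infty(\mathbb R)$, self-adjoint on $D(\mathbf A)=H^1(\mathbb R)\cap L^2(\mathbb R,|x|^{2\gamma}dx)$, and has purely discrete spectrum. Its lowest eigenvalue $\lambda_1>0$ is non-degenerate and the eigenfunction $\phi_1$ is chosen non-negative (in fact positive) a.e. "Normalized" means of unit norm in $L^2(\mathbb R)$. *)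

theory Defs
  imports "HOL-Analysis.Analysis"
begin

section \<open>The space \<open>L\<^sup>2(\<real>)\<close>\<close>

text \<open>Elements are represented by functions, identified when equal almost everywhere.\<close>

definition L2 :: "(real \<Rightarrow> complex) set" where
  "L2 = {u \<in> borel_measurable lebesgue. integrable lebesgue (\<lambda>x. (cmod (u x))\<^sup>2)}"

text \<open>This is the norm only on \<^const>\<open>L2\<close>: the Bochner integral of a non-integrable function
  is \<open>0\<close>. Hence the membership conditions in \<open>L2_tendsto\<close>.\<close>

definition L2_norm :: "(real \<Rightarrow> complex) \<Rightarrow> real" where
  "L2_norm u = sqrt (\<integral>x. (cmod (u x))\<^sup>2 \<partial>lebesgue)"

definition L2_tendsto :: "('i \<Rightarrow> real \<Rightarrow> complex) \<Rightarrow> (real \<Rightarrow> complex) \<Rightarrow> 'i filter \<Rightarrow> bool" where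
  "L2_tendsto f g F \<longleftrightarrow>
     (\<forall>\<^sub>F i in F. f i \<in> L2) \<and> g \<in> L2 \<and> ((\<lambda>i. L2_norm (\<lambda>x. f i x - g x)) \<longlongrightarrow> 0) F"


section \<open>Operators on \<open>L\<^sup>2(\<real>)\<close> and their eigenvalues\<close>

text \<open>A possibly unbounded operator \<open>T\<close> is represented by its graph: \<open>T u f\<close> means that \<open>u\<close> lies
  in the domain of \<open>T\<close> and that \<open>f\<close> represents the image of \<open>u\<close>.\<close>

type_synonym L2_operator = "(real \<Rightarrow> complex) \<Rightarrow> (real \<Rightarrow> complex) \<Rightarrow> bool"

definition eigenfunction :: "L2_operator \<Rightarrow> complex \<Rightarrow> (real \<Rightarrow> complex) \<Rightarrow> bool" where
  "eigenfunction T z u \<longleftrightarrow>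
     u \<in> L2 \<and> \<not> (AE x in lebesgue. u x = 0) \<and> T u (\<lambda>x. z * u x)"

definition eigenvalue :: "L2_operator \<Rightarrow> complex \<Rightarrow> bool" where
  "eigenvalue T z \<longleftrightarrow> (\<exists>u. eigenfunction T z u)"

text \<open>The next two notions are meant for self-adjoint \<open>T\<close>, all of whose eigenvalues are real.\<close>

definition maximal_eigenvalue :: "L2_operator \<Rightarrow> real \<Rightarrow> bool" where
  "maximal_eigenvalue T \<mu> \<longleftrightarrow>
     eigenvalue T (complex_of_real \<mu>) \<and> (\<forall>\<nu>::real. eigenvalue T (complex_of_real \<nu>) \<longrightarrow> \<nu> \<le> \<mu>)"

definition lowest_eigenvalue :: "L2_operator \<Rightarrow> real \<Rightarrow> bool" where
  "lowest_eigenvalue T \<mu> \<longleftrightarrow>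
     eigenvalue T (complex_of_real \<mu>) \<and> (\<forall>\<nu>::real. eigenvalue T (complex_of_real \<nu>) \<longrightarrow> \<mu> \<le> \<nu>)"


section \<open>The integral operators \<open>B\<^sub>\<alpha>\<close>\<close>

definition B_kernel :: "(real \<Rightarrow> real \<Rightarrow> real) \<Rightarrow> real \<Rightarrow> real \<Rightarrow> real \<Rightarrow> real" where
  "B_kernel \<Theta> \<alpha> x y = \<alpha> / pi * (1 / (\<alpha>\<^sup>2 + (x - y)\<^sup>2 + \<alpha> ^ 3 * \<Theta> x y))"

definition B_operator :: "(real \<Rightarrow> real \<Rightarrow> real) \<Rightarrow> real \<Rightarrow> L2_operator" where
  "B_operator \<Theta> \<alpha> u f \<longleftrightarrow>
     u \<in> L2 \<and> f \<in> L2 \<and>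
     (AE x in lebesgue. f x = (\<integral>y. complex_of_real (B_kernel \<Theta> \<alpha> x y) * u y \<partial>lebesgue))"


section \<open>The Fourier transform and the operator \<open>A\<close>\<close>

definition fourier_integral :: "(real \<Rightarrow> complex) \<Rightarrow> real \<Rightarrow> complex" where
  "fourier_integral u \<xi> =
     complex_of_real (1 / sqrt (2 * pi)) * (\<integral>x. exp (- (\<i> * of_real \<xi> * of_real x)) * u x \<partial>lebesgue)"

text \<open>For \<open>u\<close> in \<open>L\<^sup>2(\<real>)\<close> the Fourier integral need not converge absolutely; the Fourier
  (Plancherel) transform \<open>v\<close> of \<open>u\<close> is the \<open>L\<^sup>2\<close>-limit of the transforms of the truncations of
  \<open>u\<close>, which are integrable. It determines \<open>v\<close> up to null sets.\<close>

definition fourier_transform :: "(real \<Rightarrow> complex) \<Rightarrow> (real \<Rightarrow> complex) \<Rightarrow> bool" where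
  "fourier_transform u v \<longleftrightarrow>
     u \<in> L2 \<and> L2_tendsto (\<lambda>R. fourier_integral (\<lambda>x. indicator {-R..R} x * u x)) v at_top"

definition abs_D :: L2_operator where
  "abs_D u w \<longleftrightarrow> (\<exists>v. fourier_transform u v \<and> fourier_transform w (\<lambda>\<xi>. complex_of_real \<bar>\<xi>\<bar> * v \<xi>))"

definition H1 :: "(real \<Rightarrow> complex) set" where
  "H1 = {u. \<exists>v. fourier_transform u v \<and> (\<lambda>\<xi>. complex_of_real (sqrt (1 + \<xi>\<^sup>2)) * v \<xi>) \<in> L2}"

definition A_domain :: "real \<Rightarrow> (real \<Rightarrow> complex) set" where
  "A_domain \<gamma> =
     {u \<in> H1. integrable lebesgue (\<lambda>x. \<bar>x\<bar> powr (2 * \<gamma>) * (cmod (u x))\<^sup>2)}"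

definition A_operator :: "(real \<Rightarrow> real \<Rightarrow> real) \<Rightarrow> real \<Rightarrow> L2_operator" where
  "A_operator \<Theta> \<gamma> u f \<longleftrightarrow>
     u \<in> A_domain \<gamma> \<and> f \<in> L2 \<and>
     (\<exists>w. abs_D u w \<and> (AE x in lebesgue. f x = w x + complex_of_real (1 / 2 * \<Theta> x x) * u x))"

end

theory Submission
  imports Defs
begin

text \<open>Write \<open>E = (1 - \<mu>\<^sub>\<alpha>) / \<alpha>\<close>. The kernel of \<open>\<alpha>\<^sup>-\<^sup>1 B\<^sub>\<alpha>\<close> is the Cauchy kernel
  \<open>q(x, y) = 1 / (\<pi> (\<alpha>\<^sup>2 + (x - y)\<^sup>2))\<close> minus a nonnegative kernel \<open>V\<close>. The operator \<open>\<alpha> q\<close> is the Poisson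
  semigroup, the Fourier multiplier \<open>exp (- \<alpha> \<bar>\<xi>\<bar>)\<close>, so \<open>\<alpha>\<^sup>-\<^sup>1 - q\<close> tends to \<open>\<bar>D\<bar>\<close>. The mass
  \<open>m(x) = \<integral> V(x, y) dy\<close> concentrates on the diagonal and tends to \<open>\<theta>(x) / 2\<close>. Formally
  \<open>\<alpha>\<^sup>-\<^sup>1 (1 - B\<^sub>\<alpha>)\<close> tends to \<open>A\<close>.

  The proof compares the eigenfunctions \<open>\<psi> = \<psi>\<^sub>\<alpha>\<close> and \<open>\<phi> = \<phi>\<^sub>1\<close> directly; positivity of both replaces
  spectral theory and compactness. Each \<open>\<langle>f, q g\<rangle>\<close> is rewritten with the Dirichlet form
  \<open>1/2 \<integral>\<integral> q(x, y) (f(x) - f(y)) (g(x) - g(y))\<close> (lemma \<open>energy_eq\<close>), and likewise for \<open>V\<close>.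

  \<^item> Testing the equation of \<open>\<psi>\<close> with \<open>\<phi>\<close> gives \<open>(E - \<lambda>\<^sub>1) \<langle>\<phi>, \<psi>\<rangle> \<rightarrow> 0\<close> (\<open>overlap_identity\<close>). The error
    terms vanish because \<open>\<phi>\<close> lies in the domain of \<open>A\<close>: the Dirichlet form of \<open>V\<close> at \<open>\<phi>\<close> tends to 0
    by dominated convergence, with the Gagliardo integrand of \<open>\<phi>\<close> as a majorant, and \<open>(m - \<theta>/2) \<phi>\<close>
    tends to 0 in the mean.

  \<^item> The ground state representation of \<open>\<mu>\<^sub>\<alpha> \<langle>\<phi>, \<phi>\<rangle> - \<langle>\<phi>, B\<^sub>\<alpha> \<phi>\<rangle>\<close> with respect to \<open>\<psi>\<close> is an integral of
    squares (\<open>ground_state_representation\<close>). Divided by \<open>\<alpha>\<close>, this deficit is \<open>\<lambda>\<^sub>1 - E + o(1)\<close>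
    (\<open>deficit_eq\<close>). Its nonnegativity is the upper bound for \<open>E\<close>. On a box the kernel is bounded below,
    so that the deficit controls how far \<open>\<phi>\<close> is from a multiple of \<open>\<psi>\<close> there, in \<open>L\<^sup>1\<close>
    (\<open>proportional_on_box\<close>), and it bounds \<open>\<langle>\<phi>, \<psi>\<rangle>\<close> from below (\<open>overlap_lower_bound\<close>).

  \<^item> Testing the equation of \<open>\<psi>\<close> with \<open>\<psi>\<close> gives \<open>\<integral> m \<psi>\<^sup>2 \<le> E\<close> and a bound for the Dirichlet form of \<open>q\<close>
    (\<open>row_psi_le\<close>, \<open>energy_psi_le\<close>). The first excludes an escape of mass to infinity. The second
    passes to a fixed scale since \<open>q\<close> decreases in \<open>\<alpha>\<close>, and excludes oscillation and concentration
    through an inequality that controls the \<open>L\<^sup>2\<close> norm by the Dirichlet form, the \<open>L\<^sup>1\<close> norm on a box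
    and the tail (\<open>Nash_type_inequality\<close>).

  Consequently \<open>\<langle>\<phi>, \<psi>\<rangle>\<close> stays away from 0, hence \<open>E \<rightarrow> \<lambda>\<^sub>1\<close> and the deficit tends to 0. The same
  inequality, applied to a normalized combination of \<open>\<phi>\<close> and \<open>\<psi>\<close>, turns closeness in \<open>L\<^sup>1\<close> on boxes into
  \<open>\<langle>\<phi>, \<psi>\<rangle> \<rightarrow> 1\<close>, which is convergence in \<open>L\<^sup>2\<close>.

  Fourier analysis enters only in \<open>form_generator_estimate\<close>, which identifies the limit of
  \<open>\<alpha>\<^sup>-\<^sup>1 - q\<close> on the domain of \<open>\<bar>D\<bar>\<close>. It follows from Parseval's identity with the convergence factor
  \<open>exp (- \<alpha> \<bar>\<xi>\<bar>)\<close>, whose Fourier transform is the Cauchy kernel. All estimates are made with real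
  Borel functions along an arbitrary sequence \<open>\<alpha>\<^sub>n \<rightarrow> 0\<close>; the last part chooses Borel representatives.\<close>

section \<open>Quadratic forms of symmetric kernels\<close>

lemma abs_mult_le_squares: "\<bar>a * b\<bar> \<le> a\<^sup>2 + (b::real)\<^sup>2"
proof -
  have "0 \<le> (\<bar>a\<bar> - \<bar>b\<bar>)\<^sup>2" "0 \<le> \<bar>a\<bar> * \<bar>b\<bar>" by simp_all
  then show ?thesis unfolding power2_diff abs_mult power2_abs by linarith
qed

lemma Cauchy_Schwarz_integral:
  fixes f g :: "'a \<Rightarrow> real"
  assumes [measurable]: "f \<in> borel_measurable M" "g \<in> borel_measurable M"
    and f: "integrable M (\<lambda>x. (f x)\<^sup>2)" and g: "integrable M (\<lambda>x. (g x)\<^sup>2)"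
  shows "integrable M (\<lambda>x. f x * g x)"
    and "(\<integral>x. \<bar>f x * g x\<bar> \<partial>M)\<^sup>2 \<le> (\<integral>x. (f x)\<^sup>2 \<partial>M) * (\<integral>x. (g x)\<^sup>2 \<partial>M)"
    and "(\<integral>x. f x * g x \<partial>M)\<^sup>2 \<le> (\<integral>x. (f x)\<^sup>2 \<partial>M) * (\<integral>x. (g x)\<^sup>2 \<partial>M)"
proof -
  have le: "\<bar>f x * g x\<bar> \<le> (f x)\<^sup>2 + (g x)\<^sup>2" for x
    by (rule abs_mult_le_squares)
  show int: "integrable M (\<lambda>x. f x * g x)"
    by (rule Bochner_Integration.integrable_bound[OF Bochner_Integration.integrable_add[OF f g]]) (use le in auto)
  define A where "A = (\<integral>x. (f x)\<^sup>2 \<partial>M)"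
  define B where "B = (\<integral>x. (g x)\<^sup>2 \<partial>M)"
  define I where "I = (\<integral>x. \<bar>f x * g x\<bar> \<partial>M)"
  have intabs: "integrable M (\<lambda>x. \<bar>f x * g x\<bar>)" using int by simp
  have A0: "0 \<le> A" unfolding A_def by simp
  have "I\<^sup>2 \<le> A * B"
  proof (cases "A = 0")
    case True
    then have "AE x in M. (f x)\<^sup>2 = 0"
      unfolding A_def using integral_nonneg_eq_0_iff_AE[OF f] by simp
    then have "AE x in M. \<bar>f x * g x\<bar> = 0" by eventually_elim simp
    then have "I = 0" unfolding I_def by (rule integral_eq_zero_AE)
    then show ?thesis using True by simp
  next
    case False
    have "0 \<le> (\<integral>x. (A * \<bar>g x\<bar> - I * \<bar>f x\<bar>)\<^sup>2 \<partial>M)" by simp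
    also have "\<dots> = (\<integral>x. A\<^sup>2 * (g x)\<^sup>2 - 2 * A * I * \<bar>f x * g x\<bar> + I\<^sup>2 * (f x)\<^sup>2 \<partial>M)"
      by (rule Bochner_Integration.integral_cong) (auto simp: power2_diff power_mult_distrib abs_mult)
    also have "\<dots> = A\<^sup>2 * B - 2 * A * I * I + I\<^sup>2 * A"
      unfolding A_def[symmetric] B_def[symmetric]
      by (simp add: f g intabs flip: A_def B_def I_def)
    also have "\<dots> = A * (A * B - I\<^sup>2)" by (simp add: power2_eq_square algebra_simps)
    finally have "0 \<le> A * B - I\<^sup>2" using A0 False by (simp add: zero_le_mult_iff)
    then show ?thesis by simp
  qed
  then show 1: "(\<integral>x. \<bar>f x * g x\<bar> \<partial>M)\<^sup>2 \<le> (\<integral>x. (f x)\<^sup>2 \<partial>M) * (\<integral>x. (g x)\<^sup>2 \<partial>M)"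
    by (simp add: A_def B_def I_def)
  have "\<bar>\<integral>x. f x * g x \<partial>M\<bar> \<le> (\<integral>x. \<bar>f x * g x\<bar> \<partial>M)" by (rule integral_abs_bound)
  then have "(\<integral>x. f x * g x \<partial>M)\<^sup>2 \<le> (\<integral>x. \<bar>f x * g x\<bar> \<partial>M)\<^sup>2"
    by (metis abs_ge_zero power2_abs power_mono)
  with 1 show "(\<integral>x. f x * g x \<partial>M)\<^sup>2 \<le> (\<integral>x. (f x)\<^sup>2 \<partial>M) * (\<integral>x. (g x)\<^sup>2 \<partial>M)" by simp
qed

definition sq_int :: "(real \<Rightarrow> real) \<Rightarrow> bool" where
  "sq_int f \<longleftrightarrow> f \<in> borel_measurable borel \<and> integrable lborel (\<lambda>x. (f x)\<^sup>2)"

definition ip :: "(real \<Rightarrow> real) \<Rightarrow> (real \<Rightarrow> real) \<Rightarrow> real" where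
  "ip f g = (\<integral>x. f x * g x \<partial>lborel)"

lemma sq_int_measurable [measurable_dest]: "sq_int f \<Longrightarrow> f \<in> borel_measurable borel"
  by (simp add: sq_int_def)

lemma sq_int_square: "sq_int f \<Longrightarrow> integrable lborel (\<lambda>x. (f x)\<^sup>2)"
  by (simp add: sq_int_def)

lemma sq_int_mult: "sq_int f \<Longrightarrow> sq_int g \<Longrightarrow> integrable lborel (\<lambda>x. f x * g x)"
  by (rule Cauchy_Schwarz_integral(1)) (auto simp: sq_int_def)

lemma ip_same: "ip f f = (\<integral>x. (f x)\<^sup>2 \<partial>lborel)"
  by (simp add: ip_def power2_eq_square)

lemma ip_commute: "ip f g = ip g f"
  by (simp add: ip_def mult.commute)

lemma ip_nonneg: "0 \<le> ip f f"
  by (simp add: ip_same)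

lemma ip_Cauchy_Schwarz:
  assumes "sq_int f" "sq_int g"
  shows "\<bar>ip f g\<bar> \<le> sqrt (ip f f) * sqrt (ip g g)"
proof -
  have "(ip f g)\<^sup>2 \<le> ip f f * ip g g"
    unfolding ip_same unfolding ip_def
    by (rule Cauchy_Schwarz_integral(3)) (use assms in \<open>auto simp: sq_int_def\<close>)
  then have "sqrt ((ip f g)\<^sup>2) \<le> sqrt (ip f f * ip g g)" by (rule real_sqrt_le_mono)
  then show ?thesis by (simp add: real_sqrt_mult)
qed

lemma sq_int_scale: "sq_int f \<Longrightarrow> sq_int (\<lambda>x. c * f x)"
  by (auto simp: sq_int_def power_mult_distrib)

lemma sq_int_bound:
  assumes "sq_int f" "g \<in> borel_measurable borel" "AE x in lborel. \<bar>g x\<bar> \<le> \<bar>f x\<bar>"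
  shows "sq_int g"
proof -
  have "integrable lborel (\<lambda>x. (g x)\<^sup>2)"
    by (rule Bochner_Integration.integrable_bound[OF sq_int_square[OF assms(1)]])
      (use assms in \<open>auto simp: abs_le_square_iff\<close>)
  then show ?thesis using assms by (simp add: sq_int_def)
qed

lemma sq_int_add: 
  assumes "sq_int f" "sq_int g" shows "sq_int (\<lambda>x. f x + g x)"
proof -
  have "integrable lborel (\<lambda>x. (f x)\<^sup>2 + (g x)\<^sup>2 + 2 * (f x * g x))"
    by (intro Bochner_Integration.integrable_add integrable_mult_right sq_int_square sq_int_mult assms)
  moreover have "(\<lambda>x. f x + g x) \<in> borel_measurable borel" using assms by (auto simp: sq_int_def)
  ultimately show ?thesis by (simp add: sq_int_def power2_sum algebra_simps)
qed

lemma sq_int_diff: 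
  assumes "sq_int f" "sq_int g" shows "sq_int (\<lambda>x. f x - g x)"
  using sq_int_add[OF assms(1) sq_int_scale[OF assms(2), of "-1"]] by simp

lemma sq_int_indicator: 
  assumes "sq_int f" "A \<in> sets borel" shows "sq_int (\<lambda>x. indicator A x * f x)"
  by (rule sq_int_bound[OF assms(1)]) (use assms in \<open>auto split: split_indicator\<close>)

abbreviation plane :: "(real \<times> real) measure" where
  "plane \<equiv> lborel \<Otimes>\<^sub>M lborel"

text \<open>The bound \<open>C\<close> on the row masses makes the kernel a bounded operator on \<open>L\<^sup>2\<close> (Schur test), so
  that all integrals below converge absolutely.\<close>
definition sym_kernel :: "(real \<Rightarrow> real \<Rightarrow> real) \<Rightarrow> real \<Rightarrow> bool" where
  "sym_kernel K C \<longleftrightarrow> (\<lambda>(x, y). K x y) \<in> borel_measurable plane \<and>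
     (\<forall>x y. 0 \<le> K x y \<and> K x y = K y x) \<and> 0 \<le> C \<and>
     (\<forall>x. (\<integral>\<^sup>+y. ennreal (K x y) \<partial>lborel) \<le> ennreal C)"

definition rowint :: "(real \<Rightarrow> real \<Rightarrow> real) \<Rightarrow> real \<Rightarrow> real" where
  "rowint K x = (\<integral>y. K x y \<partial>lborel)"

definition form :: "(real \<Rightarrow> real \<Rightarrow> real) \<Rightarrow> (real \<Rightarrow> real) \<Rightarrow> (real \<Rightarrow> real) \<Rightarrow> real" where
  "form K f g = (\<integral>(x, y). K x y * (f x * g y) \<partial>plane)"

text \<open>The Dirichlet form of the jump kernel \<open>K\<close>.\<close>
definition energy :: "(real \<Rightarrow> real \<Rightarrow> real) \<Rightarrow> (real \<Rightarrow> real) \<Rightarrow> (real \<Rightarrow> real) \<Rightarrow> real" where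
  "energy K f g = (1/2) * (\<integral>(x, y). K x y * ((f x - f y) * (g x - g y)) \<partial>plane)"

context
  fixes K :: "real \<Rightarrow> real \<Rightarrow> real" and C :: real
  assumes K: "sym_kernel K C"
begin

lemma sym_kernel_measurable [measurable]: "(\<lambda>p. K (fst p) (snd p)) \<in> borel_measurable plane"
  using K by (simp add: sym_kernel_def case_prod_beta')

lemma sym_kernel_row_measurable [measurable]: "K x \<in> borel_measurable lborel"
proof -
  have "(\<lambda>y. (\<lambda>p. K (fst p) (snd p)) (x, y)) \<in> borel_measurable lborel"
    by (rule measurable_compose[OF _ sym_kernel_measurable]) simp
  then show ?thesis by simp
qed

lemma sym_kernel_nonneg: "0 \<le> K x y" and sym_kernel_commute: "K x y = K y x" and sym_kernel_bound_nonneg: "0 \<le> C"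
  using K by (auto simp: sym_kernel_def)

lemma sym_kernel_row_nn_integral: "(\<integral>\<^sup>+y. ennreal (K x y) \<partial>lborel) \<le> ennreal C"
  using K by (auto simp: sym_kernel_def)

lemma sym_kernel_row_integrable: "integrable lborel (K x)"
proof (rule integrableI_bounded)
  have "(\<integral>\<^sup>+y. ennreal (norm (K x y)) \<partial>lborel) \<le> ennreal C"
    using sym_kernel_row_nn_integral[of x] sym_kernel_nonneg by simp
  then show "(\<integral>\<^sup>+y. ennreal (norm (K x y)) \<partial>lborel) < \<infinity>"
    by (rule order_le_less_trans) simp
qed simp

lemma rowint_bounds: "0 \<le> rowint K x" "rowint K x \<le> C"
proof -
  have "ennreal (rowint K x) = (\<integral>\<^sup>+y. ennreal (K x y) \<partial>lborel)"
    unfolding rowint_def by (rule nn_integral_eq_integral[symmetric]) (use sym_kernel_row_integrable sym_kernel_nonneg in auto)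
  then show "rowint K x \<le> C" using sym_kernel_row_nn_integral[of x] sym_kernel_bound_nonneg by (metis ennreal_le_iff)
  show "0 \<le> rowint K x" unfolding rowint_def using sym_kernel_nonneg by simp
qed

lemma rowint_measurable [measurable]: "rowint K \<in> borel_measurable borel"
proof -
  have "(\<lambda>x. \<integral>y. (\<lambda>p. K (fst p) (snd p)) (x, y) \<partial>lborel) \<in> borel_measurable lborel" 
    by (rule lborel.borel_measurable_lebesgue_integral) (simp add: case_prod_beta')
  then show ?thesis unfolding rowint_def by simp
qed

lemma form_integrable_square_fst:
  assumes f: "sq_int f"
  shows "integrable plane (\<lambda>(x, y). K x y * (f x)\<^sup>2)"
    and "(\<integral>(x, y). K x y * (f x)\<^sup>2 \<partial>plane) = (\<integral>x. rowint K x * (f x)\<^sup>2 \<partial>lborel)"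
proof -
  have [measurable]: "f \<in> borel_measurable borel" using f by (simp add: sq_int_def)
  show int: "integrable plane (\<lambda>(x, y). K x y * (f x)\<^sup>2)"
  proof (rule lborel_pair.Fubini_integrable)
    show "(\<lambda>(x, y). K x y * (f x)\<^sup>2) \<in> borel_measurable plane"
      by (simp add: case_prod_beta')
    have eq: "(\<integral>y. norm (K x y * (f x)\<^sup>2) \<partial>lborel) = rowint K x * (f x)\<^sup>2" for x
      using sym_kernel_nonneg by (simp add: rowint_def abs_mult)
    have "integrable lborel (\<lambda>x. rowint K x * (f x)\<^sup>2)"
      by (rule Bochner_Integration.integrable_bound[OF integrable_mult_right[OF sq_int_square[OF f], of C]])
        (use rowint_bounds sym_kernel_bound_nonneg in \<open>auto simp: abs_mult intro!: mult_right_mono\<close>)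
    then show "integrable lborel (\<lambda>x. \<integral>y. norm ((\<lambda>(x, y). K x y * (f x)\<^sup>2) (x, y)) \<partial>lborel)"
      by (simp add: eq del: norm_mult real_norm_def)
    show "AE x in lborel. integrable lborel (\<lambda>y. (\<lambda>(x, y). K x y * (f x)\<^sup>2) (x, y))"
      using sym_kernel_row_integrable by simp
  qed
  show "(\<integral>(x, y). K x y * (f x)\<^sup>2 \<partial>plane) = (\<integral>x. rowint K x * (f x)\<^sup>2 \<partial>lborel)"
    by (subst lborel_pair.integral_fst'[OF int, symmetric]) (simp add: rowint_def)
qed

lemma form_integrable_square_snd:
  assumes f: "sq_int f"
  shows "integrable plane (\<lambda>(x, y). K x y * (f y)\<^sup>2)"
    and "(\<integral>(x, y). K x y * (f y)\<^sup>2 \<partial>plane) = (\<integral>x. rowint K x * (f x)\<^sup>2 \<partial>lborel)"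
proof -
  have eq: "(\<lambda>(x, y). K x y * (f y)\<^sup>2) = (\<lambda>(x, y). (\<lambda>(x, y). K x y * (f x)\<^sup>2) (y, x))"
    by (auto simp: fun_eq_iff sym_kernel_commute)
  show "integrable plane (\<lambda>(x, y). K x y * (f y)\<^sup>2)"
    unfolding eq by (rule lborel_pair.integrable_product_swap[OF form_integrable_square_fst(1)[OF f]])
  have m: "(\<lambda>(x, y). K x y * (f x)\<^sup>2) \<in> borel_measurable plane"
    using form_integrable_square_fst(1)[OF f] by simp
  show "(\<integral>(x, y). K x y * (f y)\<^sup>2 \<partial>plane) = (\<integral>x. rowint K x * (f x)\<^sup>2 \<partial>lborel)"
    unfolding eq lborel_pair.integral_product_swap[OF m] form_integrable_square_fst(2)[OF f] ..
qed

lemma form_integrable: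
  assumes f: "sq_int f" and g: "sq_int g"
  shows "integrable plane (\<lambda>(x, y). K x y * (f x * g y))"
proof -
  note [measurable] = sq_int_measurable[OF f] sq_int_measurable[OF g]
  have le: "\<bar>f x * g y\<bar> \<le> (f x)\<^sup>2 + (g y)\<^sup>2" for x y
    by (rule abs_mult_le_squares)
  show ?thesis
  proof (rule Bochner_Integration.integrable_bound)
    show "integrable plane (\<lambda>p. (\<lambda>(x, y). K x y * (f x)\<^sup>2) p + (\<lambda>(x, y). K x y * (g y)\<^sup>2) p)"
      by (intro Bochner_Integration.integrable_add form_integrable_square_fst form_integrable_square_snd f g)
    have "\<bar>K x y * (f x * g y)\<bar> \<le> \<bar>K x y * (f x)\<^sup>2 + K x y * (g y)\<^sup>2\<bar>" for x y
      using mult_left_mono[OF le sym_kernel_nonneg[of x y], of x y] sym_kernel_nonneg[of x y]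
      by (simp add: abs_mult distrib_left)
    then show "AE p in plane. norm (case p of (x, y) \<Rightarrow> K x y * (f x * g y)) \<le>
       norm ((\<lambda>(x, y). K x y * (f x)\<^sup>2) p + (\<lambda>(x, y). K x y * (g y)\<^sup>2) p)"
      by (auto simp: case_prod_beta')
  qed (simp add: case_prod_beta')
qed

lemma form_integrable_fst:
  assumes f: "sq_int f" and g: "sq_int g"
  shows "integrable plane (\<lambda>(x, y). K x y * (f x * g x))"
    and "(\<integral>(x, y). K x y * (f x * g x) \<partial>plane) = (\<integral>x. rowint K x * (f x * g x) \<partial>lborel)"
proof -
  note [measurable] = sq_int_measurable[OF f] sq_int_measurable[OF g]
  have le: "\<bar>f x * g x\<bar> \<le> (f x)\<^sup>2 + (g x)\<^sup>2" for x
    by (rule abs_mult_le_squares)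
  show int: "integrable plane (\<lambda>(x, y). K x y * (f x * g x))"
  proof (rule Bochner_Integration.integrable_bound)
    show "integrable plane (\<lambda>p. (\<lambda>(x, y). K x y * (f x)\<^sup>2) p + (\<lambda>(x, y). K x y * (g x)\<^sup>2) p)"
      by (intro Bochner_Integration.integrable_add form_integrable_square_fst f g)
    have "\<bar>K x y * (f x * g x)\<bar> \<le> \<bar>K x y * (f x)\<^sup>2 + K x y * (g x)\<^sup>2\<bar>" for x y
      using mult_left_mono[OF le sym_kernel_nonneg[of x y], of x] sym_kernel_nonneg[of x y]
      by (simp add: abs_mult distrib_left)
    then show "AE p in plane. norm (case p of (x, y) \<Rightarrow> K x y * (f x * g x)) \<le>
       norm ((\<lambda>(x, y). K x y * (f x)\<^sup>2) p + (\<lambda>(x, y). K x y * (g x)\<^sup>2) p)"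
      by (auto simp: case_prod_beta')
  qed (simp add: case_prod_beta')
  show "(\<integral>(x, y). K x y * (f x * g x) \<partial>plane) = (\<integral>x. rowint K x * (f x * g x) \<partial>lborel)"
    by (subst lborel_pair.integral_fst'[OF int, symmetric]) (simp add: rowint_def)
qed

lemma form_integrable_snd:
  assumes f: "sq_int f" and g: "sq_int g"
  shows "integrable plane (\<lambda>(x, y). K x y * (f y * g y))"
    and "(\<integral>(x, y). K x y * (f y * g y) \<partial>plane) = (\<integral>x. rowint K x * (f x * g x) \<partial>lborel)"
proof -
  have eq: "(\<lambda>(x, y). K x y * (f y * g y)) = (\<lambda>(x, y). (\<lambda>(x, y). K x y * (f x * g x)) (y, x))"
    by (auto simp: fun_eq_iff sym_kernel_commute)
  show "integrable plane (\<lambda>(x, y). K x y * (f y * g y))"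
    unfolding eq by (rule lborel_pair.integrable_product_swap[OF form_integrable_fst(1)[OF f g]])
  have m: "(\<lambda>(x, y). K x y * (f x * g x)) \<in> borel_measurable plane"
    using form_integrable_fst(1)[OF f g] by simp
  show "(\<integral>(x, y). K x y * (f y * g y) \<partial>plane) = (\<integral>x. rowint K x * (f x * g x) \<partial>lborel)"
    unfolding eq lborel_pair.integral_product_swap[OF m] form_integrable_fst(2)[OF f g] ..
qed

lemma form_eq_iterated:
  assumes f: "sq_int f" and g: "sq_int g"
  shows "form K f g = (\<integral>x. f x * (\<integral>y. K x y * g y \<partial>lborel) \<partial>lborel)"
proof -
  have "form K f g = (\<integral>x. (\<integral>y. K x y * (f x * g y) \<partial>lborel) \<partial>lborel)"
    unfolding form_def by (subst lborel_pair.integral_fst'[OF form_integrable[OF f g], symmetric]) simp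
  then show ?thesis by (simp add: mult.left_commute[of "K _ _"])
qed

lemma form_commute:
  assumes f: "sq_int f" and g: "sq_int g"
  shows "form K f g = form K g f"
proof -
  have eq: "(\<lambda>(x, y). K x y * (f x * g y)) = (\<lambda>(x, y). (\<lambda>(x, y). K x y * (g x * f y)) (y, x))"
    by (auto simp: fun_eq_iff sym_kernel_commute)
  have m: "(\<lambda>(x, y). K x y * (g x * f y)) \<in> borel_measurable plane"
    using form_integrable[OF g f] by simp
  show ?thesis unfolding form_def eq lborel_pair.integral_product_swap[OF m] ..
qed

text \<open>Multiplying out the two differences produces four absolutely convergent integrals; by symmetry
  the two diagonal ones agree, and so do the two mixed ones. The identity trades the quadratic form,
  whose size is of the order of the row mass, for a quantity that is monotone in the kernel.\<close>
lemma energy_eq: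
  assumes f: "sq_int f" and g: "sq_int g"
  shows "integrable plane (\<lambda>(x, y). K x y * ((f x - f y) * (g x - g y)))"
    and "energy K f g = (\<integral>x. rowint K x * (f x * g x) \<partial>lborel) - form K f g"
proof -
  define a where "a = (\<lambda>(x, y). K x y * (f x * g x))"
  define b where "b = (\<lambda>(x, y). K x y * (f y * g y))"
  define c where "c = (\<lambda>(x, y). K x y * (f x * g y))"
  define d where "d = (\<lambda>(x, y). K x y * (g x * f y))"
  have int: "integrable plane a" "integrable plane b" "integrable plane c" "integrable plane d"
    unfolding a_def b_def c_def d_def
    by (intro form_integrable_fst form_integrable_snd form_integrable f g)+
  have eq: "(\<lambda>(x, y). K x y * ((f x - f y) * (g x - g y))) = (\<lambda>p. a p + b p - (c p + d p))"
    by (auto simp: fun_eq_iff a_def b_def c_def d_def algebra_simps)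
  show "integrable plane (\<lambda>(x, y). K x y * ((f x - f y) * (g x - g y)))"
    unfolding eq by (intro Bochner_Integration.integrable_add Bochner_Integration.integrable_diff int)
  have "energy K f g = (1/2) * (integral\<^sup>L plane a + integral\<^sup>L plane b - (integral\<^sup>L plane c + integral\<^sup>L plane d))"
    unfolding energy_def eq by (simp add: int)
  moreover have "integral\<^sup>L plane a = (\<integral>x. rowint K x * (f x * g x) \<partial>lborel)"
     "integral\<^sup>L plane b = (\<integral>x. rowint K x * (f x * g x) \<partial>lborel)"
     "integral\<^sup>L plane c = form K f g" "integral\<^sup>L plane d = form K f g"
    unfolding a_def b_def c_def d_def using form_commute[OF f g]
    by (simp_all add: form_integrable_fst form_integrable_snd f g) (simp_all add: form_def)
  ultimately show "energy K f g = (\<integral>x. rowint K x * (f x * g x) \<partial>lborel) - form K f g" by simp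
qed

lemma energy_nonneg: "0 \<le> energy K f f"
  unfolding energy_def using sym_kernel_nonneg by (auto intro!: integral_nonneg_AE simp: case_prod_beta')

lemma energy_Cauchy_Schwarz:
  assumes f: "sq_int f" and g: "sq_int g"
  shows "\<bar>energy K f g\<bar> \<le> sqrt (energy K f f) * sqrt (energy K g g)"
proof -
  note [measurable] = sq_int_measurable[OF f] sq_int_measurable[OF g]
  define F where "F = (\<lambda>p. sqrt (K (fst p) (snd p)) * (f (fst p) - f (snd p)))"
  define G where "G = (\<lambda>p. sqrt (K (fst p) (snd p)) * (g (fst p) - g (snd p)))"
  have [measurable]: "F \<in> borel_measurable plane" "G \<in> borel_measurable plane"
    unfolding F_def G_def by measurable
  have FF: "(\<lambda>(x, y). K x y * ((f x - f y) * (f x - f y))) = (\<lambda>p. (F p)\<^sup>2)"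
    and GG: "(\<lambda>(x, y). K x y * ((g x - g y) * (g x - g y))) = (\<lambda>p. (G p)\<^sup>2)"
    and FG: "(\<lambda>(x, y). K x y * ((f x - f y) * (g x - g y))) = (\<lambda>p. F p * G p)"
  proof -
    have s: "sqrt (K x y) * a * (sqrt (K x y) * b) = K x y * (a * b)" for x y a b
      using real_sqrt_mult_self[of "K x y"] sym_kernel_nonneg[of x y] by (simp add: algebra_simps)
    show "(\<lambda>(x, y). K x y * ((f x - f y) * (f x - f y))) = (\<lambda>p. (F p)\<^sup>2)"
      "(\<lambda>(x, y). K x y * ((g x - g y) * (g x - g y))) = (\<lambda>p. (G p)\<^sup>2)"
      "(\<lambda>(x, y). K x y * ((f x - f y) * (g x - g y))) = (\<lambda>p. F p * G p)"
      unfolding F_def G_def power2_eq_square s by auto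
  qed
  have "(integral\<^sup>L plane (\<lambda>p. F p * G p))\<^sup>2 \<le> integral\<^sup>L plane (\<lambda>p. (F p)\<^sup>2) * integral\<^sup>L plane (\<lambda>p. (G p)\<^sup>2)"
    by (rule Cauchy_Schwarz_integral(3))
      (use energy_eq(1)[OF f f] energy_eq(1)[OF g g] in \<open>auto simp: FF GG\<close>)
  then have "(energy K f g)\<^sup>2 \<le> energy K f f * energy K g g"
    unfolding energy_def FF GG FG by (simp add: power_mult_distrib power2_eq_square)
  then have "sqrt ((energy K f g)\<^sup>2) \<le> sqrt (energy K f f * energy K g g)" by (rule real_sqrt_le_mono)
  then show ?thesis by (simp add: real_sqrt_mult)
qed

end

text \<open>The conclusions of these rules have a variable as head symbol and would match every
  measurability goal.\<close>
declare sym_kernel_measurable [measurable del] sym_kernel_row_measurable [measurable del] rowint_measurable [measurable del]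

lemma energy_mono:
  assumes K: "sym_kernel K C" and K': "sym_kernel K' C'" and le: "\<And>x y. K x y \<le> K' x y" and f: "sq_int f"
  shows "energy K f f \<le> energy K' f f"
proof -
  have "(\<integral>(x, y). K x y * ((f x - f y) * (f x - f y)) \<partial>plane)
     \<le> (\<integral>(x, y). K' x y * ((f x - f y) * (f x - f y)) \<partial>plane)"
    by (rule integral_mono[OF energy_eq(1)[OF K f f] energy_eq(1)[OF K' f f]])
      (auto intro!: mult_right_mono le)
  then show ?thesis unfolding energy_def by simp
qed

lemma sym_kernel_mono:
  assumes K': "sym_kernel K' C" and le: "\<And>x y. K x y \<le> K' x y" and nn: "\<And>x y. 0 \<le> K x y"
   and sym: "\<And>x y. K x y = K y x" and m: "(\<lambda>(x, y). K x y) \<in> borel_measurable plane"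
  shows "sym_kernel K C"
proof -
  have "(\<integral>\<^sup>+y. ennreal (K x y) \<partial>lborel) \<le> ennreal C" for x
    by (rule order_trans[OF nn_integral_mono sym_kernel_row_nn_integral[OF K']]) (auto intro!: ennreal_leI le)
  then show ?thesis unfolding sym_kernel_def using m nn sym sym_kernel_bound_nonneg[OF K'] by blast
qed

section \<open>The Cauchy kernel and its perturbation\<close>

lemma integral_FTC_real_line:
  fixes f F :: "real \<Rightarrow> real"
  assumes F: "\<And>x. DERIV F x :> f x" and f: "\<And>x. isCont f x" and nonneg: "\<And>x. 0 \<le> f x"
    and A: "(F \<longlongrightarrow> A) at_bot" and B: "(F \<longlongrightarrow> B) at_top"
  shows "integrable lborel f" "(\<integral>x. f x \<partial>lborel) = B - A"
proof -
  have lim: "((F \<circ> real_of_ereal) \<longlongrightarrow> A) (at_right (-\<infinity>))" "((F \<circ> real_of_ereal) \<longlongrightarrow> B) (at_left \<infinity>)"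
    unfolding ereal_tendsto_simps using A B by auto
  have e: "einterval (-\<infinity>) \<infinity> = UNIV" by (auto simp: einterval_def)
  have "set_integrable lborel (einterval (-\<infinity>) \<infinity>) f"
    by (rule interval_integral_FTC_nonneg(1)[OF _ F f _ lim]) (auto simp: nonneg)
  then show "integrable lborel f" by (simp add: e set_integrable_def)
  have "(LBINT x=-\<infinity>..\<infinity>. f x) = B - A"
    by (rule interval_integral_FTC_nonneg(2)[OF _ F f _ lim]) (auto simp: nonneg)
  then show "(\<integral>x. f x \<partial>lborel) = B - A"
    by (simp add: interval_lebesgue_integral_def e set_lebesgue_integral_def)
qed

text \<open>The Poisson kernel of the half-plane at height \<open>a\<close>, divided by \<open>a\<close>. With this normalization it
  increases to \<open>1 / (\<pi> (x - y)\<^sup>2)\<close>, the kernel of \<open>\<bar>D\<bar>\<close>, as \<open>a\<close> decreases to 0.\<close>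
definition cauchy :: "real \<Rightarrow> real \<Rightarrow> real \<Rightarrow> real" where
  "cauchy a x y = 1 / (pi * (a\<^sup>2 + (x - y)\<^sup>2))"

lemma cauchy_denominator_pos: "0 < a \<Longrightarrow> 0 < a\<^sup>2 + (z::real)\<^sup>2"
  by (simp add: add_pos_nonneg)

lemma tendsto_arctan_affine:
  fixes a x :: real assumes "0 < a"
  shows "((\<lambda>y. arctan ((y - x) / a)) \<longlongrightarrow> - (pi / 2)) at_bot"
    and "((\<lambda>y. arctan ((y - x) / a)) \<longlongrightarrow> pi / 2) at_top"
proof -
  have "filterlim (\<lambda>y. (1 / a) * (y - x)) at_bot at_bot"
  proof (rule filterlim_tendsto_pos_mult_at_bot[OF tendsto_const])
    show "filterlim (\<lambda>y. y - x) at_bot at_bot"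
      unfolding filterlim_at_bot eventually_at_bot_linorder
      by (metis diff_le_eq)
  qed (use assms in simp)
  then have 1: "filterlim (\<lambda>y. (y - x) / a) at_bot at_bot" by simp
  show "((\<lambda>y. arctan ((y - x) / a)) \<longlongrightarrow> - (pi / 2)) at_bot"
    by (rule filterlim_compose[OF tendsto_arctan_at_bot 1])
  have "filterlim (\<lambda>y. (1 / a) * (y - x)) at_top at_top"
  proof (rule filterlim_tendsto_pos_mult_at_top[OF tendsto_const])
    show "filterlim (\<lambda>y. y - x) at_top at_top"
      unfolding filterlim_at_top eventually_at_top_linorder
      by (metis le_diff_eq)
  qed (use assms in simp)
  then have 1: "filterlim (\<lambda>y. (y - x) / a) at_top at_top" by simp
  show "((\<lambda>y. arctan ((y - x) / a)) \<longlongrightarrow> pi / 2) at_top"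
    by (rule filterlim_compose[OF tendsto_arctan_at_top 1])
qed

lemma cauchy_integral:
  assumes a: "0 < a"
  shows "integrable lborel (cauchy a x)" "(\<integral>y. cauchy a x y \<partial>lborel) = 1 / a"
proof -
  let ?F = "\<lambda>y. (1 / (pi * a)) * arctan ((y - x) / a)"
  have F: "DERIV ?F y :> cauchy a x y" for y
  proof -
    have nz: "a\<^sup>2 + (y - x)\<^sup>2 \<noteq> 0" using cauchy_denominator_pos[OF a, of "y - x"] by (metis less_irrefl)
    have "DERIV ?F y :> (1 / (pi * a)) * (inverse (1 + ((y - x) / a)\<^sup>2) * (1 / a))"
      using a by (auto intro!: derivative_eq_intros)
    also have "(1 / (pi * a)) * (inverse (1 + ((y - x) / a)\<^sup>2) * (1 / a)) = cauchy a x y"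
      unfolding cauchy_def power2_commute[of x y] using a nz
      by (simp add: divide_simps power_divide) (simp add: power2_eq_square algebra_simps)
    finally show ?thesis .
  qed
  have c: "isCont (cauchy a x) y" for y
    unfolding cauchy_def using cauchy_denominator_pos[OF a, of "x - y"] by (intro continuous_intros) auto
  have nn: "0 \<le> cauchy a x y" for y unfolding cauchy_def by simp
  have lims: "(?F \<longlongrightarrow> (1 / (pi * a)) * (- (pi / 2))) at_bot" "(?F \<longlongrightarrow> (1 / (pi * a)) * (pi / 2)) at_top"
    by (intro tendsto_mult_left tendsto_arctan_affine a)+
  show "integrable lborel (cauchy a x)" by (rule integral_FTC_real_line(1)[OF F c nn lims])
  have "(\<integral>y. cauchy a x y \<partial>lborel) = (1 / (pi * a)) * (pi / 2) - (1 / (pi * a)) * (- (pi / 2))"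
    by (rule integral_FTC_real_line(2)[OF F c nn lims])
  then show "(\<integral>y. cauchy a x y \<partial>lborel) = 1 / a" using a by (simp add: field_simps)
qed

lemma cauchy_square_integral:
  fixes a x :: real assumes a: "0 < a"
  shows "integrable lborel (\<lambda>y. a ^ 3 / (pi * (a\<^sup>2 + (x - y)\<^sup>2)\<^sup>2))"
    and "(\<integral>y. a ^ 3 / (pi * (a\<^sup>2 + (x - y)\<^sup>2)\<^sup>2) \<partial>lborel) = 1 / 2"
proof -
  let ?f = "\<lambda>y. a ^ 3 / (pi * (a\<^sup>2 + (x - y)\<^sup>2)\<^sup>2)"
  let ?G = "\<lambda>y. a * (y - x) / (a\<^sup>2 + (y - x)\<^sup>2)"
  let ?F = "\<lambda>y. (1 / (2 * pi)) * (?G y + arctan ((y - x) / a))"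
  have nz: "a\<^sup>2 + (y - x)\<^sup>2 \<noteq> 0" "a\<^sup>2 + (x - y)\<^sup>2 \<noteq> 0" for y
    using cauchy_denominator_pos[OF a, of "y - x"] cauchy_denominator_pos[OF a, of "x - y"] by (metis less_irrefl)+
  have F: "DERIV ?F y :> ?f y" for y
  proof -
    define z where "z = y - x"
    have nz': "a\<^sup>2 + z\<^sup>2 \<noteq> 0" using nz(1)[of y] by (simp add: z_def)
    have "DERIV (\<lambda>y. ?G y + arctan ((y - x) / a)) y :> (a * (a\<^sup>2 + (y - x)\<^sup>2) - a * (y - x) * (2 * (y - x))) / (a\<^sup>2 + (y - x)\<^sup>2)\<^sup>2
         + inverse (1 + ((y - x) / a)\<^sup>2) * (1 / a)"
      using a nz(1)[of y] by (auto intro!: derivative_eq_intros simp: power2_eq_square)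
    then have "DERIV ?F y :> (1 / (2 * pi)) * ((a * (a\<^sup>2 + (y - x)\<^sup>2) - a * (y - x) * (2 * (y - x))) / (a\<^sup>2 + (y - x)\<^sup>2)\<^sup>2
         + inverse (1 + ((y - x) / a)\<^sup>2) * (1 / a))" by (rule DERIV_cmult)
    then have "DERIV ?F y :> (1 / (2 * pi)) * ((a * (a\<^sup>2 + z\<^sup>2) - a * z * (2 * z)) / (a\<^sup>2 + z\<^sup>2)\<^sup>2
         + inverse (1 + (z / a)\<^sup>2) * (1 / a))" by (simp add: z_def)
    also have "inverse (1 + (z / a)\<^sup>2) * (1 / a) = a * (a\<^sup>2 + z\<^sup>2) / (a\<^sup>2 + z\<^sup>2)\<^sup>2"
      using a nz' by (simp add: divide_simps power_divide) (simp add: power2_eq_square algebra_simps)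
    also have "(1 / (2 * pi)) * ((a * (a\<^sup>2 + z\<^sup>2) - a * z * (2 * z)) / (a\<^sup>2 + z\<^sup>2)\<^sup>2 + a * (a\<^sup>2 + z\<^sup>2) / (a\<^sup>2 + z\<^sup>2)\<^sup>2)
       = (1 / (2 * pi)) * ((a * (a\<^sup>2 + z\<^sup>2) - a * z * (2 * z) + a * (a\<^sup>2 + z\<^sup>2)) / (a\<^sup>2 + z\<^sup>2)\<^sup>2)"
      by (simp only: add_divide_distrib[symmetric])
    also have "a * (a\<^sup>2 + z\<^sup>2) - a * z * (2 * z) + a * (a\<^sup>2 + z\<^sup>2) = 2 * a ^ 3"
      by (simp add: power2_eq_square power3_eq_cube algebra_simps)
    also have "(1 / (2 * pi)) * (2 * a ^ 3 / (a\<^sup>2 + z\<^sup>2)\<^sup>2) = ?f y"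
      unfolding z_def power2_commute[of y x] by simp
    finally show ?thesis .
  qed
  have c: "isCont ?f y" for y
    using nz(2)[of y] by (intro continuous_intros) auto
  have nn: "0 \<le> ?f y" for y using a by simp
  have G0: "(?G \<longlongrightarrow> 0) at_bot" "(?G \<longlongrightarrow> 0) at_top"
  proof -
    have inv: "filterlim (\<lambda>y. y - x) at_infinity at_bot" "filterlim (\<lambda>y. y - x) at_infinity at_top"
      unfolding at_infinity_eq_at_top_bot filterlim_def filtermap_sup
      by (rule le_supI2, subst filterlim_def[symmetric], subst filterlim_at_bot, 
          metis (mono_tags, lifting) diff_le_eq eventually_at_bot_linorder)
         (rule le_supI1, subst filterlim_def[symmetric], subst filterlim_at_top, 
          metis (mono_tags, lifting) le_diff_eq eventually_at_top_linorder)
    have G: "?G y = (\<lambda>u. a * (u / (a\<^sup>2 + u\<^sup>2))) (y - x)" for y by simp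
    have bnd: "\<bar>a * (u / (a\<^sup>2 + u\<^sup>2))\<bar> \<le> a * \<bar>inverse u\<bar>" for u
    proof (cases "u = 0")
      case False
      have "\<bar>u / (a\<^sup>2 + u\<^sup>2)\<bar> = \<bar>u\<bar> / (a\<^sup>2 + u\<^sup>2)" using cauchy_denominator_pos[OF a, of u] by (simp add: abs_divide)
      also have "\<dots> \<le> \<bar>u\<bar> / (u\<^sup>2)" using False by (intro divide_left_mono mult_pos_pos cauchy_denominator_pos a) auto
      also have "\<dots> = \<bar>inverse u\<bar>" using False by (simp add: power2_eq_square field_simps)
      finally have "a * \<bar>u / (a\<^sup>2 + u\<^sup>2)\<bar> \<le> a * \<bar>inverse u\<bar>" by (rule mult_left_mono) (use a in simp)
      then show ?thesis using a by (simp only: abs_mult abs_of_pos)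
    qed simp
    have "((\<lambda>u. a * (u / (a\<^sup>2 + u\<^sup>2))) \<longlongrightarrow> 0) at_infinity"
    proof (rule Lim_null_comparison)
      show "\<forall>\<^sub>F u in at_infinity. norm (a * (u / (a\<^sup>2 + u\<^sup>2))) \<le> a * \<bar>inverse u\<bar>"
        using bnd by simp
      have "((\<lambda>u. a * \<bar>inverse u\<bar>) \<longlongrightarrow> a * \<bar>0\<bar>) at_infinity"
        by (intro tendsto_intros tendsto_inverse_0)
      then show "((\<lambda>u. a * \<bar>inverse u\<bar>) \<longlongrightarrow> 0) at_infinity" by simp
    qed
    then show "(?G \<longlongrightarrow> 0) at_bot" "(?G \<longlongrightarrow> 0) at_top"
      unfolding G by (rule filterlim_compose[OF _ inv(1)], rule filterlim_compose[OF _ inv(2)])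
  qed
  have lims: "(?F \<longlongrightarrow> (1 / (2 * pi)) * (0 + - (pi / 2))) at_bot" "(?F \<longlongrightarrow> (1 / (2 * pi)) * (0 + pi / 2)) at_top"
    by (intro tendsto_mult_left tendsto_add G0 tendsto_arctan_affine a)+
  show "integrable lborel ?f" by (rule integral_FTC_real_line(1)[OF F c nn lims])
  have "(\<integral>y. ?f y \<partial>lborel) = (1 / (2 * pi)) * (0 + pi / 2) - (1 / (2 * pi)) * (0 + - (pi / 2))"
    by (rule integral_FTC_real_line(2)[OF F c nn lims])
  then show "(\<integral>y. ?f y \<partial>lborel) = 1 / 2" by (simp add: field_simps)
qed

lemma cauchy_nonneg: "0 \<le> cauchy a x y"
  by (simp add: cauchy_def)

lemma cauchy_meas: "(\<lambda>(x, y). cauchy a x y) \<in> borel_measurable plane"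
  unfolding cauchy_def by measurable

lemma sym_kernel_cauchy:
  assumes a: "0 < a" shows "sym_kernel (cauchy a) (1 / a)"
proof -
  have "(\<integral>\<^sup>+y. ennreal (cauchy a x y) \<partial>lborel) = ennreal (1 / a)" for x
    using nn_integral_eq_integral[OF cauchy_integral(1)[OF a]] cauchy_nonneg
    by (simp add: cauchy_integral(2)[OF a])
  then show ?thesis
    using a cauchy_meas cauchy_nonneg by (auto simp: sym_kernel_def cauchy_def power2_commute)
qed

lemma rowint_cauchy: "0 < a \<Longrightarrow> rowint (cauchy a) x = 1 / a"
  by (simp add: rowint_def cauchy_integral)

text \<open>By this monotonicity a bound for the Dirichlet form at a small scale \<open>a\<close> holds at every fixed
  larger scale.\<close>
lemma cauchy_antimono: 
  assumes "0 < a" "a \<le> d" shows "cauchy d x y \<le> cauchy a x y"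
proof -
  have "a\<^sup>2 \<le> d\<^sup>2" using assms by (intro power_mono) auto
  then show ?thesis unfolding cauchy_def using cauchy_denominator_pos[OF assms(1), of "x - y"] assms
    by (intro divide_left_mono mult_left_mono mult_pos_pos cauchy_denominator_pos) auto
qed

text \<open>The kernel of \<open>a\<^sup>-\<^sup>1 B\<^sub>a\<close>.\<close>
definition wcauchy :: "(real \<Rightarrow> real \<Rightarrow> real) \<Rightarrow> real \<Rightarrow> real \<Rightarrow> real \<Rightarrow> real" where
  "wcauchy T a x y = 1 / (pi * (a\<^sup>2 + (x - y)\<^sup>2 + a ^ 3 * T x y))"

text \<open>For small \<open>a\<close> this kernel acts like multiplication by \<open>T(x, x) / 2\<close>.\<close>
definition pot :: "(real \<Rightarrow> real \<Rightarrow> real) \<Rightarrow> real \<Rightarrow> real \<Rightarrow> real \<Rightarrow> real" where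
  "pot T a x y = cauchy a x y - wcauchy T a x y"

text \<open>The properties of a Borel measurable version of \<open>\<Theta>\<close> that are used below. Changing \<open>\<Theta>\<close> on a null
  set of the plane may destroy its values on the diagonal, so \<open>\<theta>\<close> is a separate datum, tied to \<open>T\<close>
  by a Lipschitz condition for almost all nearby points.\<close>
locale homogeneous_weight =
  fixes T :: "real \<Rightarrow> real \<Rightarrow> real" and c C \<gamma> :: real and \<theta> :: "real \<Rightarrow> real"
  assumes T_meas: "(\<lambda>(x, y). T x y) \<in> borel_measurable plane"
    and T_sym: "T x y = T y x"
    and c_pos: "0 < c" and gamma: "1 \<le> \<gamma>" and C_pos: "0 < C"
    and T_lower: "c * \<bar>x\<bar> powr \<gamma> \<le> T x y"
    and T_upper: "T x y \<le> C * (\<bar>x\<bar> + \<bar>y\<bar>) powr \<gamma>"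
    and theta_meas [measurable]: "\<theta> \<in> borel_measurable borel"
    and theta_nonneg: "0 \<le> \<theta> x"
    and T_diagonal: "AE x in lborel. \<exists>\<delta>>0. \<exists>L\<ge>0. AE y in lborel. \<bar>x - y\<bar> < \<delta> \<longrightarrow> \<bar>T x y - \<theta> x\<bar> \<le> L * \<bar>x - y\<bar>"
begin

lemma T_nonneg: "0 \<le> T x y"
  using T_lower[of x y] c_pos by (meson order_trans mult_nonneg_nonneg powr_ge_zero less_imp_le)

lemma T_measurable [measurable]: "(\<lambda>p. T (fst p) (snd p)) \<in> borel_measurable plane"
  using T_meas by (simp add: case_prod_beta')

lemma wcauchy_denominator: "0 < a \<Longrightarrow> a\<^sup>2 + (x - y)\<^sup>2 \<le> a\<^sup>2 + (x - y)\<^sup>2 + a ^ 3 * T x y"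
  using T_nonneg[of x y] by simp

lemma wcauchy_le_cauchy: "0 < a \<Longrightarrow> wcauchy T a x y \<le> cauchy a x y"
  unfolding wcauchy_def cauchy_def
  using wcauchy_denominator[of a x y] cauchy_denominator_pos[of a "x - y"]
  by (intro divide_left_mono mult_left_mono mult_pos_pos) auto

lemma wcauchy_nonneg: "0 < a \<Longrightarrow> 0 \<le> wcauchy T a x y"
  unfolding wcauchy_def using T_nonneg[of x y] by (intro divide_nonneg_nonneg mult_nonneg_nonneg add_nonneg_nonneg) auto

lemma pot_nonneg: "0 < a \<Longrightarrow> 0 \<le> pot T a x y"
  unfolding pot_def using wcauchy_le_cauchy[of a x y] by simp

lemma pot_le_cauchy: "0 < a \<Longrightarrow> pot T a x y \<le> cauchy a x y"
  unfolding pot_def using wcauchy_nonneg[of a x y] by simp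

lemma pot_eq:
  assumes a: "0 < a"
  shows "pot T a x y = (a ^ 3 * T x y) / (pi * (a\<^sup>2 + (x - y)\<^sup>2) * (a\<^sup>2 + (x - y)\<^sup>2 + a ^ 3 * T x y))"
proof -
  let ?A = "a\<^sup>2 + (x - y)\<^sup>2"
  have A: "?A > 0" "?A + a ^ 3 * T x y > 0"
    using wcauchy_denominator[OF a, of x y] cauchy_denominator_pos[OF a, of "x - y"] by linarith+
  then show ?thesis unfolding pot_def cauchy_def wcauchy_def
    by (simp add: divide_simps)
qed

lemma pot_le:
  assumes a: "0 < a" shows "pot T a x y \<le> T x y * (a ^ 3 / (pi * (a\<^sup>2 + (x - y)\<^sup>2)\<^sup>2))"
proof -
  let ?A = "a\<^sup>2 + (x - y)\<^sup>2"
  have A: "?A > 0" "?A \<le> ?A + a ^ 3 * T x y"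
    using wcauchy_denominator[OF a, of x y] cauchy_denominator_pos[OF a, of "x - y"] by auto
  then have A2: "0 < ?A + a ^ 3 * T x y" by linarith
  have "pot T a x y \<le> (a ^ 3 * T x y) / (pi * ?A * ?A)"
    unfolding pot_eq[OF a] using A A2 a T_nonneg[of x y]
    by (intro divide_left_mono mult_left_mono mult_pos_pos) auto
  then show ?thesis by (simp add: power2_eq_square mult_ac)
qed

lemma sym_kernel_wcauchy: assumes a: "0 < a" shows "sym_kernel (wcauchy T a) (1 / a)"
proof (rule sym_kernel_mono[OF sym_kernel_cauchy[OF a]])
  show "wcauchy T a x y = wcauchy T a y x" for x y unfolding wcauchy_def by (simp add: power2_commute T_sym)
  show "(\<lambda>(x, y). wcauchy T a x y) \<in> borel_measurable plane"
    unfolding wcauchy_def case_prod_beta' by measurable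
qed (use wcauchy_le_cauchy wcauchy_nonneg a in auto)

lemma sym_kernel_pot: assumes a: "0 < a" shows "sym_kernel (pot T a) (1 / a)"
proof (rule sym_kernel_mono[OF sym_kernel_cauchy[OF a]])
  show "pot T a x y = pot T a y x" for x y unfolding pot_def wcauchy_def cauchy_def by (simp add: power2_commute T_sym)
  show "(\<lambda>(x, y). pot T a x y) \<in> borel_measurable plane"
    unfolding pot_def cauchy_def wcauchy_def case_prod_beta' by measurable
qed (use pot_le_cauchy pot_nonneg a in auto)

text \<open>An upper bound for \<open>T x y\<close> when \<open>\<bar>x - y\<bar> \<le> 1 + \<bar>x\<bar>\<close>. It grows like \<open>\<bar>x\<bar> powr \<gamma>\<close>, so multiplication by
  it maps the domain of \<open>A\<close> into \<open>L\<^sup>2\<close>.\<close>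
definition weight_bound :: "real \<Rightarrow> real" where "weight_bound x = C * (3 + 3 * \<bar>x\<bar>) powr \<gamma>"

lemma weight_bound_nonneg: "0 \<le> weight_bound x" using C_pos by (simp add: weight_bound_def)

lemma T_le_bound: assumes "\<bar>x - y\<bar> \<le> 1 + \<bar>x\<bar>" shows "T x y \<le> weight_bound x"
proof -
  have "\<bar>x\<bar> + \<bar>y\<bar> \<le> 3 + 3 * \<bar>x\<bar>" using assms by linarith
  then have "(\<bar>x\<bar> + \<bar>y\<bar>) powr \<gamma> \<le> (3 + 3 * \<bar>x\<bar>) powr \<gamma>" using gamma by (intro powr_mono2) auto
  then show ?thesis using T_upper[of x y] C_pos unfolding weight_bound_def
    by (meson mult_left_mono order_trans less_imp_le)
qed

lemma cauchy_le_far: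
  assumes a: "0 < a" and d: "0 < d" "d \<le> 1" "d \<le> \<bar>x - y\<bar>"
  shows "cauchy a x y \<le> (2 / d\<^sup>2) * cauchy 1 x y"
proof -
  have "\<bar>d\<bar> \<le> \<bar>x - y\<bar>" using d by linarith
  then have z: "d\<^sup>2 \<le> (x - y)\<^sup>2" unfolding abs_le_square_iff .
  have d2: "d\<^sup>2 \<le> 1" "0 < d\<^sup>2" using d by (auto simp: power_le_one)
  have le: "d\<^sup>2 * (1 + q) / 2 \<le> p + q" if "d\<^sup>2 \<le> q" "0 \<le> p" for p q :: real
  proof -
    have "0 \<le> q" using that d2 by linarith
    then have "d\<^sup>2 * q \<le> 1 * q" by (intro mult_right_mono d2)
    then have "d\<^sup>2 * (1 + q) \<le> 2 * (p + q)" using that by (simp add: distrib_left)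
    then show ?thesis by simp
  qed
  have "1 / (pi * (a\<^sup>2 + (x - y)\<^sup>2)) \<le> 1 / (pi * (d\<^sup>2 * (1 + (x - y)\<^sup>2) / 2))"
  proof (rule divide_left_mono)
    have "d\<^sup>2 * (1 + (x - y)\<^sup>2) / 2 \<le> a\<^sup>2 + (x - y)\<^sup>2" by (rule le[OF z]) simp
    then have "pi * (d\<^sup>2 * (1 + (x - y)\<^sup>2) / 2) \<le> pi * (a\<^sup>2 + (x - y)\<^sup>2)" by (rule mult_left_mono) simp
    then show "pi * (d\<^sup>2 * (1 + (x - y)\<^sup>2) / 2) \<le> pi * (a\<^sup>2 + (x - y)\<^sup>2)" .
    have "0 < 1 + (x - y)\<^sup>2" using cauchy_denominator_pos[of 1 "x - y"] by simp
    then show "0 < pi * (a\<^sup>2 + (x - y)\<^sup>2) * (pi * (d\<^sup>2 * (1 + (x - y)\<^sup>2) / 2))"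
      using cauchy_denominator_pos[OF a, of "x - y"] d by (intro mult_pos_pos divide_pos_pos) auto
  qed simp
  also have "\<dots> = (2 / d\<^sup>2) * cauchy 1 x y"
    by (simp add: cauchy_def)
  finally show ?thesis by (simp add: cauchy_def)
qed

text \<open>For \<open>\<bar>x - y\<bar> \<le> 1 + \<bar>x\<bar>\<close> the weight is at most \<open>weight_bound x\<close>, and \<open>a\<^sup>3 / (\<pi> (a\<^sup>2 + z\<^sup>2)\<^sup>2)\<close> has
  integral \<open>1/2\<close>. Farther away the growth of the weight is harmless because the kernel never exceeds
  the Cauchy kernel, which is at most twice the Cauchy kernel of scale 1 there.\<close>
lemma rowint_pot_le:
  assumes a: "0 < a" shows "rowint (pot T a) x \<le> weight_bound x / 2 + 2"
proof -
  let ?g = "\<lambda>y. weight_bound x * (a ^ 3 / (pi * (a\<^sup>2 + (x - y)\<^sup>2)\<^sup>2)) + 2 * cauchy 1 x y"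
  have int: "integrable lborel ?g"
    by (intro Bochner_Integration.integrable_add integrable_mult_right cauchy_square_integral cauchy_integral a) simp
  have "pot T a x y \<le> ?g y" for y
  proof (cases "\<bar>x - y\<bar> \<le> 1 + \<bar>x\<bar>")
    case True
    have "pot T a x y \<le> T x y * (a ^ 3 / (pi * (a\<^sup>2 + (x - y)\<^sup>2)\<^sup>2))" by (rule pot_le[OF a])
    also have "\<dots> \<le> weight_bound x * (a ^ 3 / (pi * (a\<^sup>2 + (x - y)\<^sup>2)\<^sup>2))"
      by (rule mult_right_mono[OF T_le_bound[OF True]]) (use a in simp)
    finally show ?thesis using cauchy_nonneg[of 1 x y] by linarith
  next
    case False
    have "cauchy a x y \<le> 2 * cauchy 1 x y"
      using cauchy_le_far[OF a, of 1 x y] False by simp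
    moreover have "0 \<le> weight_bound x * (a ^ 3 / (pi * (a\<^sup>2 + (x - y)\<^sup>2)\<^sup>2))" using a weight_bound_nonneg by simp
    ultimately show ?thesis using pot_le_cauchy[OF a, of x y] by linarith
  qed
  then have "rowint (pot T a) x \<le> (\<integral>y. ?g y \<partial>lborel)"
    unfolding rowint_def by (intro integral_mono sym_kernel_row_integrable[OF sym_kernel_pot[OF a]] int)
  also have "\<dots> = weight_bound x * (\<integral>y. a ^ 3 / (pi * (a\<^sup>2 + (x - y)\<^sup>2)\<^sup>2) \<partial>lborel) + 2 * (\<integral>y. cauchy 1 x y \<partial>lborel)"
    by (subst Bochner_Integration.integral_add)
      (simp_all only: integrable_mult_right cauchy_square_integral(1)[OF a] cauchy_integral(1) zero_less_one integral_mult_right_zero)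
  also have "\<dots> = weight_bound x * (1 / 2) + 2 * 1"
    by (simp only: cauchy_square_integral(2)[OF a] cauchy_integral(2)[of 1] zero_less_one div_by_1)
  finally show ?thesis by simp
qed

text \<open>The kernel increases with the weight and \<open>T x y \<ge> c R powr \<gamma>\<close> for all \<open>y\<close>. Already the interval
  \<open>\<bar>x - y\<bar> \<le> a\<close> contributes the stated mass.\<close>
lemma rowint_pot_ge:
  assumes a: "0 < a" and R: "0 \<le> R" "R \<le> \<bar>x\<bar>" and small: "a * (c * R powr \<gamma>) \<le> 1"
  shows "c * R powr \<gamma> / (3 * pi) \<le> rowint (pot T a) x"
proof -
  define t where "t = c * R powr \<gamma>"
  have t0: "0 \<le> t" using c_pos by (simp add: t_def)
  have tT: "t \<le> T x y" for y
  proof -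
    have "R powr \<gamma> \<le> \<bar>x\<bar> powr \<gamma>" using R gamma by (intro powr_mono2) auto
    then show ?thesis using T_lower[of x y] c_pos unfolding t_def by (meson mult_left_mono order_trans less_imp_le)
  qed
  have le: "indicator {x - a..x + a} y * (t / (6 * pi * a)) \<le> pot T a x y" for y
  proof (cases "y \<in> {x - a..x + a}")
    case True
    let ?A = "a\<^sup>2 + (x - y)\<^sup>2"
    have "\<bar>x - y\<bar> \<le> \<bar>a\<bar>" using True a by auto
    then have "(x - y)\<^sup>2 \<le> a\<^sup>2" by (simp only: abs_le_square_iff)
    then have A: "0 < ?A" "?A \<le> 2 * a\<^sup>2" using cauchy_denominator_pos[OF a, of "x - y"] by auto
    have a3: "a ^ 3 * t \<le> a\<^sup>2"
      using small a unfolding t_def[symmetric] power3_eq_cube power2_eq_square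
      using mult_left_mono[of "a * t" 1 "a * a"] by (simp add: mult.assoc)
    have mono: "a ^ 3 * t \<le> a ^ 3 * T x y" using tT[of y] a by (intro mult_left_mono) auto
    have nn: "0 \<le> a ^ 3 * t" using a t0 by simp
    have "wcauchy T a x y \<le> 1 / (pi * (?A + a ^ 3 * t))"
      unfolding wcauchy_def using A mono nn by (intro divide_left_mono mult_left_mono mult_pos_pos) auto
    then have "1 / (pi * ?A) - 1 / (pi * (?A + a ^ 3 * t)) \<le> pot T a x y"
      unfolding pot_def cauchy_def by linarith
    moreover have "1 / (pi * ?A) - 1 / (pi * (?A + a ^ 3 * t)) = a ^ 3 * t / (pi * (?A * (?A + a ^ 3 * t)))"
      using A nn by (simp add: divide_simps)
    moreover have "a ^ 3 * t / (pi * ((2 * a\<^sup>2) * (3 * a\<^sup>2))) \<le> a ^ 3 * t / (pi * (?A * (?A + a ^ 3 * t)))"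
      using A a3 nn a by (intro divide_left_mono mult_left_mono mult_mono mult_pos_pos) auto
    moreover have "a ^ 3 * t / (pi * ((2 * a\<^sup>2) * (3 * a\<^sup>2))) = t / (6 * pi * a)"
      using a by (simp add: field_simps power2_eq_square power3_eq_cube)
    ultimately show ?thesis using True by simp
  next
    case False then show ?thesis using pot_nonneg[OF a] by simp
  qed
  have "(\<integral>y. indicator {x - a..x + a} y * (t / (6 * pi * a)) \<partial>lborel) \<le> rowint (pot T a) x"
    unfolding rowint_def
    by (intro integral_mono sym_kernel_row_integrable[OF sym_kernel_pot[OF a]] le integrable_mult_left)
       (auto intro!: integrable_real_indicator simp: emeasure_lborel_Icc_eq)
  moreover have "(\<integral>y. indicator {x - a..x + a} y * (t / (6 * pi * a)) \<partial>lborel) = t / (3 * pi)"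
    using a by (simp add: field_simps)
  ultimately show ?thesis by (simp add: t_def)
qed

lemma pot_tendsto_zero:
  assumes a: "\<And>n. 0 < a n" "a \<longlonglongrightarrow> 0" and ne: "x \<noteq> y"
  shows "(\<lambda>n. pot T (a n) x y) \<longlonglongrightarrow> 0"
proof -
  have nz: "(x - y)\<^sup>2 \<noteq> 0" using ne by simp
  have "(\<lambda>n. pot T (a n) x y) \<longlonglongrightarrow> 1 / (pi * (0\<^sup>2 + (x - y)\<^sup>2)) - 1 / (pi * (0\<^sup>2 + (x - y)\<^sup>2 + 0 ^ 3 * T x y))"
    unfolding pot_def cauchy_def wcauchy_def by (intro tendsto_intros a) (use nz in auto)
  then show ?thesis by simp
qed

text \<open>The leading term of the kernel is \<open>\<theta> x\<close> times \<open>a\<^sup>3 / (\<pi> (a\<^sup>2 + z\<^sup>2)\<^sup>2)\<close>. Both errors, from freezing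
  the weight and from dropping \<open>a\<^sup>3 T\<close> in the denominator, are of order \<open>a\<^sup>2\<close> relative to the Cauchy
  kernel, whose mass is only \<open>1 / a\<close>.\<close>
lemma pot_near_diagonal:
  assumes a: "0 < a" and near: "\<bar>x - y\<bar> \<le> 1 + \<bar>x\<bar>" and L: "0 \<le> L" "\<bar>T x y - \<theta> x\<bar> \<le> L * \<bar>x - y\<bar>"
  shows "\<bar>pot T a x y - \<theta> x * (a ^ 3 / (pi * (a\<^sup>2 + (x - y)\<^sup>2)\<^sup>2))\<bar> \<le> (L + \<theta> x * weight_bound x) * a\<^sup>2 * cauchy a x y"
proof -
  define A where "A = a\<^sup>2 + (x - y)\<^sup>2"
  define s where "s = a ^ 3 * T x y"
  have A: "0 < A" using cauchy_denominator_pos[OF a, of "x - y"] by (simp add: A_def)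
  have s: "0 \<le> s" using a T_nonneg[of x y] by (simp add: s_def)
  have aA: "a\<^sup>2 \<le> A" by (simp add: A_def)
  have azA: "a * \<bar>x - y\<bar> \<le> A"
    using abs_mult_le_squares[of a "x - y"] a by (simp add: A_def abs_mult)
  have "pot T a x y - \<theta> x * (a ^ 3 / (pi * A\<^sup>2)) = a ^ 3 / pi * ((T x y - \<theta> x) / (A * (A + s)) - \<theta> x * s / (A\<^sup>2 * (A + s)))"
    unfolding pot_eq[OF a] A_def[symmetric] s_def[symmetric] using A s
    by (simp add: divide_simps power2_eq_square) (simp add: s_def algebra_simps)
  also have "\<bar>\<dots>\<bar> = a ^ 3 / pi * \<bar>(T x y - \<theta> x) / (A * (A + s)) - \<theta> x * s / (A\<^sup>2 * (A + s))\<bar>"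
    using a by (simp add: abs_mult)
  also have "\<dots> \<le> a ^ 3 / pi * (L * \<bar>x - y\<bar> / (A * A) + \<theta> x * (a ^ 3 * weight_bound x) / (A\<^sup>2 * A))"
  proof (rule mult_left_mono)
    have "\<bar>(T x y - \<theta> x) / (A * (A + s)) - \<theta> x * s / (A\<^sup>2 * (A + s))\<bar>
        \<le> \<bar>(T x y - \<theta> x) / (A * (A + s))\<bar> + \<bar>\<theta> x * s / (A\<^sup>2 * (A + s))\<bar>" by (rule abs_triangle_ineq4)
    also have "\<dots> = \<bar>T x y - \<theta> x\<bar> / (A * (A + s)) + \<theta> x * s / (A\<^sup>2 * (A + s))"
      using A s theta_nonneg[of x] by (simp add: abs_mult)
    also have "\<dots> \<le> L * \<bar>x - y\<bar> / (A * A) + \<theta> x * (a ^ 3 * weight_bound x) / (A\<^sup>2 * A)"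
    proof (rule add_mono)
      show "\<bar>T x y - \<theta> x\<bar> / (A * (A + s)) \<le> L * \<bar>x - y\<bar> / (A * A)"
        using A s L by (intro frac_le mult_left_mono) auto
      have "s \<le> a ^ 3 * weight_bound x" unfolding s_def using T_le_bound[OF near] a by (intro mult_left_mono) auto
      then show "\<theta> x * s / (A\<^sup>2 * (A + s)) \<le> \<theta> x * (a ^ 3 * weight_bound x) / (A\<^sup>2 * A)"
        using A s theta_nonneg[of x] weight_bound_nonneg[of x] a by (intro frac_le mult_left_mono mult_nonneg_nonneg) auto
    qed
    finally show "\<bar>(T x y - \<theta> x) / (A * (A + s)) - \<theta> x * s / (A\<^sup>2 * (A + s))\<bar> \<le> L * \<bar>x - y\<bar> / (A * A) + \<theta> x * (a ^ 3 * weight_bound x) / (A\<^sup>2 * A)" .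
  qed (use a in simp)
  also have "\<dots> = L * a\<^sup>2 / (pi * A) * (a * \<bar>x - y\<bar> / A) + \<theta> x * weight_bound x * a\<^sup>2 / (pi * A) * ((a\<^sup>2 / A) * (a\<^sup>2 / A))"
    using A by (simp add: field_simps power2_eq_square power3_eq_cube)
  also have "\<dots> \<le> L * a\<^sup>2 / (pi * A) * 1 + \<theta> x * weight_bound x * a\<^sup>2 / (pi * A) * (1 * 1)"
    using A aA azA L(1) theta_nonneg[of x] weight_bound_nonneg[of x] a
    by (intro add_mono mult_left_mono mult_mono) auto
  also have "\<dots> = (L + \<theta> x * weight_bound x) * a\<^sup>2 * cauchy a x y"
    unfolding cauchy_def A_def[symmetric] using A by (simp add: field_simps)
  finally show ?thesis by (simp add: A_def)
qed

text \<open>Near the diagonal the previous estimate applies, and \<open>a\<^sup>3 / (\<pi> (a\<^sup>2 + z\<^sup>2)\<^sup>2)\<close> has integral \<open>1/2\<close>.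
  Away from the diagonal the kernel tends to 0 and is dominated by a multiple of one fixed Cauchy
  kernel.\<close>
lemma rowint_pot_tendsto:
  assumes a: "\<And>n. 0 < a n" "a \<longlonglongrightarrow> 0"
  shows "AE x in lborel. (\<lambda>n. rowint (pot T (a n)) x) \<longlonglongrightarrow> \<theta> x / 2"
  using T_diagonal
proof eventually_elim
  fix x assume "\<exists>\<delta>>0. \<exists>L\<ge>0. AE y in lborel. \<bar>x - y\<bar> < \<delta> \<longrightarrow> \<bar>T x y - \<theta> x\<bar> \<le> L * \<bar>x - y\<bar>"
  then obtain \<delta> L where \<delta>: "\<delta> > 0" "L \<ge> 0" and ae: "AE y in lborel. \<bar>x - y\<bar> < \<delta> \<longrightarrow> \<bar>T x y - \<theta> x\<bar> \<le> L * \<bar>x - y\<bar>"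
    by blast
  define d where "d = min \<delta> 1"
  have d: "0 < d" "d \<le> 1" "d \<le> \<delta>" using \<delta> by (auto simp: d_def)
  define g where "g = (\<lambda>n y. a n ^ 3 / (pi * ((a n)\<^sup>2 + (x - y)\<^sup>2)\<^sup>2))"
  \<comment> \<open>The last summand covers the comparison function \<open>g n\<close> at distances of at least \<open>d\<close>.\<close>
  define M where "M = (\<lambda>n. L + \<theta> x * weight_bound x + \<theta> x * a n / d\<^sup>2)"
  define h where "h = (\<lambda>n y. indicator {y. d \<le> \<bar>x - y\<bar>} y * pot T (a n) x y)"
  have [measurable]: "pot T (a n) x \<in> borel_measurable borel" for n
    using sym_kernel_row_integrable[OF sym_kernel_pot[OF a(1)]] by simp
  have [measurable]: "h n \<in> borel_measurable borel" for n
    unfolding h_def by measurable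
  have g: "integrable lborel (g n)" "(\<integral>y. g n y \<partial>lborel) = 1 / 2" for n
    unfolding g_def by (rule cauchy_square_integral[OF a(1)])+
  have h_bound: "\<bar>h n y\<bar> \<le> (2 / d\<^sup>2) * cauchy 1 x y" for n y
    using cauchy_le_far[OF a(1) d(1,2), of x y n] pot_le_cauchy[OF a(1), of n x y] pot_nonneg[OF a(1), of n x y]
      cauchy_nonneg[of 1 x y]
    by (auto simp: h_def split: split_indicator)
  have dom: "integrable lborel (\<lambda>y. (2 / d\<^sup>2) * cauchy 1 x y)"
    by (intro integrable_mult_right cauchy_integral) simp
  have h_int: "integrable lborel (h n)" for n
    by (rule Bochner_Integration.integrable_bound[OF dom]) (use h_bound cauchy_nonneg[of 1 x] in auto)
  have h_lim: "(\<lambda>n. \<integral>y. h n y \<partial>lborel) \<longlonglongrightarrow> (\<integral>y. 0 \<partial>(lborel :: real measure))"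
  proof (rule integral_dominated_convergence[OF _ _ dom])
    show "AE y in lborel. (\<lambda>n. h n y) \<longlonglongrightarrow> 0"
    proof (intro AE_I2)
      fix y show "(\<lambda>n. h n y) \<longlonglongrightarrow> 0"
        using pot_tendsto_zero[OF a, of x y] d unfolding h_def by (cases "x = y") (auto split: split_indicator)
    qed
  qed (use h_bound in auto)
  have key: "AE y in lborel. \<bar>pot T (a n) x y - \<theta> x * g n y\<bar> \<le> M n * (a n)\<^sup>2 * cauchy (a n) x y + h n y" for n
    using ae
  proof eventually_elim
    fix y assume near: "\<bar>x - y\<bar> < \<delta> \<longrightarrow> \<bar>T x y - \<theta> x\<bar> \<le> L * \<bar>x - y\<bar>"
    have an: "0 < a n" by (rule a)
    show "\<bar>pot T (a n) x y - \<theta> x * g n y\<bar> \<le> M n * (a n)\<^sup>2 * cauchy (a n) x y + h n y"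
    proof (cases "\<bar>x - y\<bar> < d")
      case True
      have "\<bar>pot T (a n) x y - \<theta> x * g n y\<bar> \<le> (L + \<theta> x * weight_bound x) * (a n)\<^sup>2 * cauchy (a n) x y"
        unfolding g_def by (rule pot_near_diagonal[OF an]) (use True d near \<delta> in auto)
      also have "\<dots> \<le> M n * (a n)\<^sup>2 * cauchy (a n) x y"
        using an theta_nonneg[of x] cauchy_nonneg[of "a n" x y] unfolding M_def by (intro mult_right_mono) auto
      finally show ?thesis using pot_nonneg[OF an, of x y] True by (simp add: h_def)
    next
      case False
      define A where "A = (a n)\<^sup>2 + (x - y)\<^sup>2"
      have "\<bar>d\<bar> \<le> \<bar>x - y\<bar>" using False d by linarith
      then have "d\<^sup>2 \<le> (x - y)\<^sup>2" unfolding abs_le_square_iff .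
      then have A: "d\<^sup>2 \<le> A" "0 < A" "0 < d\<^sup>2" using cauchy_denominator_pos[OF an, of "x - y"] d by (auto simp: A_def intro: add_increasing)
      have "g n y = a n * (a n)\<^sup>2 * (1 / (pi * A)) * (1 / A)"
        unfolding g_def A_def[symmetric] by (simp add: power2_eq_square power3_eq_cube)
      also have "\<dots> \<le> a n * (a n)\<^sup>2 * (1 / (pi * A)) * (1 / d\<^sup>2)"
      proof (rule mult_left_mono)
        show "1 / A \<le> 1 / d\<^sup>2" by (rule divide_left_mono[OF A(1)]) (use mult_pos_pos[OF A(2,3)] in \<open>auto simp: mult.commute\<close>)
        show "0 \<le> a n * (a n)\<^sup>2 * (1 / (pi * A))" using an less_imp_le[OF A(2)] by simp
      qed
      finally have "\<theta> x * g n y \<le> \<theta> x * (a n * (a n)\<^sup>2 * (1 / (pi * A)) * (1 / d\<^sup>2))"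
        by (rule mult_left_mono[OF _ theta_nonneg])
      also have "\<dots> = (\<theta> x * a n / d\<^sup>2) * (a n)\<^sup>2 * cauchy (a n) x y"
        unfolding cauchy_def A_def[symmetric] by (simp add: mult_ac)
      also have "\<dots> \<le> M n * (a n)\<^sup>2 * cauchy (a n) x y"
        using \<delta>(2) theta_nonneg[of x] weight_bound_nonneg[of x] cauchy_nonneg[of "a n" x y] unfolding M_def
        by (intro mult_right_mono) auto
      finally have 1: "\<theta> x * g n y \<le> M n * (a n)\<^sup>2 * cauchy (a n) x y" .
      have "0 \<le> \<theta> x * g n y" using theta_nonneg[of x] an by (simp add: g_def)
      with 1 show ?thesis using pot_nonneg[OF an, of x y] False by (simp add: h_def)
    qed
  qed
  have le: "\<bar>rowint (pot T (a n)) x - \<theta> x / 2\<bar> \<le> M n * a n + (\<integral>y. h n y \<partial>lborel)" for n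
  proof -
    have i1: "integrable lborel (\<lambda>y. pot T (a n) x y - \<theta> x * g n y)"
      by (intro Bochner_Integration.integrable_diff integrable_mult_right g sym_kernel_row_integrable[OF sym_kernel_pot[OF a(1)]])
    have i2: "integrable lborel (\<lambda>y. M n * (a n)\<^sup>2 * cauchy (a n) x y)"
      by (intro integrable_mult_right cauchy_integral a)
    have "rowint (pot T (a n)) x - \<theta> x / 2 = (\<integral>y. pot T (a n) x y - \<theta> x * g n y \<partial>lborel)"
      using g[of n] sym_kernel_row_integrable[OF sym_kernel_pot[OF a(1)], of n x] by (simp add: rowint_def)
    also have "\<bar>\<dots>\<bar> \<le> (\<integral>y. \<bar>pot T (a n) x y - \<theta> x * g n y\<bar> \<partial>lborel)" by (rule integral_abs_bound)
    also have "\<dots> \<le> (\<integral>y. M n * (a n)\<^sup>2 * cauchy (a n) x y + h n y \<partial>lborel)"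
      by (rule integral_mono_AE[OF _ _ key]) (use i1 i2 h_int in auto)
    also have "\<dots> = M n * (a n)\<^sup>2 * (1 / a n) + (\<integral>y. h n y \<partial>lborel)"
      by (subst Bochner_Integration.integral_add[OF i2 h_int]) (simp only: integral_mult_right_zero cauchy_integral(2)[OF a(1)])
    also have "M n * (a n)\<^sup>2 * (1 / a n) = M n * a n" using a(1)[of n] by (simp add: power2_eq_square)
    finally show ?thesis .
  qed
  have "(\<lambda>n. M n * a n + (\<integral>y. h n y \<partial>lborel)) \<longlonglongrightarrow> (L + \<theta> x * weight_bound x + \<theta> x * 0 / d\<^sup>2) * 0 + (\<integral>y. 0 \<partial>(lborel :: real measure))"
    unfolding M_def using d by (intro tendsto_intros a h_lim) auto
  then have "(\<lambda>n. M n * a n + (\<integral>y. h n y \<partial>lborel)) \<longlonglongrightarrow> 0" by simp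
  then have "(\<lambda>n. rowint (pot T (a n)) x - \<theta> x / 2) \<longlonglongrightarrow> 0"
    by (rule Lim_null_comparison[rotated]) (use le in auto)
  then show "(\<lambda>n. rowint (pot T (a n)) x) \<longlonglongrightarrow> \<theta> x / 2" by (simp add: LIM_zero_iff)
qed

end

section \<open>A Nash-type inequality and the ground state representation\<close>

lemma form_bound:
  assumes K: "sym_kernel K C" and f: "sq_int f" and g: "sq_int g"
  shows "\<bar>form K f g\<bar> \<le> C * (sqrt (ip f f) * sqrt (ip g g))"
proof -
  note [measurable] = sq_int_measurable[OF f] sq_int_measurable[OF g] sym_kernel_measurable[OF K]
  define F where "F = (\<lambda>p. sqrt (K (fst p) (snd p)) * f (fst p))"
  define G where "G = (\<lambda>p. sqrt (K (fst p) (snd p)) * g (snd p))"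
  have [measurable]: "F \<in> borel_measurable plane" "G \<in> borel_measurable plane"
    unfolding F_def G_def by measurable
  have s: "sqrt (K x y) * a * (sqrt (K x y) * b) = K x y * (a * b)" for x y a b
    using real_sqrt_mult_self[of "K x y"] sym_kernel_nonneg[OF K, of x y] by (simp add: algebra_simps)
  have FF: "(\<lambda>(x, y). K x y * (f x)\<^sup>2) = (\<lambda>p. (F p)\<^sup>2)"
    and GG: "(\<lambda>(x, y). K x y * (g y)\<^sup>2) = (\<lambda>p. (G p)\<^sup>2)"
    and FG: "(\<lambda>(x, y). K x y * (f x * g y)) = (\<lambda>p. F p * G p)"
    unfolding F_def G_def power2_eq_square s by auto
  have le: "(\<integral>x. rowint K x * (h x)\<^sup>2 \<partial>lborel) \<le> C * ip h h" if h: "sq_int h" for h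
  proof -
    note [measurable] = sq_int_measurable[OF h] rowint_measurable[OF K]
    have i: "integrable lborel (\<lambda>x. C * (h x)\<^sup>2)" by (intro integrable_mult_right sq_int_square h)
    have le: "rowint K x * (h x)\<^sup>2 \<le> C * (h x)\<^sup>2" for x by (intro mult_right_mono rowint_bounds[OF K]) simp
    have "integrable lborel (\<lambda>x. rowint K x * (h x)\<^sup>2)"
      by (rule Bochner_Integration.integrable_bound[OF i])
        (use le rowint_bounds[OF K] sym_kernel_bound_nonneg[OF K] in \<open>auto simp: abs_mult\<close>)
    from integral_mono[OF this i le] show ?thesis by (simp add: ip_same)
  qed
  have "(integral\<^sup>L plane (\<lambda>p. F p * G p))\<^sup>2 \<le> integral\<^sup>L plane (\<lambda>p. (F p)\<^sup>2) * integral\<^sup>L plane (\<lambda>p. (G p)\<^sup>2)"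
    by (rule Cauchy_Schwarz_integral(3))
      (use form_integrable_square_fst(1)[OF K f] form_integrable_square_snd(1)[OF K g] in \<open>auto simp: FF GG\<close>)
  also have "\<dots> \<le> (C * ip f f) * (C * ip g g)"
    unfolding FF[symmetric] GG[symmetric] form_integrable_square_fst(2)[OF K f] form_integrable_square_snd(2)[OF K g]
    by (intro mult_mono le f g mult_nonneg_nonneg sym_kernel_bound_nonneg[OF K] ip_nonneg integral_nonneg_AE AE_I2 rowint_bounds[OF K]) simp
  finally have "(form K f g)\<^sup>2 \<le> (C * ip f f) * (C * ip g g)"
    unfolding form_def FG .
  then have "sqrt ((form K f g)\<^sup>2) \<le> sqrt ((C * ip f f) * (C * ip g g))" by (rule real_sqrt_le_mono)
  also have "(C * ip f f) * (C * ip g g) = C\<^sup>2 * (ip f f * ip g g)" by (simp add: power2_eq_square)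
  finally show ?thesis using sym_kernel_bound_nonneg[OF K] by (simp add: real_sqrt_mult)
qed

lemma form_add_left:
  assumes K: "sym_kernel K C" and f: "sq_int f" and g: "sq_int g" and h: "sq_int h"
  shows "form K (\<lambda>x. f x + g x) h = form K f h + form K g h"
proof -
  have "form K (\<lambda>x. f x + g x) h = (\<integral>p. (\<lambda>(x, y). K x y * (f x * h y)) p + (\<lambda>(x, y). K x y * (g x * h y)) p \<partial>plane)"
    unfolding form_def by (rule Bochner_Integration.integral_cong) (auto simp: algebra_simps)
  also have "\<dots> = form K f h + form K g h"
    unfolding form_def by (intro Bochner_Integration.integral_add form_integrable[OF K] f g h)
  finally show ?thesis .
qed

lemma form_cauchy_energy:
  assumes a: "0 < a" and f: "sq_int f" and g: "sq_int g"
  shows "energy (cauchy a) f g = ip f g / a - form (cauchy a) f g"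
  unfolding energy_eq(2)[OF sym_kernel_cauchy[OF a] f g] by (simp add: rowint_cauchy[OF a] ip_def)

lemma integrable_on_interval:
  assumes f: "sq_int f"
  shows "integrable lborel (\<lambda>x. indicator {-R..R} x * \<bar>f x\<bar>)"
proof -
  note [measurable] = sq_int_measurable[OF f]
  have sq: "(\<lambda>x. (indicator {-R..R} x :: real)\<^sup>2) = indicator {-R..R}" by (auto simp: fun_eq_iff split: split_indicator)
  have "integrable lborel (\<lambda>x. (indicator {-R..R} x :: real)\<^sup>2)"
    unfolding sq by (rule integrable_real_indicator) (auto simp: emeasure_lborel_Icc_eq)
  then show ?thesis
    by (rule Cauchy_Schwarz_integral(1)[rotated 2]) (use sq_int_square[OF f] in auto)
qed

lemma integrable_three_halves_power:
  assumes f: "sq_int f" and nonneg: "\<And>x. 0 \<le> f x"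
  shows "integrable lborel (\<lambda>x. indicator {-R..R} x * (f x * sqrt (f x)))"
proof (rule Bochner_Integration.integrable_bound)
  note [measurable] = sq_int_measurable[OF f]
  show "integrable lborel (\<lambda>x. indicator {-R..R} x * \<bar>f x\<bar> + (f x)\<^sup>2)"
    by (intro Bochner_Integration.integrable_add integrable_on_interval sq_int_square f)
  show "AE x in lborel. norm (indicator {-R..R} x * (f x * sqrt (f x))) \<le> norm (indicator {-R..R} x * \<bar>f x\<bar> + (f x)\<^sup>2)"
  proof (intro AE_I2)
    fix x
    have "sqrt (f x) \<le> 1 + f x"
    proof (rule real_le_lsqrt)
      show "f x \<le> (1 + f x)\<^sup>2" using nonneg[of x] by (simp add: power2_sum)
    qed (use nonneg[of x] in simp)
    then have "f x * sqrt (f x) \<le> f x * (1 + f x)" by (rule mult_left_mono[OF _ nonneg])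
    then show "norm (indicator {-R..R} x * (f x * sqrt (f x))) \<le> norm (indicator {-R..R} x * \<bar>f x\<bar> + (f x)\<^sup>2)"
      using nonneg[of x] by (auto simp: abs_mult power2_eq_square algebra_simps split: split_indicator)
  qed
  show "(\<lambda>x. indicator {-R..R} x * (f x * sqrt (f x))) \<in> borel_measurable lborel" by simp
qed

lemma integral_product_real_line:
  fixes f g :: "real \<Rightarrow> 'b :: {real_normed_field, banach, second_countable_topology}"
  assumes f: "integrable lborel f" and g: "integrable lborel g"
  shows "integrable plane (\<lambda>(x, y). f x * g y)"
    and "(\<integral>(x, y). f x * g y \<partial>plane) = (\<integral>x. f x \<partial>lborel) * (\<integral>y. g y \<partial>lborel)"
proof -
  have [measurable]: "f \<in> borel_measurable borel" "g \<in> borel_measurable borel" using f g by auto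
  show i: "integrable plane (\<lambda>(x, y). f x * g y)"
  proof (rule lborel_pair.Fubini_integrable)
    show "integrable lborel (\<lambda>x. \<integral>y. norm (case (x, y) of (x, y) \<Rightarrow> f x * g y) \<partial>lborel)"
      using f by (simp add: norm_mult)
    show "AE x in lborel. integrable lborel (\<lambda>y. case (x, y) of (x, y) \<Rightarrow> f x * g y)"
      using g by simp
  qed (simp add: case_prod_beta')
  show "(\<integral>(x, y). f x * g y \<partial>plane) = (\<integral>x. f x \<partial>lborel) * (\<integral>y. g y \<partial>lborel)"
    by (subst lborel_pair.integral_fst'[OF i, symmetric]) simp
qed

text \<open>The form of the Cauchy kernel at scale \<open>d\<close> is \<open>\<parallel>f\<parallel>\<^sup>2 / d\<close> minus the Dirichlet form. Inside the
  box it is bounded by the maximum \<open>1 / (\<pi> d\<^sup>2)\<close> of the kernel times the squared \<open>L\<^sup>1\<close> norm; whatever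
  involves the complement of the box is bounded by the Schur test. The inequality replaces compact
  embeddings: a bounded Dirichlet form, a small tail and a small \<open>L\<^sup>1\<close> norm on a box force a small
  \<open>L\<^sup>2\<close> norm.\<close>
lemma Nash_type_inequality:
  assumes d: "0 < d" and f: "sq_int f"
  shows "ip f f \<le> d * energy (cauchy d) f f + (\<integral>x. indicator {-R..R} x * \<bar>f x\<bar> \<partial>lborel)\<^sup>2 / (pi * d)
     + 2 * sqrt (ip f f) * sqrt (\<integral>x. indicator (- {-R..R}) x * (f x)\<^sup>2 \<partial>lborel)"
proof -
  note K = sym_kernel_cauchy[OF d]
  define u where "u = (\<lambda>x. indicator {-R..R} x * f x)"
  define v where "v = (\<lambda>x. indicator (- {-R..R}) x * f x)"
  have u: "sq_int u" and v: "sq_int v" unfolding u_def v_def by (intro sq_int_indicator f; simp)+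
  note [measurable] = sq_int_measurable[OF f] sq_int_measurable[OF u] sq_int_measurable[OF v]
  have fuv: "f = (\<lambda>x. u x + v x)" by (auto simp: u_def v_def fun_eq_iff split: split_indicator)
  have "form (cauchy d) f f = form (cauchy d) u f + form (cauchy d) v f"
    by (subst (1) fuv) (rule form_add_left[OF K u v f])
  also have "form (cauchy d) u f = form (cauchy d) f u" by (rule form_commute[OF K u f])
  also have "\<dots> = form (cauchy d) u u + form (cauchy d) v u"
    by (subst fuv) (rule form_add_left[OF K u v u])
  finally have split: "form (cauchy d) f f = form (cauchy d) u u + form (cauchy d) v u + form (cauchy d) v f" .
  have uf: "ip u u \<le> ip f f"
    unfolding ip_same by (rule integral_mono[OF sq_int_square[OF u] sq_int_square[OF f]])
      (auto simp: u_def split: split_indicator)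
  have iv: "ip v v = (\<integral>x. indicator (- {-R..R}) x * (f x)\<^sup>2 \<partial>lborel)"
    unfolding ip_same v_def by (rule Bochner_Integration.integral_cong) (auto split: split_indicator)
  have b1: "form (cauchy d) v u \<le> 1 / d * (sqrt (ip v v) * sqrt (ip f f))"
  proof -
    have "form (cauchy d) v u \<le> 1 / d * (sqrt (ip v v) * sqrt (ip u u))" using form_bound[OF K v u] by linarith
    also have "\<dots> \<le> 1 / d * (sqrt (ip v v) * sqrt (ip f f))"
      using d uf ip_nonneg by (intro mult_left_mono) auto
    finally show ?thesis .
  qed
  have b2: "form (cauchy d) v f \<le> 1 / d * (sqrt (ip v v) * sqrt (ip f f))" using form_bound[OF K v f] by linarith
  define I where "I = (\<integral>x. indicator {-R..R} x * \<bar>f x\<bar> \<partial>lborel)"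
  have iu: "integrable lborel (\<lambda>x. \<bar>u x\<bar>)"
    using integrable_on_interval[OF f, of R] by (simp add: u_def abs_mult)
  have I: "(\<integral>x. \<bar>u x\<bar> \<partial>lborel) = I" by (simp add: u_def abs_mult I_def)
  have prod: "integrable plane (\<lambda>(x, y). \<bar>u x\<bar> * \<bar>u y\<bar>)" "(\<integral>(x, y). \<bar>u x\<bar> * \<bar>u y\<bar> \<partial>plane) = I * I"
    using integral_product_real_line[OF iu iu] by (simp_all add: I)
  have b3: "form (cauchy d) u u \<le> 1 / (pi * d\<^sup>2) * (I * I)"
  proof -
    have "cauchy d x y * (u x * u y) \<le> 1 / (pi * d\<^sup>2) * (\<bar>u x\<bar> * \<bar>u y\<bar>)" for x y
    proof -
      have "cauchy d x y * (u x * u y) \<le> cauchy d x y * (\<bar>u x\<bar> * \<bar>u y\<bar>)"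
        by (intro mult_left_mono cauchy_nonneg) (metis abs_ge_self abs_mult)
      also have "\<dots> \<le> 1 / (pi * d\<^sup>2) * (\<bar>u x\<bar> * \<bar>u y\<bar>)"
        unfolding cauchy_def using d cauchy_denominator_pos[OF d, of "x - y"]
        by (intro mult_right_mono divide_left_mono mult_left_mono mult_pos_pos) auto
      finally show ?thesis .
    qed
    then have "form (cauchy d) u u \<le> (\<integral>p. 1 / (pi * d\<^sup>2) * (\<lambda>(x, y). \<bar>u x\<bar> * \<bar>u y\<bar>) p \<partial>plane)"
      unfolding form_def by (intro integral_mono form_integrable[OF K u u] integrable_mult_right prod) auto
    then show ?thesis using prod by simp
  qed
  have "form (cauchy d) f f \<le> 1 / (pi * d\<^sup>2) * (I * I) + 1 / d * (sqrt (ip v v) * sqrt (ip f f)) + 1 / d * (sqrt (ip v v) * sqrt (ip f f))"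
    unfolding split by (intro add_mono b1 b2 b3)
  from mult_left_mono[OF this, of d]
  have "d * form (cauchy d) f f \<le> d * (1 / (pi * d\<^sup>2) * (I * I) + 1 / d * (sqrt (ip v v) * sqrt (ip f f)) + 1 / d * (sqrt (ip v v) * sqrt (ip f f)))"
    using d by simp
  also have "\<dots> = I\<^sup>2 / (pi * d) + 2 * sqrt (ip f f) * sqrt (ip v v)"
    using d by (simp add: field_simps power2_eq_square)
  finally have "d * form (cauchy d) f f \<le> I\<^sup>2 / (pi * d) + 2 * sqrt (ip f f) * sqrt (ip v v)" .
  moreover have "ip f f = d * energy (cauchy d) f f + d * form (cauchy d) f f"
    unfolding form_cauchy_energy[OF d f f] using d by (simp add: algebra_simps)
  ultimately have "ip f f \<le> d * energy (cauchy d) f f + I\<^sup>2 / (pi * d) + 2 * sqrt (ip f f) * sqrt (ip v v)" by linarith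
  then show ?thesis by (simp only: iv I_def)
qed

lemma norm_mono_nonneg: "0 \<le> u \<Longrightarrow> u \<le> (v::real) \<Longrightarrow> norm u \<le> norm v"
  by simp

text \<open>Integrating first in the variable of \<open>\<psi>\<close> in the numerator, the eigenvalue equation cancels the
  denominator. In particular the integrals are finite although \<open>\<psi>\<close> may be arbitrarily small.\<close>
lemma ground_state_integrable:
  assumes K: "sym_kernel K C" and psi: "sq_int \<psi>" "\<And>x. 0 < \<psi> x" and phi: "sq_int \<phi>"
    and eig: "AE x in lborel. (\<integral>y. K x y * \<psi> y \<partial>lborel) = m * \<psi> x"
  shows "integrable plane (\<lambda>(x, y). K x y * ((\<phi> x)\<^sup>2 * \<psi> y / \<psi> x))"
    and "(\<integral>(x, y). K x y * ((\<phi> x)\<^sup>2 * \<psi> y / \<psi> x) \<partial>plane) = m * ip \<phi> \<phi>"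
    and "integrable plane (\<lambda>(x, y). K x y * ((\<phi> y)\<^sup>2 * \<psi> x / \<psi> y))"
    and "(\<integral>(x, y). K x y * ((\<phi> y)\<^sup>2 * \<psi> x / \<psi> y) \<partial>plane) = m * ip \<phi> \<phi>"
proof -
  let ?G = "\<lambda>(x, y). K x y * ((\<phi> x)\<^sup>2 * \<psi> y / \<psi> x)"
  note [measurable] = sq_int_measurable[OF psi(1)] sq_int_measurable[OF phi] sym_kernel_measurable[OF K] sym_kernel_row_measurable[OF K]
  have ms: "?G \<in> borel_measurable plane" unfolding case_prod_beta' by measurable
  have eq: "K x y * ((\<phi> x)\<^sup>2 * \<psi> y / \<psi> x) = (\<phi> x)\<^sup>2 / \<psi> x * (K x y * \<psi> y)" for x y by simp
  have inner: "AE x in lborel. (\<integral>y. K x y * ((\<phi> x)\<^sup>2 * \<psi> y / \<psi> x) \<partial>lborel) = m * (\<phi> x)\<^sup>2"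
    using eig
  proof eventually_elim
    fix x assume "(\<integral>y. K x y * \<psi> y \<partial>lborel) = m * \<psi> x"
    then show "(\<integral>y. K x y * ((\<phi> x)\<^sup>2 * \<psi> y / \<psi> x) \<partial>lborel) = m * (\<phi> x)\<^sup>2"
      unfolding eq integral_mult_right_zero using psi(2)[of x] by (simp add: power2_eq_square)
  qed
  have nn: "0 \<le> K x y * ((\<phi> x)\<^sup>2 * \<psi> y / \<psi> x)" for x y
    using sym_kernel_nonneg[OF K, of x y] psi(2)[of x] psi(2)[of y] by simp
  have "AE x in lborel. integrable lborel (\<lambda>y. (\<lambda>(x, y). K x y * (\<psi> x * \<psi> y)) (x, y))"
    by (rule lborel_pair.AE_integrable_fst'[OF form_integrable[OF K psi(1) psi(1)]])
  then have row_int: "AE x in lborel. integrable lborel (\<lambda>y. K x y * ((\<phi> x)\<^sup>2 * \<psi> y / \<psi> x))"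
  proof eventually_elim
    fix x assume "integrable lborel (\<lambda>y. (\<lambda>(x, y). K x y * (\<psi> x * \<psi> y)) (x, y))"
    then have "integrable lborel (\<lambda>y. (\<phi> x)\<^sup>2 / (\<psi> x)\<^sup>2 * (K x y * (\<psi> x * \<psi> y)))" by (intro integrable_mult_right) simp
    also have "(\<lambda>y. (\<phi> x)\<^sup>2 / (\<psi> x)\<^sup>2 * (K x y * (\<psi> x * \<psi> y))) = (\<lambda>y. K x y * ((\<phi> x)\<^sup>2 * \<psi> y / \<psi> x))"
      using psi(2)[of x] by (auto simp: fun_eq_iff power2_eq_square)
    finally show "integrable lborel (\<lambda>y. K x y * ((\<phi> x)\<^sup>2 * \<psi> y / \<psi> x))" .
  qed
  show int: "integrable plane ?G"
  proof (rule lborel_pair.Fubini_integrable[OF ms])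
    have "integrable lborel (\<lambda>x. m * (\<phi> x)\<^sup>2)" by (intro integrable_mult_right sq_int_square phi)
    moreover have "AE x in lborel. m * (\<phi> x)\<^sup>2 = (\<integral>y. norm (?G (x, y)) \<partial>lborel)"
      using inner
    proof eventually_elim
      fix x assume "(\<integral>y. K x y * ((\<phi> x)\<^sup>2 * \<psi> y / \<psi> x) \<partial>lborel) = m * (\<phi> x)\<^sup>2"
      moreover have "norm (?G (x, y)) = K x y * ((\<phi> x)\<^sup>2 * \<psi> y / \<psi> x)" for y
        unfolding prod.case real_norm_def by (rule abs_of_nonneg[OF nn])
      ultimately show "m * (\<phi> x)\<^sup>2 = (\<integral>y. norm (?G (x, y)) \<partial>lborel)" by simp
    qed
    moreover have "(\<lambda>x. \<integral>y. norm (?G (x, y)) \<partial>lborel) \<in> borel_measurable lborel" using ms by measurable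
    ultimately show "integrable lborel (\<lambda>x. \<integral>y. norm (?G (x, y)) \<partial>lborel)"
      using Bochner_Integration.integrable_cong_AE_imp by blast
    show "AE x in lborel. integrable lborel (\<lambda>y. ?G (x, y))" using row_int by simp
  qed
  have "integral\<^sup>L plane ?G = (\<integral>x. (\<integral>y. ?G (x, y) \<partial>lborel) \<partial>lborel)"
    by (rule lborel_pair.integral_fst'[OF int, symmetric])
  also have "\<dots> = (\<integral>x. m * (\<phi> x)\<^sup>2 \<partial>lborel)"
  proof (rule integral_cong_AE)
    show "(\<lambda>x. \<integral>y. ?G (x, y) \<partial>lborel) \<in> borel_measurable lborel"
      using lborel_pair.integrable_fst'[OF int] by simp
  qed (use inner in auto)
  finally show val: "integral\<^sup>L plane ?G = m * ip \<phi> \<phi>" by (simp add: ip_same)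
  have sw: "(\<lambda>(x, y). K x y * ((\<phi> y)\<^sup>2 * \<psi> x / \<psi> y)) = (\<lambda>(x, y). ?G (y, x))"
    by (auto simp: fun_eq_iff sym_kernel_commute[OF K])
  show "integrable plane (\<lambda>(x, y). K x y * ((\<phi> y)\<^sup>2 * \<psi> x / \<psi> y))"
    unfolding sw by (rule lborel_pair.integrable_product_swap[OF int])
  show "(\<integral>(x, y). K x y * ((\<phi> y)\<^sup>2 * \<psi> x / \<psi> y) \<partial>plane) = m * ip \<phi> \<phi>"
    unfolding sw lborel_pair.integral_product_swap[OF ms] val ..
qed

lemma ground_state_square:
  fixes s t u v :: real assumes "0 < s" "0 < t"
  shows "(u * sqrt (t / s) - v * sqrt (s / t))\<^sup>2 = u\<^sup>2 * t / s + v\<^sup>2 * s / t - 2 * u * v"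
proof -
  have "sqrt (t / s) * sqrt (s / t) = 1" using assms by (simp flip: real_sqrt_mult)
  then have "u * sqrt (t / s) * (v * sqrt (s / t)) = u * v" by (metis (no_types, opaque_lifting) mult.assoc mult.left_commute mult.right_neutral)
  then show ?thesis using assms by (simp add: power2_diff power_mult_distrib)
qed

text \<open>A positive eigenfunction \<open>\<psi>\<close> of a kernel that is bounded below on the square of \<open>{-R..R}\<close>, and a
  nonnegative function \<open>\<phi>\<close> to be compared with \<open>\<psi>\<close>.\<close>
locale ground_state_on_box =
  fixes K :: "real \<Rightarrow> real \<Rightarrow> real" and C m R \<kappa> :: real and \<psi> \<phi> :: "real \<Rightarrow> real"
  assumes K: "sym_kernel K C" and psi: "sq_int \<psi>" and psi_pos: "\<And>x. 0 < \<psi> x"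
    and phi: "sq_int \<phi>" and phi_nonneg: "\<And>x. 0 \<le> \<phi> x"
    and eig: "AE x in lborel. (\<integral>y. K x y * \<psi> y \<partial>lborel) = m * \<psi> x"
    and kappa: "0 < \<kappa>" and K_lower: "\<And>x y. x \<in> {-R..R} \<Longrightarrow> y \<in> {-R..R} \<Longrightarrow> \<kappa> \<le> K x y"
begin

definition deficit :: real where "deficit = m * ip \<phi> \<phi> - form K \<phi> \<phi>"

definition mass :: "(real \<Rightarrow> real) \<Rightarrow> real" where "mass f = (\<integral>x. indicator {-R..R} x * f x \<partial>lborel)"

abbreviation J :: "real \<Rightarrow> real" where "J \<equiv> indicator {-R..R}"

text \<open>Up to the factor \<open>sqrt (\<psi> x * \<psi> y)\<close> this is the difference of the values of \<open>\<phi> / \<psi>\<close> at \<open>x\<close> and \<open>y\<close>.\<close>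
definition gap :: "real \<times> real \<Rightarrow> real" where
  "gap = (\<lambda>(x, y). \<phi> x * sqrt (\<psi> y / \<psi> x) - \<phi> y * sqrt (\<psi> x / \<psi> y))"

lemma meas [measurable]: "\<psi> \<in> borel_measurable borel" "\<phi> \<in> borel_measurable borel"
  "(\<lambda>p. K (fst p) (snd p)) \<in> borel_measurable plane" "gap \<in> borel_measurable plane"
proof -
  show [measurable]: "\<psi> \<in> borel_measurable borel" "\<phi> \<in> borel_measurable borel" using psi phi by (auto simp: sq_int_def)
  show "gap \<in> borel_measurable plane" unfolding gap_def case_prod_beta' by measurable
qed (rule sym_kernel_measurable[OF K])

lemma gap_square: "(gap (x, y))\<^sup>2 = (\<phi> x)\<^sup>2 * \<psi> y / \<psi> x + (\<phi> y)\<^sup>2 * \<psi> x / \<psi> y - 2 * \<phi> x * \<phi> y"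
  unfolding gap_def using ground_state_square[OF psi_pos psi_pos] by simp

text \<open>The square of the gap expands into two terms that \<open>\<psi>\<close> turns into \<open>m \<langle>\<phi>, \<phi>\<rangle>\<close> and a mixed term that
  gives the quadratic form. Thus \<open>m\<close> is an upper bound of the quadratic form, and near equality forces
  \<open>\<phi> / \<psi>\<close> to be almost constant.\<close>
lemma ground_state_representation:
  "integrable plane (\<lambda>(x, y). K x y * (gap (x, y))\<^sup>2)"
  "(\<integral>(x, y). K x y * (gap (x, y))\<^sup>2 \<partial>plane) = 2 * deficit"
proof -
  note g = ground_state_integrable[OF K psi psi_pos phi eig]
  let ?G = "\<lambda>(x, y). K x y * ((\<phi> x)\<^sup>2 * \<psi> y / \<psi> x)" and ?H = "\<lambda>(x, y). K x y * ((\<phi> y)\<^sup>2 * \<psi> x / \<psi> y)"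
    and ?F = "\<lambda>(x, y). K x y * (\<phi> x * \<phi> y)"
  have eq: "(\<lambda>(x, y). K x y * (gap (x, y))\<^sup>2) = (\<lambda>p. ?G p + ?H p - 2 * ?F p)"
    unfolding gap_square by (auto simp: fun_eq_iff algebra_simps)
  have F: "integrable plane ?F" by (rule form_integrable[OF K phi phi])
  show "integrable plane (\<lambda>(x, y). K x y * (gap (x, y))\<^sup>2)"
    unfolding eq by (intro Bochner_Integration.integrable_diff Bochner_Integration.integrable_add integrable_mult_right g F)
  have "(\<integral>p. ?G p + ?H p - 2 * ?F p \<partial>plane) = (\<integral>p. ?G p \<partial>plane) + (\<integral>p. ?H p \<partial>plane) - 2 * (\<integral>p. ?F p \<partial>plane)"
    using g F by simp
  also have "\<dots> = 2 * deficit" unfolding g(2,4) deficit_def form_def by simp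
  finally show "(\<integral>(x, y). K x y * (gap (x, y))\<^sup>2 \<partial>plane) = 2 * deficit" unfolding eq .
qed

lemma deficit_nonneg: "0 \<le> deficit"
proof -
  have "0 \<le> (\<integral>(x, y). K x y * (gap (x, y))\<^sup>2 \<partial>plane)"
    using sym_kernel_nonneg[OF K] by (intro integral_nonneg_AE AE_I2) (auto simp: case_prod_beta')
  then show ?thesis unfolding ground_state_representation by simp
qed

lemma box_gap:
  "integrable plane (\<lambda>p. J (fst p) * J (snd p) * (gap p)\<^sup>2)"
  "(\<integral>p. J (fst p) * J (snd p) * (gap p)\<^sup>2 \<partial>plane) \<le> 2 * deficit / \<kappa>"
proof -
  have le: "J (fst p) * J (snd p) * (gap p)\<^sup>2 \<le> 1 / \<kappa> * (case p of (x, y) \<Rightarrow> K x y * (gap (x, y))\<^sup>2)" for p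
  proof (cases "fst p \<in> {-R..R} \<and> snd p \<in> {-R..R}")
    case True
    have "1 * (gap p)\<^sup>2 \<le> (K (fst p) (snd p) / \<kappa>) * (gap p)\<^sup>2"
      using K_lower[of "fst p" "snd p"] True kappa by (intro mult_right_mono) auto
    then show ?thesis using True by (auto simp: case_prod_beta')
  next
    case False then show ?thesis using kappa sym_kernel_nonneg[OF K] by (auto simp: case_prod_beta' split: split_indicator)
  qed
  have i: "integrable plane (\<lambda>p. 1 / \<kappa> * (case p of (x, y) \<Rightarrow> K x y * (gap (x, y))\<^sup>2))"
    by (intro integrable_mult_right ground_state_representation)
  show int: "integrable plane (\<lambda>p. J (fst p) * J (snd p) * (gap p)\<^sup>2)"
  proof (rule Bochner_Integration.integrable_bound[OF i])
    show "AE p in plane. norm (J (fst p) * J (snd p) * (gap p)\<^sup>2) \<le> norm (1 / \<kappa> * (case p of (x, y) \<Rightarrow> K x y * (gap (x, y))\<^sup>2))"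
    proof (intro AE_I2)
      fix p
      have "0 \<le> J (fst p) * J (snd p) * (gap p)\<^sup>2" by (auto split: split_indicator)
      then show "norm (J (fst p) * J (snd p) * (gap p)\<^sup>2) \<le> norm (1 / \<kappa> * (case p of (x, y) \<Rightarrow> K x y * (gap (x, y))\<^sup>2))"
        using le[of p] by (intro norm_mono_nonneg)
    qed
  qed measurable
  have "(\<integral>p. J (fst p) * J (snd p) * (gap p)\<^sup>2 \<partial>plane) \<le> (\<integral>p. 1 / \<kappa> * (case p of (x, y) \<Rightarrow> K x y * (gap (x, y))\<^sup>2) \<partial>plane)"
    by (rule integral_mono[OF int i le])
  also have "\<dots> = 1 / \<kappa> * (2 * deficit)" unfolding integral_mult_right_zero ground_state_representation ..
  finally show "(\<integral>p. J (fst p) * J (snd p) * (gap p)\<^sup>2 \<partial>plane) \<le> 2 * deficit / \<kappa>" by simp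
qed

lemma box_int: "integrable lborel (\<lambda>x. J x * \<psi> x)" "integrable lborel (\<lambda>x. J x * \<phi> x)"
  using integrable_on_interval[OF psi, of R] integrable_on_interval[OF phi, of R] psi_pos phi_nonneg
  by (simp_all add: abs_of_pos)

lemma mass_nonneg: "0 \<le> mass \<psi>" "0 \<le> mass \<phi>"
  unfolding mass_def using psi_pos phi_nonneg by (auto intro!: integral_nonneg_AE simp: less_imp_le)

text \<open>The function on the left is the integral over the box in \<open>y\<close> of
  \<open>\<phi> x * \<psi> y - \<phi> y * \<psi> x\<close>, which is \<open>sqrt (\<psi> x * \<psi> y)\<close> times the gap. By the Cauchy--Schwarz
  inequality no lower bound for \<open>\<psi>\<close> is needed.\<close>
lemma proportional_on_box:
  "(\<integral>x. J x * \<bar>mass \<psi> * \<phi> x - mass \<phi> * \<psi> x\<bar> \<partial>lborel) \<le> mass \<psi> * sqrt (2 * deficit / \<kappa>)"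
proof -
  \<comment> \<open>\<open>H\<close> factors as \<open>F G\<close>, where \<open>F\<^sup>2\<close> has integral \<open>(mass \<psi>)\<^sup>2\<close> and \<open>G\<^sup>2\<close> is bounded by the deficit.\<close>
  define H where "H = (\<lambda>p. J (fst p) * J (snd p) * (\<phi> (fst p) * \<psi> (snd p) - \<phi> (snd p) * \<psi> (fst p)))"
  define F where "F = (\<lambda>p. J (fst p) * J (snd p) * sqrt (\<psi> (fst p) * \<psi> (snd p)))"
  define G where "G = (\<lambda>p. J (fst p) * J (snd p) * gap p)"
  have [measurable]: "F \<in> borel_measurable plane" "G \<in> borel_measurable plane" unfolding F_def G_def by measurable
  have sq: "s * sqrt (t / u) * sqrt (u * t) = s * t" if "0 < t" "0 < u" for s t u
  proof -
    have "sqrt (t / u) * sqrt (u * t) = sqrt (t * t)" using that by (simp flip: real_sqrt_mult)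
    then show ?thesis using that by (simp add: mult.assoc)
  qed
  have HFG: "H p = F p * G p" for p
    using sq[of "\<psi> (snd p)" "\<psi> (fst p)" "\<phi> (fst p)"] sq[of "\<psi> (fst p)" "\<psi> (snd p)" "\<phi> (snd p)"] psi_pos
    by (auto simp: H_def F_def G_def gap_def case_prod_beta' algebra_simps split: split_indicator)
  have F2: "(\<lambda>p. (F p)\<^sup>2) = (\<lambda>(x, y). (J x * \<psi> x) * (J y * \<psi> y))"
    using psi_pos by (auto simp: fun_eq_iff F_def less_imp_le split: split_indicator)
  have F2i: "integrable plane (\<lambda>p. (F p)\<^sup>2)" "(\<integral>p. (F p)\<^sup>2 \<partial>plane) = mass \<psi> * mass \<psi>"
    unfolding F2 mass_def by (intro integral_product_real_line box_int)+
  have G2: "(\<lambda>p. (G p)\<^sup>2) = (\<lambda>p. J (fst p) * J (snd p) * (gap p)\<^sup>2)"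
    by (auto simp: fun_eq_iff G_def split: split_indicator)
  have Hi: "integrable plane H"
    unfolding HFG[abs_def] by (rule Cauchy_Schwarz_integral(1)) (use F2i G2 box_gap in auto)
  have "(\<integral>p. \<bar>H p\<bar> \<partial>plane)\<^sup>2 \<le> (mass \<psi> * mass \<psi>) * (2 * deficit / \<kappa>)"
  proof -
    have "(\<integral>p. \<bar>H p\<bar> \<partial>plane)\<^sup>2 \<le> (\<integral>p. (F p)\<^sup>2 \<partial>plane) * (\<integral>p. (G p)\<^sup>2 \<partial>plane)"
      unfolding HFG by (rule Cauchy_Schwarz_integral(2)) (use F2i G2 box_gap in auto)
    also have "\<dots> \<le> (mass \<psi> * mass \<psi>) * (2 * deficit / \<kappa>)"
      unfolding F2i G2 by (intro mult_left_mono box_gap) simp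
    finally show ?thesis .
  qed
  then have "sqrt ((\<integral>p. \<bar>H p\<bar> \<partial>plane)\<^sup>2) \<le> sqrt ((mass \<psi> * mass \<psi>) * (2 * deficit / \<kappa>))" by (rule real_sqrt_le_mono)
  then have HI: "(\<integral>p. \<bar>H p\<bar> \<partial>plane) \<le> mass \<psi> * sqrt (2 * deficit / \<kappa>)"
    using mass_nonneg by (simp add: real_sqrt_mult real_sqrt_divide)
  have Habs: "integrable plane (\<lambda>p. \<bar>H p\<bar>)" using Hi by simp
  have inner: "(\<integral>y. H (x, y) \<partial>lborel) = J x * (mass \<psi> * \<phi> x - mass \<phi> * \<psi> x)" for x
  proof -
    have "(\<integral>y. H (x, y) \<partial>lborel) = (\<integral>y. J x * \<phi> x * (J y * \<psi> y) - J x * \<psi> x * (J y * \<phi> y) \<partial>lborel)"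
      unfolding H_def by (rule Bochner_Integration.integral_cong) (auto simp: algebra_simps)
    also have "\<dots> = J x * \<phi> x * mass \<psi> - J x * \<psi> x * mass \<phi>"
      unfolding mass_def
      by (subst Bochner_Integration.integral_diff) (simp_all only: integrable_mult_right box_int integral_mult_right_zero)
    finally show ?thesis by (simp add: algebra_simps)
  qed
  have "(\<integral>x. J x * \<bar>mass \<psi> * \<phi> x - mass \<phi> * \<psi> x\<bar> \<partial>lborel) = (\<integral>x. \<bar>\<integral>y. H (x, y) \<partial>lborel\<bar> \<partial>lborel)"
    unfolding inner by (simp add: abs_mult)
  also have "\<dots> \<le> (\<integral>x. (\<integral>y. \<bar>H (x, y)\<bar> \<partial>lborel) \<partial>lborel)"
  proof (rule integral_mono)
    show "integrable lborel (\<lambda>x. \<bar>\<integral>y. H (x, y) \<partial>lborel\<bar>)"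
      using lborel_pair.integrable_fst'[OF Hi] by simp
    show "integrable lborel (\<lambda>x. \<integral>y. \<bar>H (x, y)\<bar> \<partial>lborel)"
      by (rule lborel_pair.integrable_fst'[OF Habs])
  qed (rule integral_abs_bound)
  also have "\<dots> = (\<integral>p. \<bar>H p\<bar> \<partial>plane)" by (rule lborel_pair.integral_fst'[OF Habs])
  finally show ?thesis using HI by linarith
qed

text \<open>Where \<open>\<phi>\<close> and \<open>\<psi>\<close> were almost disjoint, \<open>\<phi>\<^sup>2 / \<psi>\<close> would be large, but its integral is controlled
  by the deficit. The Cauchy--Schwarz inequality makes this precise with \<open>\<phi>\<^sup>2 / \<psi>\<close> and \<open>\<phi> \<psi>\<close> as the two
  factors, whose geometric mean is the power \<open>\<phi> sqrt \<phi>\<close>.\<close>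
lemma overlap_lower_bound:
  assumes pos: "0 < mass \<psi>"
  shows "mass \<psi> * (mass (\<lambda>x. \<phi> x * sqrt (\<phi> x)))\<^sup>2 \<le> (deficit / \<kappa> + (mass \<phi>)\<^sup>2) * ip \<phi> \<psi>"
proof -
  define n where "n = mass (\<lambda>x. \<phi> x * sqrt (\<phi> x))"
  define F where "F = (\<lambda>p. J (fst p) * J (snd p) * (\<phi> (fst p) * sqrt (\<psi> (snd p) / \<psi> (fst p))))"
  define G where "G = (\<lambda>p. J (fst p) * J (snd p) * (sqrt (\<phi> (fst p)) * sqrt (\<psi> (fst p) * \<psi> (snd p))))"
  have [measurable]: "F \<in> borel_measurable plane" "G \<in> borel_measurable plane" unfolding F_def G_def by measurable
  let ?Q = "\<lambda>(x, y). K x y * ((\<phi> x)\<^sup>2 * \<psi> y / \<psi> x)"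
  have F2: "(F (x, y))\<^sup>2 = J x * J y * ((\<phi> x)\<^sup>2 * \<psi> y / \<psi> x)" for x y
    using psi_pos[of x] psi_pos[of y] by (auto simp: F_def power_mult_distrib split: split_indicator)
  have F2i: "integrable plane (\<lambda>p. (F p)\<^sup>2)"
  proof (rule Bochner_Integration.integrable_bound[OF integrable_mult_right[OF ground_state_integrable(1)[OF K psi psi_pos phi eig], of "1 / \<kappa>"]])
    show "AE p in plane. norm ((F p)\<^sup>2) \<le> norm (1 / \<kappa> * ?Q p)"
    proof (intro AE_I2)
      fix p :: "real \<times> real"
      obtain x y where p: "p = (x, y)" by (cases p)
      have nn: "0 \<le> (\<phi> x)\<^sup>2 * \<psi> y / \<psi> x" using psi_pos[of x] psi_pos[of y] by simp
      have "J x * J y \<le> 1 / \<kappa> * K x y"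
        using K_lower[of x y] sym_kernel_nonneg[OF K, of x y] kappa by (auto split: split_indicator)
      then have "(F (x, y))\<^sup>2 \<le> 1 / \<kappa> * K x y * ((\<phi> x)\<^sup>2 * \<psi> y / \<psi> x)"
        unfolding F2 by (rule mult_right_mono[OF _ nn])
      then have "(F (x, y))\<^sup>2 \<le> 1 / \<kappa> * ?Q (x, y)" by simp
      then show "norm ((F p)\<^sup>2) \<le> norm (1 / \<kappa> * ?Q p)"
        unfolding p by (rule norm_mono_nonneg[rotated]) (rule zero_le_power2)
    qed
  qed measurable
  define I where "I = (\<integral>p. (F p)\<^sup>2 \<partial>plane)"
  have F2s: "integrable plane (\<lambda>(x, y). (F (y, x))\<^sup>2)" "(\<integral>(x, y). (F (y, x))\<^sup>2 \<partial>plane) = I"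
    using lborel_pair.integrable_product_swap[OF F2i] lborel_pair.integral_product_swap[of "\<lambda>p. (F p)\<^sup>2"]
    by (simp_all add: I_def)
  note pp = integral_product_real_line[OF box_int(2) box_int(2)]
  have "(\<lambda>p. J (fst p) * J (snd p) * (gap p)\<^sup>2) = (\<lambda>p. (F p)\<^sup>2 + (case p of (x, y) \<Rightarrow> (F (y, x))\<^sup>2) - 2 * (case p of (x, y) \<Rightarrow> (J x * \<phi> x) * (J y * \<phi> y)))"
  proof (rule ext)
    fix p :: "real \<times> real"
    obtain x y where p: "p = (x, y)" by (cases p)
    show "J (fst p) * J (snd p) * (gap p)\<^sup>2 = (F p)\<^sup>2 + (case p of (x, y) \<Rightarrow> (F (y, x))\<^sup>2) - 2 * (case p of (x, y) \<Rightarrow> (J x * \<phi> x) * (J y * \<phi> y))"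
      unfolding p gap_square prod.case F2 by (simp add: algebra_simps)
  qed
  then have "(\<integral>p. J (fst p) * J (snd p) * (gap p)\<^sup>2 \<partial>plane) = I + I - 2 * (mass \<phi> * mass \<phi>)"
    using F2i F2s pp by (simp add: I_def mass_def)
  with box_gap(2) have I: "I \<le> deficit / \<kappa> + (mass \<phi>)\<^sup>2" by (simp add: power2_eq_square)
  have G2: "(\<lambda>p. (G p)\<^sup>2) = (\<lambda>(x, y). (J x * (\<phi> x * \<psi> x)) * (J y * \<psi> y))"
    using psi_pos phi_nonneg by (auto simp: fun_eq_iff G_def power_mult_distrib less_imp_le split: split_indicator)
  have pp_int: "integrable lborel (\<lambda>x. J x * (\<phi> x * \<psi> x))"
    by (rule Bochner_Integration.integrable_bound[OF sq_int_mult[OF phi psi]]) (auto split: split_indicator)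
  have pp_le: "(\<integral>x. J x * (\<phi> x * \<psi> x) \<partial>lborel) \<le> ip \<phi> \<psi>"
    unfolding ip_def using psi_pos phi_nonneg
    by (intro integral_mono pp_int sq_int_mult phi psi) (auto simp: less_imp_le split: split_indicator)
  have G2i: "integrable plane (\<lambda>p. (G p)\<^sup>2)" "(\<integral>p. (G p)\<^sup>2 \<partial>plane) \<le> ip \<phi> \<psi> * mass \<psi>"
    unfolding G2 integral_product_real_line(2)[OF pp_int box_int(1)]
    using mult_right_mono[OF pp_le mass_nonneg(1)]
    by (auto simp: mass_def intro: integral_product_real_line pp_int box_int)
  have n_int: "integrable lborel (\<lambda>x. J x * (\<phi> x * sqrt (\<phi> x)))"
    by (rule integrable_three_halves_power[OF phi phi_nonneg])
  have sq: "sqrt (t / u) * sqrt (u * t) = t" if "0 < t" "0 < u" for t u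
    using that by (simp flip: real_sqrt_mult)
  have FG: "F (x, y) * G (x, y) = (J x * (\<phi> x * sqrt (\<phi> x))) * (J y * \<psi> y)" for x y
  proof -
    have "F (x, y) * G (x, y) = (J x * J x) * (J y * J y) * (\<phi> x * sqrt (\<phi> x)) * (sqrt (\<psi> y / \<psi> x) * sqrt (\<psi> x * \<psi> y))"
      by (simp add: F_def G_def mult_ac)
    then show ?thesis unfolding sq[OF psi_pos psi_pos] by (auto split: split_indicator)
  qed
  have FG': "(\<lambda>p. F p * G p) = (\<lambda>(x, y). (J x * (\<phi> x * sqrt (\<phi> x))) * (J y * \<psi> y))"
    by (auto simp: fun_eq_iff FG)
  have "(n * mass \<psi>)\<^sup>2 = (\<integral>p. F p * G p \<partial>plane)\<^sup>2"
    unfolding FG' integral_product_real_line(2)[OF n_int box_int(1)] by (simp add: n_def mass_def)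
  also have "\<dots> \<le> I * (\<integral>p. (G p)\<^sup>2 \<partial>plane)"
    unfolding I_def by (rule Cauchy_Schwarz_integral(3)) (use F2i G2i in auto)
  also have "\<dots> \<le> (deficit / \<kappa> + (mass \<phi>)\<^sup>2) * (ip \<phi> \<psi> * mass \<psi>)"
    using deficit_nonneg kappa by (intro mult_mono I G2i) auto
  finally have "mass \<psi> * (mass \<psi> * n\<^sup>2) \<le> mass \<psi> * ((deficit / \<kappa> + (mass \<phi>)\<^sup>2) * ip \<phi> \<psi>)"
    by (simp add: power_mult_distrib power2_eq_square mult_ac)
  then show ?thesis using pos by (simp add: n_def)
qed

end

section \<open>The two eigenvalue equations tested against each other\<close>

lemma energy_scale: "energy K (\<lambda>x. s * f x) (\<lambda>x. s * f x) = s\<^sup>2 * energy K f f"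
proof -
  have "(\<integral>(x, y). K x y * ((s * f x - s * f y) * (s * f x - s * f y)) \<partial>plane)
     = (\<integral>p. s\<^sup>2 * (case p of (x, y) \<Rightarrow> K x y * ((f x - f y) * (f x - f y))) \<partial>plane)"
    by (rule Bochner_Integration.integral_cong) (auto simp: power2_eq_square algebra_simps)
  then show ?thesis unfolding energy_def by simp
qed

lemma energy_diff_le:
  assumes K: "sym_kernel K C" and f: "sq_int f" and g: "sq_int g"
  shows "energy K (\<lambda>x. f x - g x) (\<lambda>x. f x - g x) \<le> 2 * energy K f f + 2 * energy K g g"
proof -
  let ?h = "\<lambda>x. f x - g x"
  let ?F = "\<lambda>f. (\<lambda>(x, y). K x y * ((f x - f y) * (f x - f y)))"
  have pw: "(u - v) * (u - v) \<le> 2 * (u * u) + 2 * (v * v)" for u v :: real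
    using zero_le_square[of "u + v"] by (simp add: algebra_simps)
  have "integral\<^sup>L plane (?F ?h) \<le> (\<integral>p. 2 * ?F f p + 2 * ?F g p \<partial>plane)"
  proof (rule integral_mono)
    show "integrable plane (?F ?h)" by (rule energy_eq(1)[OF K sq_int_diff[OF f g] sq_int_diff[OF f g]])
    show "integrable plane (\<lambda>p. 2 * ?F f p + 2 * ?F g p)"
      by (intro Bochner_Integration.integrable_add integrable_mult_right energy_eq(1)[OF K] f g)
    fix p :: "real \<times> real"
    obtain x y where p: "p = (x, y)" by (cases p)
    have "K x y * (((f x - f y) - (g x - g y)) * ((f x - f y) - (g x - g y)))
       \<le> K x y * (2 * ((f x - f y) * (f x - f y)) + 2 * ((g x - g y) * (g x - g y)))"
      by (intro mult_left_mono pw sym_kernel_nonneg[OF K])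
    also have "(f x - f y) - (g x - g y) = ?h x - ?h y" by simp
    finally show "?F ?h p \<le> 2 * ?F f p + 2 * ?F g p" unfolding p prod.case by (simp only: distrib_left mult.left_commute)
  qed
  also have "\<dots> = 2 * integral\<^sup>L plane (?F f) + 2 * integral\<^sup>L plane (?F g)"
    using energy_eq(1)[OF K f f] energy_eq(1)[OF K g g] by simp
  finally show ?thesis unfolding energy_def by simp
qed

lemma ip_linear_combination:
  assumes f: "sq_int f" and g: "sq_int g"
  shows "ip (\<lambda>x. s * f x - t * g x) (\<lambda>x. s * f x - t * g x) = s\<^sup>2 * ip f f + t\<^sup>2 * ip g g - 2 * s * t * ip f g"
proof -
  have "ip (\<lambda>x. s * f x - t * g x) (\<lambda>x. s * f x - t * g x)
     = (\<integral>x. s\<^sup>2 * (f x * f x) + t\<^sup>2 * (g x * g x) - 2 * s * t * (f x * g x) \<partial>lborel)"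
    unfolding ip_def by (rule Bochner_Integration.integral_cong) (auto simp: power2_eq_square algebra_simps)
  also have "\<dots> = s\<^sup>2 * ip f f + t\<^sup>2 * ip g g - 2 * s * t * ip f g"
    unfolding ip_def using sq_int_mult[OF f f] sq_int_mult[OF g g] sq_int_mult[OF f g] by simp
  finally show ?thesis .
qed

definition tail :: "real \<Rightarrow> (real \<Rightarrow> real) \<Rightarrow> real" where
  "tail R f = (\<integral>x. indicator (- {-R..R}) x * (f x)\<^sup>2 \<partial>lborel)"

lemma tail_integrable: 
  assumes f: "sq_int f" shows "integrable lborel (\<lambda>x. indicator (- {-R..R}) x * (f x)\<^sup>2)"
proof -
  note [measurable] = sq_int_measurable[OF f]
  show ?thesis
    by (rule Bochner_Integration.integrable_bound[OF sq_int_square[OF f]]) (auto split: split_indicator)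
qed

lemma tail_nonneg: "0 \<le> tail R f" unfolding tail_def by (auto intro!: integral_nonneg_AE)

lemma tail_linear_combination:
  assumes f: "sq_int f" and g: "sq_int g" and st: "0 \<le> s" "s \<le> 1" "0 \<le> t" "t \<le> 1"
  shows "tail R (\<lambda>x. s * f x - t * g x) \<le> 2 * tail R f + 2 * tail R g"
proof -
  have h: "sq_int (\<lambda>x. s * f x - t * g x)" by (intro sq_int_diff sq_int_scale f g)
  have pw: "(s * u - t * v)\<^sup>2 \<le> 2 * u\<^sup>2 + 2 * v\<^sup>2" for u v :: real
  proof -
    have "(s * u - t * v)\<^sup>2 \<le> 2 * (s * u)\<^sup>2 + 2 * (t * v)\<^sup>2"
      using zero_le_power2[of "s * u + t * v"] by (simp add: power2_sum power2_diff)
    also have "\<dots> \<le> 2 * (1 * u\<^sup>2) + 2 * (1 * v\<^sup>2)"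
      unfolding power_mult_distrib using st by (intro add_mono mult_left_mono mult_right_mono power_le_one) auto
    finally show ?thesis by simp
  qed
  have "tail R (\<lambda>x. s * f x - t * g x) \<le> (\<integral>x. 2 * (indicator (- {-R..R}) x * (f x)\<^sup>2) + 2 * (indicator (- {-R..R}) x * (g x)\<^sup>2) \<partial>lborel)"
    unfolding tail_def
    by (rule integral_mono[OF tail_integrable[OF h]])
      (use pw in \<open>auto intro!: Bochner_Integration.integrable_add integrable_mult_right tail_integrable f g split: split_indicator\<close>)
  also have "\<dots> = 2 * tail R f + 2 * tail R g"
    unfolding tail_def using tail_integrable[OF f] tail_integrable[OF g] by simp
  finally show ?thesis .
qed

lemma tail_tendsto_zero:
  assumes f: "sq_int f" shows "((\<lambda>R. tail R f) \<longlongrightarrow> 0) at_top"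
proof -
  note [measurable] = sq_int_measurable[OF f]
  have "((\<lambda>R. tail R f) \<longlongrightarrow> (\<integral>x. 0 \<partial>(lborel :: real measure))) at_top"
    unfolding tail_def
  proof (rule integral_dominated_convergence_at_top[where w = "\<lambda>x. (f x)\<^sup>2"])
    show "AE x in lborel. ((\<lambda>R. indicator (- {-R..R}) x * (f x)\<^sup>2) \<longlongrightarrow> 0) at_top"
    proof (intro AE_I2)
      fix x :: real
      have "eventually (\<lambda>R. indicator (- {-R..R}) x * (f x)\<^sup>2 = 0) at_top"
        using eventually_ge_at_top[of "\<bar>x\<bar>"] by eventually_elim (auto simp: abs_le_iff)
      then show "((\<lambda>R. indicator (- {-R..R}) x * (f x)\<^sup>2) \<longlongrightarrow> 0) at_top" by (rule tendsto_eventually)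
    qed
    show "\<forall>\<^sub>F R in at_top. AE x in lborel. norm (indicator (- {-R..R}) x * (f x)\<^sup>2) \<le> (f x)\<^sup>2"
      by (auto intro!: always_eventually split: split_indicator)
  qed (use sq_int_square[OF f] in auto)
  then show ?thesis by simp
qed

text \<open>The sequence \<open>\<psi>\<close> of positive eigenfunctions has the eigenvalues \<open>1 / a n - E n\<close> for the kernel of
  \<open>a\<^sup>-\<^sup>1 B\<^sub>a\<close>. The function \<open>w\<close> stands for \<open>\<bar>D\<bar> \<phi>\<close>, and the last assumption says that \<open>(1 - P\<^sub>a) \<phi> / a\<close>,
  with the Poisson semigroup \<open>P\<^sub>a\<close>, tends to \<open>w\<close> in \<open>L\<^sup>2\<close>.\<close>
locale eigenvalue_asymptotics = homogeneous_weight +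
  fixes a E \<eta> :: "nat \<Rightarrow> real" and \<psi> :: "nat \<Rightarrow> real \<Rightarrow> real" and \<phi> w :: "real \<Rightarrow> real" and lam :: real
  assumes a_pos: "0 < a n" and a_lim: "a \<longlonglongrightarrow> 0"
    and psi: "sq_int (\<psi> n)" and psi_norm: "ip (\<psi> n) (\<psi> n) = 1" and psi_pos: "0 < \<psi> n x"
    and psi_eig: "AE x in lborel. (\<integral>y. wcauchy T (a n) x y * \<psi> n y \<partial>lborel) = (1 / a n - E n) * \<psi> n x"
    and phi: "sq_int \<phi>" and phi_norm: "ip \<phi> \<phi> = 1" and phi_nonneg: "0 \<le> \<phi> x"
    and phi_weight: "sq_int (\<lambda>x. weight_bound x * \<phi> x)"
    and w: "sq_int w" and phi_eig: "AE x in lborel. w x + 1 / 2 * \<theta> x * \<phi> x = lam * \<phi> x"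
    and eta_lim: "\<eta> \<longlonglongrightarrow> 0"
    and eta: "sq_int g \<Longrightarrow> \<bar>ip \<phi> g / a n - form (cauchy (a n)) \<phi> g - ip w g\<bar> \<le> \<eta> n * sqrt (ip g g)"
begin

abbreviation k :: "nat \<Rightarrow> real \<Rightarrow> real \<Rightarrow> real" where "k n \<equiv> wcauchy T (a n)"
abbreviation q :: "nat \<Rightarrow> real \<Rightarrow> real \<Rightarrow> real" where "q n \<equiv> cauchy (a n)"
abbreviation V :: "nat \<Rightarrow> real \<Rightarrow> real \<Rightarrow> real" where "V n \<equiv> pot T (a n)"
abbreviation m :: "nat \<Rightarrow> real \<Rightarrow> real" where "m n \<equiv> rowint (V n)"
abbreviation overlap :: "nat \<Rightarrow> real" where "overlap n \<equiv> ip \<phi> (\<psi> n)"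

lemmas q_kernel = sym_kernel_cauchy[OF a_pos]
lemmas k_kernel = sym_kernel_wcauchy[OF a_pos]
lemmas V_kernel = sym_kernel_pot[OF a_pos]

lemma phi_meas [measurable]: "\<phi> \<in> borel_measurable borel" and psi_meas [measurable]: "\<psi> n \<in> borel_measurable borel"
  and m_meas [measurable]: "m n \<in> borel_measurable borel"
  using phi psi rowint_measurable[OF V_kernel] by (auto simp: sq_int_def)

lemma form_split:
  assumes f: "sq_int f" and g: "sq_int g"
  shows "form (q n) f g = form (k n) f g + form (V n) f g"
proof -
  have "form (q n) f g = (\<integral>p. (case p of (x, y) \<Rightarrow> k n x y * (f x * g y)) + (case p of (x, y) \<Rightarrow> V n x y * (f x * g y)) \<partial>plane)"
    unfolding form_def by (rule Bochner_Integration.integral_cong) (auto simp: pot_def algebra_simps)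
  also have "\<dots> = form (k n) f g + form (V n) f g"
    unfolding form_def by (intro Bochner_Integration.integral_add form_integrable[OF k_kernel f g] form_integrable[OF V_kernel f g])
  finally show ?thesis .
qed

lemma form_wcauchy_psi:
  assumes f: "sq_int f" shows "form (k n) f (\<psi> n) = (1 / a n - E n) * ip f (\<psi> n)"
proof -
  note [measurable] = sq_int_measurable[OF f] sym_kernel_measurable[OF k_kernel]
  have "form (k n) f (\<psi> n) = (\<integral>x. f x * (\<integral>y. k n x y * \<psi> n y \<partial>lborel) \<partial>lborel)"
    by (rule form_eq_iterated[OF k_kernel f psi])
  also have "\<dots> = (\<integral>x. (1 / a n - E n) * (f x * \<psi> n x) \<partial>lborel)"
  proof (rule integral_cong_AE)
    have "(\<lambda>x. \<integral>y. (\<lambda>p. k n (fst p) (snd p)) (x, y) * \<psi> n y \<partial>lborel) \<in> borel_measurable lborel"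
      by measurable
    then show "(\<lambda>x. f x * (\<integral>y. k n x y * \<psi> n y \<partial>lborel)) \<in> borel_measurable lborel" by simp
    show "AE x in lborel. f x * (\<integral>y. k n x y * \<psi> n y \<partial>lborel) = (1 / a n - E n) * (f x * \<psi> n x)"
      using psi_eig[of n] by eventually_elim simp
  qed simp
  finally show ?thesis by (simp add: ip_def)
qed

lemma form_V_psi_nonneg: "0 \<le> form (V n) (\<psi> n) (\<psi> n)"
  unfolding form_def using sym_kernel_nonneg[OF V_kernel] psi_pos
  by (intro integral_nonneg_AE AE_I2) (auto simp: case_prod_beta' less_imp_le)

text \<open>The equation of \<open>\<psi> n\<close> tested with \<open>\<psi> n\<close>. Both terms on the right are nonnegative, the second one by
  positivity of \<open>\<psi> n\<close>.\<close>
lemma E_eq: "E n = energy (q n) (\<psi> n) (\<psi> n) + form (V n) (\<psi> n) (\<psi> n)"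
  using form_cauchy_energy[OF a_pos psi psi, of n n n] form_split[OF psi psi, of n n n] form_wcauchy_psi[OF psi, of n n]
  by (simp add: psi_norm)

lemma energy_psi_le: "energy (q n) (\<psi> n) (\<psi> n) \<le> E n"
  using E_eq[of n] form_V_psi_nonneg[of n] by linarith

lemma energy_V_le: "sq_int f \<Longrightarrow> energy (V n) f f \<le> energy (q n) f f"
  by (rule energy_mono[OF V_kernel q_kernel pot_le_cauchy[OF a_pos]])

lemma E_nonneg: "0 \<le> E n"
  using energy_psi_le[of n] energy_nonneg[OF q_kernel, of n "\<psi> n"] by linarith

text \<open>Rewriting the form of \<open>V n\<close> by \<open>energy_eq\<close> produces the row integral and minus the Dirichlet form
  of \<open>V n\<close>, which is compensated by the larger Dirichlet form of \<open>q n\<close>.\<close>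
lemma row_psi_le: "(\<integral>x. m n x * (\<psi> n x)\<^sup>2 \<partial>lborel) \<le> E n"
  using E_eq[of n] energy_V_le[OF psi, of n n] energy_eq(2)[OF V_kernel psi psi, of n n n]
  by (simp add: power2_eq_square)

lemma theta_le: "AE x in lborel. \<theta> x / 2 \<le> weight_bound x / 2 + 2"
  using rowint_pot_tendsto[OF a_pos a_lim]
  by eventually_elim (rule LIMSEQ_le_const2, auto intro!: exI[of _ 0] rowint_pot_le a_pos)

lemma dominating_weight: "sq_int (\<lambda>x. (weight_bound x / 2 + 2) * \<phi> x)"
  using sq_int_add[OF sq_int_scale[OF phi_weight, of "1 / 2"] sq_int_scale[OF phi, of 2]]
  by (simp add: algebra_simps)

lemma sq_int_theta_phi: "sq_int (\<lambda>x. \<theta> x / 2 * \<phi> x)"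
proof (rule sq_int_bound[OF dominating_weight])
  show "AE x in lborel. \<bar>\<theta> x / 2 * \<phi> x\<bar> \<le> \<bar>(weight_bound x / 2 + 2) * \<phi> x\<bar>"
    using theta_le
  proof eventually_elim
    fix x assume "\<theta> x / 2 \<le> weight_bound x / 2 + 2"
    then have "\<bar>\<theta> x / 2\<bar> * \<bar>\<phi> x\<bar> \<le> \<bar>weight_bound x / 2 + 2\<bar> * \<bar>\<phi> x\<bar>"
      using theta_nonneg[of x] by (intro mult_right_mono) auto
    then show "\<bar>\<theta> x / 2 * \<phi> x\<bar> \<le> \<bar>(weight_bound x / 2 + 2) * \<phi> x\<bar>" by (simp only: abs_mult)
  qed
qed simp

lemma sq_int_row_phi: "sq_int (\<lambda>x. m n x * \<phi> x)"
proof (rule sq_int_bound[OF dominating_weight])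
  show "AE x in lborel. \<bar>m n x * \<phi> x\<bar> \<le> \<bar>(weight_bound x / 2 + 2) * \<phi> x\<bar>"
    using phi_nonneg rowint_bounds[OF V_kernel, of n] rowint_pot_le[OF a_pos] weight_bound_nonneg
    by (intro AE_I2) (simp add: abs_mult mult_right_mono)
qed simp

definition row_error :: "nat \<Rightarrow> real" where
  "row_error n = ip (\<lambda>x. m n x * \<phi> x - \<theta> x / 2 * \<phi> x) (\<lambda>x. m n x * \<phi> x - \<theta> x / 2 * \<phi> x)"

lemma row_error_tendsto: "row_error \<longlonglongrightarrow> 0"
proof -
  have "(\<lambda>n. \<integral>x. (m n x * \<phi> x - \<theta> x / 2 * \<phi> x)\<^sup>2 \<partial>lborel) \<longlonglongrightarrow> (\<integral>x. 0 \<partial>(lborel :: real measure))"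
  proof (rule integral_dominated_convergence[OF _ _ sq_int_square[OF dominating_weight]])
    show "AE x in lborel. (\<lambda>n. (m n x * \<phi> x - \<theta> x / 2 * \<phi> x)\<^sup>2) \<longlonglongrightarrow> 0"
      using rowint_pot_tendsto[OF a_pos a_lim]
    proof eventually_elim
      fix x assume "(\<lambda>n. m n x) \<longlonglongrightarrow> \<theta> x / 2"
      then have "(\<lambda>n. (m n x * \<phi> x - \<theta> x / 2 * \<phi> x)\<^sup>2) \<longlonglongrightarrow> (\<theta> x / 2 * \<phi> x - \<theta> x / 2 * \<phi> x)\<^sup>2"
        by (intro tendsto_intros)
      then show "(\<lambda>n. (m n x * \<phi> x - \<theta> x / 2 * \<phi> x)\<^sup>2) \<longlonglongrightarrow> 0" by simp
    qed
    fix n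
    show "AE x in lborel. norm ((m n x * \<phi> x - \<theta> x / 2 * \<phi> x)\<^sup>2) \<le> ((weight_bound x / 2 + 2) * \<phi> x)\<^sup>2"
      using theta_le
    proof eventually_elim
      fix x assume "\<theta> x / 2 \<le> weight_bound x / 2 + 2"
      then have "\<bar>m n x - \<theta> x / 2\<bar> \<le> \<bar>weight_bound x / 2 + 2\<bar>"
        using rowint_bounds(1)[OF V_kernel, of n x] rowint_pot_le[OF a_pos, of n x] theta_nonneg[of x] by linarith
      then have "\<bar>m n x - \<theta> x / 2\<bar> * \<bar>\<phi> x\<bar> \<le> \<bar>weight_bound x / 2 + 2\<bar> * \<bar>\<phi> x\<bar>" by (rule mult_right_mono) simp
      then have "\<bar>(m n x - \<theta> x / 2) * \<phi> x\<bar> \<le> \<bar>(weight_bound x / 2 + 2) * \<phi> x\<bar>" by (simp only: abs_mult)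
      then have "((m n x - \<theta> x / 2) * \<phi> x)\<^sup>2 \<le> ((weight_bound x / 2 + 2) * \<phi> x)\<^sup>2" by (simp only: abs_le_square_iff)
      then show "norm ((m n x * \<phi> x - \<theta> x / 2 * \<phi> x)\<^sup>2) \<le> ((weight_bound x / 2 + 2) * \<phi> x)\<^sup>2"
        by (simp add: left_diff_distrib)
    qed
  qed simp_all
  then show ?thesis by (simp add: row_error_def[abs_def] ip_same)
qed

lemma energy_phi_tendsto: "(\<lambda>n. energy (q n) \<phi> \<phi>) \<longlonglongrightarrow> ip w \<phi>"
proof -
  have "\<bar>energy (q n) \<phi> \<phi> - ip w \<phi>\<bar> \<le> \<eta> n" for n
    using eta[OF phi, of n] unfolding form_cauchy_energy[OF a_pos phi phi] by (simp add: phi_norm)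
  then have "(\<lambda>n. energy (q n) \<phi> \<phi> - ip w \<phi>) \<longlonglongrightarrow> 0"
    by (intro Lim_null_comparison[OF _ eta_lim]) auto
  then show ?thesis by (simp add: LIM_zero_iff)
qed

text \<open>The Dirichlet forms of \<open>q n\<close> at \<open>\<phi>\<close> are bounded since they converge to \<open>\<langle>\<bar>D\<bar> \<phi>, \<phi>\<rangle>\<close>; Fatou's lemma
  passes to the limit kernel. Where \<open>x = y\<close> the integrand is 0.\<close>
lemma gagliardo_integrable:
  "integrable plane (\<lambda>(x, y). 1 / (pi * (x - y)\<^sup>2) * ((\<phi> x - \<phi> y) * (\<phi> x - \<phi> y)))"
proof -
  let ?g = "\<lambda>p. 1 / (pi * (fst p - snd p)\<^sup>2) * ((\<phi> (fst p) - \<phi> (snd p)) * (\<phi> (fst p) - \<phi> (snd p)))"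
  let ?h = "\<lambda>n p. q n (fst p) (snd p) * ((\<phi> (fst p) - \<phi> (snd p)) * (\<phi> (fst p) - \<phi> (snd p)))"
  obtain M where M: "\<And>n. norm (energy (q n) \<phi> \<phi>) \<le> M"
    using convergent_imp_Bseq[OF convergentI[OF energy_phi_tendsto]] by (auto simp: Bseq_def)
  have hM: "(\<integral>\<^sup>+p. ennreal (?h n p) \<partial>plane) \<le> ennreal (2 * M)" for n
  proof -
    have "(\<integral>\<^sup>+p. ennreal (?h n p) \<partial>plane) = ennreal (\<integral>p. ?h n p \<partial>plane)"
      by (rule nn_integral_eq_integral)
        (use energy_eq(1)[OF q_kernel phi phi, of n] cauchy_nonneg in \<open>auto simp: case_prod_beta'\<close>)
    also have "(\<integral>p. ?h n p \<partial>plane) = 2 * energy (q n) \<phi> \<phi>" by (simp add: energy_def case_prod_beta')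
    also have "ennreal (2 * energy (q n) \<phi> \<phi>) \<le> ennreal (2 * M)" using M[of n] by (intro ennreal_leI) auto
    finally show ?thesis .
  qed
  have lim: "liminf (\<lambda>n. ennreal (?h n p)) = ennreal (?g p)" for p
  proof -
    have "(\<lambda>n. ?h n p) \<longlonglongrightarrow> ?g p"
    proof (cases "fst p = snd p")
      case False
      then have nz: "(fst p - snd p)\<^sup>2 \<noteq> 0" by simp
      have "(\<lambda>n. ?h n p) \<longlonglongrightarrow> 1 / (pi * (0\<^sup>2 + (fst p - snd p)\<^sup>2)) * ((\<phi> (fst p) - \<phi> (snd p)) * (\<phi> (fst p) - \<phi> (snd p)))"
        unfolding cauchy_def by (intro tendsto_intros a_lim) (use nz in auto)
      then show ?thesis by simp
    qed simp
    then have "(\<lambda>n. ennreal (?h n p)) \<longlonglongrightarrow> ennreal (?g p)" by (rule tendsto_ennrealI)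
    then show ?thesis by (rule lim_imp_Liminf[OF sequentially_bot])
  qed
  have "integrable plane ?g"
  proof (rule integrableI_bounded)
    have "(\<integral>\<^sup>+p. ennreal (norm (?g p)) \<partial>plane) = (\<integral>\<^sup>+p. liminf (\<lambda>n. ennreal (?h n p)) \<partial>plane)"
      unfolding lim by (rule nn_integral_cong) simp
    also have "\<dots> \<le> liminf (\<lambda>n. \<integral>\<^sup>+p. ennreal (?h n p) \<partial>plane)"
      by (rule nn_integral_liminf) (unfold cauchy_def, measurable)
    also have "\<dots> \<le> liminf (\<lambda>n. ennreal (2 * M))" by (rule Liminf_mono) (use hM in auto)
    also have "\<dots> < \<infinity>" by (simp add: Liminf_const)
    finally show "(\<integral>\<^sup>+p. ennreal (norm (?g p)) \<partial>plane) < \<infinity>" .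
  qed measurable
  then show ?thesis by (simp add: case_prod_beta')
qed

lemma energy_V_phi_tendsto: "(\<lambda>n. energy (V n) \<phi> \<phi>) \<longlonglongrightarrow> 0"
proof -
  have "(\<lambda>n. \<integral>(x, y). V n x y * ((\<phi> x - \<phi> y) * (\<phi> x - \<phi> y)) \<partial>plane) \<longlonglongrightarrow> (\<integral>p. 0 \<partial>plane)"
  proof (rule integral_dominated_convergence[OF _ _ gagliardo_integrable])
    show "AE p in plane. (\<lambda>n. case p of (x, y) \<Rightarrow> V n x y * ((\<phi> x - \<phi> y) * (\<phi> x - \<phi> y))) \<longlonglongrightarrow> 0"
    proof (intro AE_I2)
      fix p :: "real \<times> real"
      obtain x y where p: "p = (x, y)" by (cases p)
      show "(\<lambda>n. case p of (x, y) \<Rightarrow> V n x y * ((\<phi> x - \<phi> y) * (\<phi> x - \<phi> y))) \<longlonglongrightarrow> 0"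
        unfolding p prod.case
        using tendsto_mult_right[OF pot_tendsto_zero[OF a_pos a_lim, of x y], of "(\<phi> x - \<phi> y) * (\<phi> x - \<phi> y)"]
        by (cases "x = y") auto
    qed
    fix n
    show "AE p in plane. norm (case p of (x, y) \<Rightarrow> V n x y * ((\<phi> x - \<phi> y) * (\<phi> x - \<phi> y)))
       \<le> (case p of (x, y) \<Rightarrow> 1 / (pi * (x - y)\<^sup>2) * ((\<phi> x - \<phi> y) * (\<phi> x - \<phi> y)))"
    proof (intro AE_I2)
      fix p :: "real \<times> real"
      obtain x y where p: "p = (x, y)" by (cases p)
      show "norm (case p of (x, y) \<Rightarrow> V n x y * ((\<phi> x - \<phi> y) * (\<phi> x - \<phi> y)))
       \<le> (case p of (x, y) \<Rightarrow> 1 / (pi * (x - y)\<^sup>2) * ((\<phi> x - \<phi> y) * (\<phi> x - \<phi> y)))"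
      proof (cases "x = y")
        case False
        have "V n x y \<le> 1 / (pi * ((a n)\<^sup>2 + (x - y)\<^sup>2))"
          using pot_le_cauchy[OF a_pos, of n x y] by (simp add: cauchy_def)
        also have "\<dots> \<le> 1 / (pi * (x - y)\<^sup>2)"
          using False cauchy_denominator_pos[OF a_pos, of n "x - y"] by (intro divide_left_mono mult_left_mono mult_pos_pos) auto
        finally have "V n x y * ((\<phi> x - \<phi> y) * (\<phi> x - \<phi> y)) \<le> 1 / (pi * (x - y)\<^sup>2) * ((\<phi> x - \<phi> y) * (\<phi> x - \<phi> y))"
          by (rule mult_right_mono) simp
        then show ?thesis using pot_nonneg[OF a_pos, of n x y] unfolding p prod.case by simp
      qed (simp add: p)
    qed
    show "(\<lambda>(x, y). V n x y * ((\<phi> x - \<phi> y) * (\<phi> x - \<phi> y))) \<in> borel_measurable plane"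
      using energy_eq(1)[OF V_kernel phi phi, of n] by simp
  qed simp
  then have "(\<lambda>n. 1 / 2 * (\<integral>(x, y). V n x y * ((\<phi> x - \<phi> y) * (\<phi> x - \<phi> y)) \<partial>plane)) \<longlonglongrightarrow> 1 / 2 * (\<integral>p. 0 \<partial>plane)"
    by (rule tendsto_mult_left)
  then show ?thesis by (simp add: energy_def)
qed

text \<open>The equation \<open>w + \<theta> \<phi> / 2 = lam \<phi>\<close> tested with \<open>g\<close>, in which \<open>w\<close> is replaced by its approximation and
  \<open>\<theta> / 2\<close> by the row integral of \<open>V n\<close>; \<open>energy_eq\<close> turns the latter into the form of \<open>V n\<close>.\<close>
lemma eigenfunction_test:
  assumes g: "sq_int g" "ip g g = 1"
  shows "\<bar>(ip \<phi> g / a n - form (q n) \<phi> g + form (V n) \<phi> g) - lam * ip \<phi> g + energy (V n) \<phi> g\<bar> \<le> \<eta> n + sqrt (row_error n)"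
proof -
  note [measurable] = sq_int_measurable[OF g(1)] sq_int_measurable[OF w]
  have 1: "\<bar>ip \<phi> g / a n - form (q n) \<phi> g - ip w g\<bar> \<le> \<eta> n"
    using eta[OF g(1), of n] g(2) by simp
  have row: "form (V n) \<phi> g = ip (\<lambda>x. m n x * \<phi> x) g - energy (V n) \<phi> g"
    using energy_eq(2)[OF V_kernel phi g(1), of n] by (simp add: ip_def mult.assoc)
  have "ip w g = (\<integral>x. lam * (\<phi> x * g x) - \<theta> x / 2 * \<phi> x * g x \<partial>lborel)"
    unfolding ip_def
  proof (rule integral_cong_AE)
    show "AE x in lborel. w x * g x = lam * (\<phi> x * g x) - \<theta> x / 2 * \<phi> x * g x"
      using phi_eig
    proof eventually_elim
      fix x assume "w x + 1 / 2 * \<theta> x * \<phi> x = lam * \<phi> x"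
      then have "w x = lam * \<phi> x - \<theta> x / 2 * \<phi> x" by simp
      then show "w x * g x = lam * (\<phi> x * g x) - \<theta> x / 2 * \<phi> x * g x" by (simp add: left_diff_distrib)
    qed
  qed simp_all
  also have "\<dots> = lam * ip \<phi> g - ip (\<lambda>x. \<theta> x / 2 * \<phi> x) g"
    unfolding ip_def using sq_int_mult[OF phi g(1)] sq_int_mult[OF sq_int_theta_phi g(1)] by simp
  finally have 2: "ip w g = lam * ip \<phi> g - ip (\<lambda>x. \<theta> x / 2 * \<phi> x) g" .
  have eq: "ip (\<lambda>x. m n x * \<phi> x) g - ip (\<lambda>x. \<theta> x / 2 * \<phi> x) g = ip (\<lambda>x. m n x * \<phi> x - \<theta> x / 2 * \<phi> x) g"
    unfolding ip_def left_diff_distrib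
    by (rule Bochner_Integration.integral_diff[symmetric]) (intro sq_int_mult sq_int_row_phi sq_int_theta_phi g)+
  have 3: "\<bar>ip (\<lambda>x. m n x * \<phi> x) g - ip (\<lambda>x. \<theta> x / 2 * \<phi> x) g\<bar> \<le> sqrt (row_error n)"
    unfolding eq
    using ip_Cauchy_Schwarz[OF sq_int_diff[OF sq_int_row_phi sq_int_theta_phi] g(1), of n] g(2)
    by (simp add: row_error_def)
  show ?thesis using 1 2 3 row by linarith
qed

text \<open>The deficit in the ground state representation of \<open>\<phi>\<close> with respect to \<open>\<psi> n\<close>.\<close>
definition deficit :: "nat \<Rightarrow> real" where "deficit n = (1 / a n - E n) - form (k n) \<phi> \<phi>"

text \<open>Both eigenvalue equations are used, each tested with the other eigenfunction. The Dirichlet form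
  of \<open>V n\<close> at the pair is bounded by the Cauchy--Schwarz inequality, since at \<open>\<psi> n\<close> it is at most
  \<open>E n\<close>.\<close>
lemma overlap_identity: "\<bar>(E n - lam) * overlap n\<bar> \<le> \<eta> n + sqrt (row_error n) + sqrt (energy (V n) \<phi> \<phi>) * sqrt (E n)"
proof -
  have "sqrt (energy (V n) (\<psi> n) (\<psi> n)) \<le> sqrt (E n)"
    using order_trans[OF energy_V_le[OF psi] energy_psi_le] by simp
  then have "sqrt (energy (V n) \<phi> \<phi>) * sqrt (energy (V n) (\<psi> n) (\<psi> n)) \<le> sqrt (energy (V n) \<phi> \<phi>) * sqrt (E n)"
    by (rule mult_left_mono) (simp add: energy_nonneg[OF V_kernel])
  with energy_Cauchy_Schwarz[OF V_kernel phi psi, of n n]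
  have 1: "\<bar>energy (V n) \<phi> (\<psi> n)\<bar> \<le> sqrt (energy (V n) \<phi> \<phi>) * sqrt (E n)" by (rule order_trans)
  have 2: "overlap n / a n - form (q n) \<phi> (\<psi> n) + form (V n) \<phi> (\<psi> n) = E n * overlap n"
    using form_split[OF phi psi, of n n] form_wcauchy_psi[OF phi, of n] by (simp add: algebra_simps)
  have "(E n - lam) * overlap n = E n * overlap n - lam * overlap n" by (simp add: algebra_simps)
  with eigenfunction_test[OF psi psi_norm, of n n, unfolded 2] 1 show ?thesis by linarith
qed

lemma deficit_eq: "\<bar>deficit n - (lam - E n)\<bar> \<le> \<eta> n + sqrt (row_error n) + energy (V n) \<phi> \<phi>"
proof -
  have "1 / a n - form (q n) \<phi> \<phi> + form (V n) \<phi> \<phi> = deficit n + E n"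
    using form_split[OF phi phi, of n] by (simp add: deficit_def)
  then show ?thesis using eigenfunction_test[OF phi phi_norm, of n] energy_nonneg[OF V_kernel, of n \<phi>]
    unfolding phi_norm by (simp add: abs_le_iff)
qed

end

section \<open>Convergence of eigenvalues and eigenfunctions\<close>

context eigenvalue_asymptotics
begin

definition box_bound :: "real \<Rightarrow> real" where
  "box_bound R = 1 / (pi * (1 + 4 * R\<^sup>2 + C * (2 * R) powr \<gamma>))"

lemma box_bound_pos: "0 < box_bound R"
  unfolding box_bound_def using C_pos by (intro divide_pos_pos mult_pos_pos add_pos_nonneg) auto

text \<open>On bounded sets the kernels are bounded below uniformly in \<open>a \<le> 1\<close>, since the limit kernel
  \<open>1 / (\<pi> (x - y)\<^sup>2)\<close> is positive.\<close>
lemma wcauchy_ge_box_bound: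
  assumes a: "a n \<le> 1" and x: "x \<in> {-R..R}" and y: "y \<in> {-R..R}"
  shows "box_bound R \<le> k n x y"
proof -
  have a1: "(a n)\<^sup>2 \<le> 1" "(a n) ^ 3 \<le> 1" using a a_pos[of n] by (auto simp: power_le_one)
  have "\<bar>x - y\<bar> \<le> \<bar>2 * R\<bar>" using x y by auto
  then have z: "(x - y)\<^sup>2 \<le> 4 * R\<^sup>2" unfolding abs_le_square_iff by (simp add: power_mult_distrib)
  have "(\<bar>x\<bar> + \<bar>y\<bar>) powr \<gamma> \<le> (2 * R) powr \<gamma>" using x y gamma by (intro powr_mono2) auto
  then have "C * (\<bar>x\<bar> + \<bar>y\<bar>) powr \<gamma> \<le> C * (2 * R) powr \<gamma>" using C_pos by (intro mult_left_mono) auto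
  then have T: "T x y \<le> C * (2 * R) powr \<gamma>" using T_upper[of x y] by linarith
  have "a n ^ 3 * T x y \<le> 1 * T x y" by (intro mult_right_mono a1 T_nonneg)
  then have le: "(a n)\<^sup>2 + (x - y)\<^sup>2 + a n ^ 3 * T x y \<le> 1 + 4 * R\<^sup>2 + C * (2 * R) powr \<gamma>"
    using a1 z T by linarith
  have pos: "0 < (a n)\<^sup>2 + (x - y)\<^sup>2 + a n ^ 3 * T x y"
    using cauchy_denominator_pos[OF a_pos, of n "x - y"] wcauchy_denominator[OF a_pos, of n x y] by linarith
  with le have pos': "0 < 1 + 4 * R\<^sup>2 + C * (2 * R) powr \<gamma>" by linarith
  show ?thesis unfolding box_bound_def wcauchy_def
    by (intro divide_left_mono mult_left_mono mult_pos_pos le pos pos') auto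
qed

lemma ground_state: "a n \<le> 1 \<Longrightarrow> ground_state_on_box (k n) (1 / a n) (1 / a n - E n) R (box_bound R) (\<psi> n) \<phi>"
  by unfold_locales
    (use k_kernel psi psi_pos phi phi_nonneg psi_eig box_bound_pos wcauchy_ge_box_bound in auto)

abbreviation mass :: "real \<Rightarrow> (real \<Rightarrow> real) \<Rightarrow> real" where
  "mass R f \<equiv> (\<integral>x. indicator {-R..R} x * f x \<partial>lborel)"

lemma deficit_nonneg: "a n \<le> 1 \<Longrightarrow> 0 \<le> deficit n"
  using ground_state_on_box.deficit_nonneg[OF ground_state[of n 0]]
  by (simp add: ground_state_on_box.deficit_def[OF ground_state[of n 0]] deficit_def phi_norm)

lemma proportional_on_box:
  assumes "a n \<le> 1"
  shows "mass R (\<lambda>x. \<bar>mass R (\<psi> n) * \<phi> x - mass R \<phi> * \<psi> n x\<bar>) \<le> mass R (\<psi> n) * sqrt (2 * deficit n / box_bound R)"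
  using ground_state_on_box.proportional_on_box[OF ground_state[OF assms, of R]]
  by (simp add: ground_state_on_box.deficit_def[OF ground_state[OF assms]]
      ground_state_on_box.mass_def[OF ground_state[OF assms]] deficit_def phi_norm)

lemma overlap_lower_bound:
  assumes "a n \<le> 1" "0 < mass R (\<psi> n)"
  shows "mass R (\<psi> n) * (mass R (\<lambda>x. \<phi> x * sqrt (\<phi> x)))\<^sup>2 \<le> (deficit n / box_bound R + (mass R \<phi>)\<^sup>2) * overlap n"
  using ground_state_on_box.overlap_lower_bound[OF ground_state[OF assms(1), of R]] assms(2)
  by (simp add: ground_state_on_box.deficit_def[OF ground_state[OF assms(1)]]
      ground_state_on_box.mass_def[OF ground_state[OF assms(1)]] deficit_def phi_norm)

lemma overlap_nonneg: "0 \<le> overlap n"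
  unfolding ip_def using phi_nonneg psi_pos by (intro integral_nonneg_AE AE_I2) (simp add: less_imp_le)

lemma overlap_le_1: "overlap n \<le> 1"
  using ip_Cauchy_Schwarz[OF phi psi, of n] by (simp add: phi_norm psi_norm)

lemma eventually_a_less: "0 < d \<Longrightarrow> eventually (\<lambda>n. a n < d) sequentially"
  using a_lim by (rule order_tendstoD(2))

text \<open>A common bound, for all large \<open>n\<close>, of \<open>E n\<close>, of the deficit and of the Dirichlet forms of \<open>\<phi>\<close> and
  \<open>\<psi> n\<close>.\<close>
definition form_cap :: real where "form_cap = max 1 (max (lam + 1) (ip w \<phi> + 1))"

definition err :: "nat \<Rightarrow> real" where "err n = \<eta> n + sqrt (row_error n) + energy (V n) \<phi> \<phi>"

lemma err_tendsto: "err \<longlonglongrightarrow> 0"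
proof -
  have "err \<longlonglongrightarrow> 0 + sqrt 0 + 0"
    unfolding err_def[abs_def] by (intro tendsto_intros eta_lim row_error_tendsto energy_V_phi_tendsto)
  then show ?thesis by simp
qed

definition capped :: "nat \<Rightarrow> bool" where
  "capped n \<longleftrightarrow> a n \<le> 1 \<and> E n \<le> form_cap \<and> deficit n \<le> form_cap \<and> energy (q n) \<phi> \<phi> \<le> form_cap"

lemma eventually_capped: "eventually (\<lambda>n. capped n) sequentially"
proof -
  have "eventually (\<lambda>n. energy (q n) \<phi> \<phi> < ip w \<phi> + 1) sequentially"
    by (rule order_tendstoD(2)[OF energy_phi_tendsto]) simp
  moreover have "eventually (\<lambda>n. err n < 1) sequentially" by (rule order_tendstoD(2)[OF err_tendsto]) simp
  moreover have "eventually (\<lambda>n. a n < 1) sequentially" by (rule eventually_a_less) simp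
  ultimately show ?thesis
  proof eventually_elim
    fix n assume *: "energy (q n) \<phi> \<phi> < ip w \<phi> + 1" "err n < 1" "a n < 1"
    have d: "\<bar>deficit n - (lam - E n)\<bar> \<le> err n" using deficit_eq[of n] by (simp add: err_def)
    have "0 \<le> deficit n" using * by (intro deficit_nonneg) simp
    then show "capped n"
      using * d E_nonneg[of n] unfolding form_cap_def capped_def by linarith
  qed
qed

lemma form_cap_ge_1: "1 \<le> form_cap" by (simp add: form_cap_def)

text \<open>Outside \<open>{-R..R}\<close> the row integral of \<open>V n\<close> is at least of the order \<open>R powr \<gamma>\<close>, hence of the order
  \<open>R\<close>, while its integral against \<open>(\<psi> n)\<^sup>2\<close> is at most \<open>E n\<close>.\<close>
lemma tail_psi:
  assumes R: "1 \<le> R" and small: "a n * (c * R powr \<gamma>) \<le> 1" and E: "E n \<le> form_cap"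
  shows "tail R (\<psi> n) \<le> form_cap * (3 * pi) / (c * R)"
proof -
  define t where "t = c * R powr \<gamma> / (3 * pi)"
  have "R powr 1 \<le> R powr \<gamma>" using R gamma by (intro powr_mono) auto
  then have Rg: "R \<le> R powr \<gamma>" using R by simp
  have t: "c * R / (3 * pi) \<le> t" "0 < c * R / (3 * pi)" unfolding t_def
    using Rg c_pos R by (auto intro!: divide_right_mono mult_left_mono)
  have pw: "t * (indicator (- {-R..R}) x * (\<psi> n x)\<^sup>2) \<le> m n x * (\<psi> n x)\<^sup>2" for x
  proof (cases "x \<in> {-R..R}")
    case False
    then have "t \<le> m n x" unfolding t_def using R by (intro rowint_pot_ge a_pos small) auto
    then show ?thesis using False by (simp add: mult_right_mono)
  qed (use rowint_bounds[OF V_kernel] in simp)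
  have mi: "integrable lborel (\<lambda>x. m n x * (\<psi> n x)\<^sup>2)"
    by (rule Bochner_Integration.integrable_bound[OF integrable_mult_right[OF sq_int_square[OF psi[of n]], of "1 / a n"]])
      (use rowint_bounds[OF V_kernel, of n] a_pos[of n] in \<open>auto simp: abs_mult simp del: times_divide_eq_left intro!: mult_right_mono AE_I2\<close>)
  have "t * tail R (\<psi> n) \<le> (\<integral>x. m n x * (\<psi> n x)\<^sup>2 \<partial>lborel)"
    unfolding tail_def integral_mult_right_zero[symmetric]
    by (rule integral_mono[OF _ mi pw]) (intro integrable_mult_right tail_integrable psi)
  also have "\<dots> \<le> form_cap" using row_psi_le[of n] E by linarith
  finally have "t * tail R (\<psi> n) \<le> form_cap" .
  moreover have "c * R / (3 * pi) * tail R (\<psi> n) \<le> t * tail R (\<psi> n)" by (intro mult_right_mono t tail_nonneg)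
  ultimately have "c * R / (3 * pi) * tail R (\<psi> n) \<le> form_cap" by linarith
  then show ?thesis using c_pos R by (simp add: field_simps)
qed

lemma eventually_tail_psi:
  assumes "0 < \<tau>"
  shows "\<exists>R0. \<forall>R\<ge>R0. eventually (\<lambda>n. tail R (\<psi> n) \<le> \<tau>) sequentially"
proof (intro exI allI impI)
  fix R assume R: "max 1 (form_cap * (3 * pi) / (c * \<tau>)) \<le> R"
  then have R1: "1 \<le> R" "form_cap * (3 * pi) / (c * \<tau>) \<le> R" by auto
  have cR: "0 < c * R powr \<gamma>" using c_pos R1 by simp
  have le: "form_cap * (3 * pi) / (c * R) \<le> \<tau>" using R1 c_pos assms by (simp add: field_simps)
  have "eventually (\<lambda>n. a n < 1 / (c * R powr \<gamma>)) sequentially" using cR by (intro eventually_a_less) simp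
  with eventually_capped show "eventually (\<lambda>n. tail R (\<psi> n) \<le> \<tau>) sequentially"
  proof eventually_elim
    fix n assume *: "capped n" "a n < 1 / (c * R powr \<gamma>)"
    note * = *[unfolded capped_def]
    have "a n * (c * R powr \<gamma>) \<le> 1" using * cR by (simp add: pos_less_divide_eq less_imp_le)
    then show "tail R (\<psi> n) \<le> \<tau>" using tail_psi[OF R1(1)] * le by fastforce
  qed
qed

lemma eventually_energy_le:
  assumes "0 < d" shows "eventually (\<lambda>n. energy (cauchy d) (\<psi> n) (\<psi> n) \<le> form_cap \<and> energy (cauchy d) \<phi> \<phi> \<le> form_cap) sequentially"
  using eventually_capped eventually_a_less[OF assms]
proof eventually_elim
  fix n assume *: "capped n" "a n < d"
    note * = *[unfolded capped_def]
  have "energy (cauchy d) f f \<le> energy (q n) f f" if "sq_int f" for f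
    by (rule energy_mono[OF sym_kernel_cauchy[OF assms] q_kernel cauchy_antimono that]) (use * a_pos in auto)
  from this[OF psi, of n] this[OF phi] show "energy (cauchy d) (\<psi> n) (\<psi> n) \<le> form_cap \<and> energy (cauchy d) \<phi> \<phi> \<le> form_cap"
    using * energy_psi_le[of n] by linarith
qed

text \<open>If \<open>\<psi> n\<close> had small integral over a large box, then the Nash-type inequality with a small fixed
  scale \<open>d\<close> would contradict the normalization.\<close>
lemma eventually_mass_psi:
  "\<exists>p0>0. \<exists>R0. \<forall>R\<ge>R0. eventually (\<lambda>n. p0 \<le> mass R (\<psi> n)) sequentially"
proof -
  \<comment> \<open>With this scale and a tail of at most \<open>1/64\<close>, energy and tail account for at most half of the norm.\<close>
  define d where "d = 1 / (4 * form_cap)"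
  define p0 where "p0 = sqrt (pi * d / 4)"
  have d: "0 < d" "d * form_cap = 1 / 4" using form_cap_ge_1 by (auto simp: d_def)
  obtain R0 where R0: "\<forall>R\<ge>R0. eventually (\<lambda>n. tail R (\<psi> n) \<le> (1 / 8)\<^sup>2) sequentially"
    using eventually_tail_psi[of "(1/8)\<^sup>2"] by auto
  have "\<forall>R\<ge>R0. eventually (\<lambda>n. p0 \<le> mass R (\<psi> n)) sequentially"
  proof (intro allI impI)
    fix R assume "R0 \<le> R"
    with R0 have "eventually (\<lambda>n. tail R (\<psi> n) \<le> (1 / 8)\<^sup>2) sequentially" by blast
    with eventually_energy_le[OF d(1)] show "eventually (\<lambda>n. p0 \<le> mass R (\<psi> n)) sequentially"
    proof eventually_elim
      fix n assume e: "energy (cauchy d) (\<psi> n) (\<psi> n) \<le> form_cap \<and> energy (cauchy d) \<phi> \<phi> \<le> form_cap" and t: "tail R (\<psi> n) \<le> (1 / 8)\<^sup>2"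
      have "sqrt (tail R (\<psi> n)) \<le> sqrt ((1 / 8)\<^sup>2)" using t by (rule real_sqrt_le_mono)
      then have t': "sqrt (tail R (\<psi> n)) \<le> 1 / 8" by simp
      have en: "d * energy (cauchy d) (\<psi> n) (\<psi> n) \<le> 1 / 4"
        using mult_left_mono[of "energy (cauchy d) (\<psi> n) (\<psi> n)" form_cap d] e d by simp
      have abs: "\<bar>\<psi> n x\<bar> = \<psi> n x" for x using psi_pos[of n x] by simp
      have "1 \<le> d * energy (cauchy d) (\<psi> n) (\<psi> n) + (mass R (\<psi> n))\<^sup>2 / (pi * d) + 2 * sqrt (tail R (\<psi> n))"
        using Nash_type_inequality[OF d(1) psi, of n R] by (simp add: psi_norm tail_def abs)
      then have "1 / 4 \<le> (mass R (\<psi> n))\<^sup>2 / (pi * d)" using t' en by linarith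
      then have "pi * d / 4 \<le> (mass R (\<psi> n))\<^sup>2" using d by (simp add: field_simps)
      then have "p0 \<le> sqrt ((mass R (\<psi> n))\<^sup>2)" unfolding p0_def by (rule real_sqrt_le_mono)
      moreover have "0 \<le> mass R (\<psi> n)" using psi_pos by (intro integral_nonneg_AE AE_I2) (simp add: less_imp_le)
      ultimately show "p0 \<le> mass R (\<psi> n)" by simp
    qed
  qed
  moreover have "0 < p0" using d by (simp add: p0_def)
  ultimately show ?thesis by blast
qed

lemma mass_phi_pos: "\<exists>R0. \<forall>R\<ge>R0. 0 < mass R (\<lambda>x. \<phi> x * sqrt (\<phi> x))"
proof -
  have "eventually (\<lambda>R. tail R \<phi> < 1) at_top" by (rule order_tendstoD(2)[OF tail_tendsto_zero[OF phi]]) simp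
  then obtain R0 where R0: "\<And>R. R \<ge> R0 \<Longrightarrow> tail R \<phi> < 1" by (auto simp: eventually_at_top_linorder)
  have "0 < mass R (\<lambda>x. \<phi> x * sqrt (\<phi> x))" if R: "R \<ge> R0" for R
  proof -
    let ?f = "\<lambda>x. indicator {-R..R} x * (\<phi> x * sqrt (\<phi> x))"
    have nn: "0 \<le> ?f x" for x using phi_nonneg by simp
    have int: "integrable lborel ?f" by (rule integrable_three_halves_power[OF phi phi_nonneg])
    have "mass R (\<lambda>x. \<phi> x * sqrt (\<phi> x)) \<noteq> 0"
    proof
      assume "mass R (\<lambda>x. \<phi> x * sqrt (\<phi> x)) = 0"
      then have "AE x in lborel. ?f x = 0" using integral_nonneg_eq_0_iff_AE[OF int] nn by simp
      then have "AE x in lborel. (\<phi> x)\<^sup>2 = indicator (- {-R..R}) x * (\<phi> x)\<^sup>2"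
        by eventually_elim (auto split: split_indicator_asm split_indicator)
      then have "(\<integral>x. (\<phi> x)\<^sup>2 \<partial>lborel) = tail R \<phi>" unfolding tail_def by (intro integral_cong_AE) auto
      then show False using R0[OF R] phi_norm by (simp add: ip_same)
    qed
    moreover have "0 \<le> mass R (\<lambda>x. \<phi> x * sqrt (\<phi> x))" using nn by (intro integral_nonneg_AE AE_I2) auto
    ultimately show ?thesis by simp
  qed
  then show ?thesis by blast
qed

lemma overlap_bounded_below: "\<exists>i0>0. eventually (\<lambda>n. i0 \<le> overlap n) sequentially"
proof -
  obtain p0 R1 where p0: "0 < p0" "\<forall>R\<ge>R1. eventually (\<lambda>n. p0 \<le> mass R (\<psi> n)) sequentially"
    using eventually_mass_psi by auto
  obtain R2 where R2: "\<forall>R\<ge>R2. 0 < mass R (\<lambda>x. \<phi> x * sqrt (\<phi> x))" using mass_phi_pos by auto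
  define R where "R = max R1 R2"
  define B where "B = mass R (\<lambda>x. \<phi> x * sqrt (\<phi> x))"
  have B: "0 < B" using R2 by (simp add: R_def B_def)
  define A where "A = form_cap / box_bound R + (mass R \<phi>)\<^sup>2"
  have A: "0 < A" unfolding A_def using form_cap_ge_1 box_bound_pos by (intro add_pos_nonneg divide_pos_pos) auto
  have "eventually (\<lambda>n. p0 \<le> mass R (\<psi> n)) sequentially" using p0(2) by (simp add: R_def)
  with eventually_capped have "eventually (\<lambda>n. p0 * B\<^sup>2 / A \<le> overlap n) sequentially"
  proof eventually_elim
    fix n assume *: "capped n" and p: "p0 \<le> mass R (\<psi> n)"
    note * = *[unfolded capped_def]
    have "p0 * B\<^sup>2 \<le> mass R (\<psi> n) * B\<^sup>2" using p by (intro mult_right_mono) auto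
    also have "\<dots> \<le> (deficit n / box_bound R + (mass R \<phi>)\<^sup>2) * overlap n"
      unfolding B_def by (rule overlap_lower_bound) (use * p p0 in auto)
    also have "\<dots> \<le> A * overlap n"
      unfolding A_def using * box_bound_pos[of R] overlap_nonneg[of n]
      by (intro mult_right_mono add_mono divide_right_mono) auto
    finally show "p0 * B\<^sup>2 / A \<le> overlap n" using A by (simp add: field_simps)
  qed
  moreover have "0 < p0 * B\<^sup>2 / A" using A B p0 by simp
  ultimately show ?thesis by blast
qed

theorem E_tendsto: "E \<longlonglongrightarrow> lam"
proof -
  obtain i0 where i0: "0 < i0" "eventually (\<lambda>n. i0 \<le> overlap n) sequentially" using overlap_bounded_below by auto
  define u where "u n = (\<eta> n + sqrt (row_error n) + sqrt (energy (V n) \<phi> \<phi>) * sqrt form_cap) / i0" for n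
  have "(\<lambda>n. u n) \<longlonglongrightarrow> (0 + sqrt 0 + sqrt 0 * sqrt form_cap) / i0"
    unfolding u_def by (intro tendsto_intros eta_lim row_error_tendsto energy_V_phi_tendsto) (use i0 in auto)
  then have u: "(\<lambda>n. u n) \<longlonglongrightarrow> 0" by simp
  have "eventually (\<lambda>n. norm (E n - lam) \<le> u n) sequentially"
    using eventually_capped i0(2)
  proof eventually_elim
    fix n assume *: "capped n" and i: "i0 \<le> overlap n"
    note * = *[unfolded capped_def]
    have "\<bar>E n - lam\<bar> * i0 \<le> \<bar>E n - lam\<bar> * overlap n" using i by (intro mult_left_mono) auto
    also have "\<dots> = \<bar>(E n - lam) * overlap n\<bar>" using overlap_nonneg[of n] by (simp add: abs_mult)
    also have "\<dots> \<le> \<eta> n + sqrt (row_error n) + sqrt (energy (V n) \<phi> \<phi>) * sqrt (E n)" by (rule overlap_identity)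
    also have "\<dots> \<le> \<eta> n + sqrt (row_error n) + sqrt (energy (V n) \<phi> \<phi>) * sqrt form_cap"
      using * energy_nonneg[OF V_kernel, of n \<phi>] by (intro add_left_mono mult_left_mono) auto
    finally show "norm (E n - lam) \<le> u n" unfolding u_def using i0 by (simp add: pos_le_divide_eq)
  qed
  then have "(\<lambda>n. E n - lam) \<longlonglongrightarrow> 0" by (rule Lim_null_comparison[OF _ u])
  then show ?thesis by (simp add: LIM_zero_iff)
qed

lemma deficit_tendsto: "deficit \<longlonglongrightarrow> 0"
proof -
  have "(\<lambda>n. deficit n - (lam - E n)) \<longlonglongrightarrow> 0"
    by (rule Lim_null_comparison[OF _ err_tendsto]) (use deficit_eq in \<open>auto simp: err_def\<close>)
  then have "(\<lambda>n. (deficit n - (lam - E n)) + (lam - E n)) \<longlonglongrightarrow> 0 + (lam - lam)"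
    by (intro tendsto_intros E_tendsto)
  then show ?thesis by simp
qed

text \<open>The Nash-type inequality is applied to \<open>f = s \<phi> - r \<psi> n\<close> with coefficients in the ratio of the
  masses of \<open>\<psi> n\<close> and \<open>\<phi>\<close> in the box, so that its \<open>L\<^sup>1\<close> norm there is small by \<open>proportional_on_box\<close>.
  Normalizing the larger coefficient to 1 keeps all bounds independent of the size of the masses,
  and is enough because \<open>1 + u\<^sup>2 - 2 u t \<ge> 1 - t\<^sup>2 \<ge> 1 - t\<close> for \<open>t\<close> in the unit interval.\<close>
lemma one_minus_overlap_le:
  assumes an: "a n \<le> 1" and d: "0 < d"
    and en: "energy (cauchy d) (\<psi> n) (\<psi> n) \<le> form_cap" "energy (cauchy d) \<phi> \<phi> \<le> form_cap"
    and tl: "tail R (\<psi> n) \<le> t" "tail R \<phi> \<le> t" and p: "0 < mass R (\<psi> n)"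
  shows "1 - overlap n \<le> 4 * form_cap * d + 2 * deficit n / (box_bound R * (pi * d)) + 8 * sqrt t"
proof -
  define p where "p = mass R (\<psi> n)"
  define v where "v = mass R \<phi>"
  \<comment> \<open>Dividing by the larger mass makes one coefficient equal to 1.\<close>
  define M where "M = max p v"
  define s where "s = p / M"
  define r where "r = v / M"
  have pv: "0 < p" "0 \<le> v" using p phi_nonneg unfolding p_def v_def by (auto intro!: integral_nonneg_AE)
  have M: "0 < M" using pv by (simp add: M_def)
  have sr: "0 \<le> s" "s \<le> 1" "0 \<le> r" "r \<le> 1" using pv M by (auto simp: s_def r_def M_def divide_simps)
  have max1: "s = 1 \<or> r = 1" using M by (auto simp: s_def r_def M_def max_def)
  define f where "f = (\<lambda>x. s * \<phi> x - r * \<psi> n x)"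
  have f: "sq_int f" unfolding f_def by (intro sq_int_diff sq_int_scale phi psi)
  have ipf: "ip f f = s\<^sup>2 + r\<^sup>2 - 2 * s * r * overlap n"
    unfolding f_def ip_linear_combination[OF phi psi] by (simp add: phi_norm psi_norm)
  have lower: "1 - overlap n \<le> ip f f"
  proof -
    \<comment> \<open>The right-hand side is minimal for \<open>u = overlap n\<close>.\<close>
    have gen: "1 - overlap n \<le> 1 + u\<^sup>2 - 2 * u * overlap n" for u
    proof -
      have "(overlap n)\<^sup>2 \<le> overlap n" using overlap_nonneg[of n] overlap_le_1[of n]
        by (simp add: power2_eq_square mult_left_le)
      moreover have "0 \<le> (u - overlap n)\<^sup>2" by simp
      ultimately show ?thesis by (simp add: power2_diff)
    qed
    from max1 show ?thesis
    proof
      assume "s = 1" then show ?thesis using gen[of r] ipf by simp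
    next
      assume "r = 1" then show ?thesis using gen[of s] ipf by (simp add: algebra_simps)
    qed
  qed
  have upper: "ip f f \<le> 2"
  proof -
    have "s\<^sup>2 \<le> 1" "r\<^sup>2 \<le> 1" using sr by (auto simp: power_le_one)
    moreover have "0 \<le> 2 * s * r * overlap n" using sr overlap_nonneg[of n] by simp
    ultimately show ?thesis using ipf by linarith
  qed
  have energy_f: "energy (cauchy d) f f \<le> 4 * form_cap"
  proof -
    note K = sym_kernel_cauchy[OF d]
    have "energy (cauchy d) f f \<le> 2 * (s\<^sup>2 * energy (cauchy d) \<phi> \<phi>) + 2 * (r\<^sup>2 * energy (cauchy d) (\<psi> n) (\<psi> n))"
      unfolding f_def energy_scale[symmetric] by (rule energy_diff_le[OF K]) (intro sq_int_scale phi psi)+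
    also have "\<dots> \<le> 2 * (1 * form_cap) + 2 * (1 * form_cap)"
      using sr en energy_nonneg[OF K] by (intro add_mono mult_left_mono mult_mono power_le_one) auto
    finally show ?thesis by simp
  qed
  have mass_f: "mass R (\<lambda>x. \<bar>f x\<bar>) \<le> sqrt (2 * deficit n / box_bound R)"
  proof -
    have "f x = (p * \<phi> x - v * \<psi> n x) / M" for x by (simp add: f_def s_def r_def diff_divide_distrib)
    then have "mass R (\<lambda>x. \<bar>f x\<bar>) = mass R (\<lambda>x. \<bar>p * \<phi> x - v * \<psi> n x\<bar>) / M"
      using M by (simp add: abs_divide)
    also have "\<dots> \<le> p * sqrt (2 * deficit n / box_bound R) / M"
      using proportional_on_box[OF an, of R] M by (intro divide_right_mono) (auto simp: p_def v_def)
    also have "\<dots> = s * sqrt (2 * deficit n / box_bound R)" by (simp add: s_def)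
    also have "\<dots> \<le> 1 * sqrt (2 * deficit n / box_bound R)"
      using deficit_nonneg[OF an] box_bound_pos[of R] sr by (intro mult_right_mono) auto
    finally show ?thesis by simp
  qed
  have mass_f2: "(mass R (\<lambda>x. \<bar>f x\<bar>))\<^sup>2 \<le> 2 * deficit n / box_bound R"
  proof -
    have "0 \<le> mass R (\<lambda>x. \<bar>f x\<bar>)" by (intro integral_nonneg_AE AE_I2) simp
    then have "(mass R (\<lambda>x. \<bar>f x\<bar>))\<^sup>2 \<le> (sqrt (2 * deficit n / box_bound R))\<^sup>2" using mass_f by (intro power_mono)
    also have "\<dots> = 2 * deficit n / box_bound R"
      using deficit_nonneg[OF an] box_bound_pos[of R] by simp
    finally show ?thesis .
  qed
  have tail_f: "tail R f \<le> 4 * t"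
    using tail_linear_combination[OF phi psi, of s r R n] sr tl by (simp add: f_def)
  have "2 * sqrt (ip f f) * sqrt (tail R f) \<le> 2 * 2 * (2 * sqrt t)"
  proof (intro mult_mono)
    have "sqrt (ip f f) \<le> sqrt (2\<^sup>2)" using upper by (intro real_sqrt_le_mono) simp
    then show "sqrt (ip f f) \<le> 2" by simp
    have "sqrt (tail R f) \<le> sqrt (2\<^sup>2 * t)" using tail_f by (intro real_sqrt_le_mono) simp
    then show "sqrt (tail R f) \<le> 2 * sqrt t" by (simp add: real_sqrt_mult)
  qed (use tail_nonneg ip_nonneg in auto)
  moreover have "d * energy (cauchy d) f f \<le> d * (4 * form_cap)" using d energy_f by (intro mult_left_mono) auto
  moreover have "(mass R (\<lambda>x. \<bar>f x\<bar>))\<^sup>2 / (pi * d) \<le> 2 * deficit n / box_bound R / (pi * d)"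
    using mass_f2 d by (intro divide_right_mono) auto
  moreover have "ip f f \<le> d * energy (cauchy d) f f + (mass R (\<lambda>x. \<bar>f x\<bar>))\<^sup>2 / (pi * d) + 2 * sqrt (ip f f) * sqrt (tail R f)"
    using Nash_type_inequality[OF d f, of R] by (simp add: tail_def)
  ultimately have "ip f f \<le> d * (4 * form_cap) + 2 * deficit n / box_bound R / (pi * d) + 8 * sqrt t" by linarith
  with lower show ?thesis by (simp add: mult.commute)
qed

theorem overlap_tendsto: "(\<lambda>n. overlap n) \<longlonglongrightarrow> 1"
proof (rule order_tendstoI)
  fix u :: real assume "1 < u"
  then show "eventually (\<lambda>n. overlap n < u) sequentially"
    using overlap_le_1 by (intro always_eventually) (auto intro: le_less_trans)
next
  fix u :: real assume "u < 1"
  define \<tau> where "\<tau> = (1 - u) / 3"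
  have tau: "0 < \<tau>" using \<open>u < 1\<close> by (simp add: \<tau>_def)
  define d where "d = \<tau> / (8 * form_cap)"
  define t where "t = (\<tau> / 8)\<^sup>2"
  have d: "0 < d" "4 * form_cap * d < \<tau>" using tau form_cap_ge_1 by (auto simp: d_def)
  have t: "0 < t" "8 * sqrt t = \<tau>" using tau by (auto simp: t_def)
  obtain R1 where R1: "\<forall>R\<ge>R1. eventually (\<lambda>n. tail R (\<psi> n) \<le> t) sequentially"
    using eventually_tail_psi[OF t(1)] by blast
  have "eventually (\<lambda>R. tail R \<phi> < t) at_top" by (rule order_tendstoD(2)[OF tail_tendsto_zero[OF phi] t(1)])
  then obtain R2 where R2: "\<And>R. R \<ge> R2 \<Longrightarrow> tail R \<phi> < t" by (auto simp: eventually_at_top_linorder)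
  obtain p0 R3 where R3: "0 < p0" "\<forall>R\<ge>R3. eventually (\<lambda>n. p0 \<le> mass R (\<psi> n)) sequentially"
    using eventually_mass_psi by auto
  define R where "R = max R1 (max R2 R3)"
  have Rs: "R \<ge> R1" "R \<ge> R2" "R \<ge> R3" by (auto simp: R_def)
  have "(\<lambda>n. 2 * deficit n / (box_bound R * (pi * d))) \<longlonglongrightarrow> 2 * 0 / (box_bound R * (pi * d))"
    by (intro tendsto_intros deficit_tendsto) (use box_bound_pos[of R] d in auto)
  then have "eventually (\<lambda>n. 2 * deficit n / (box_bound R * (pi * d)) < \<tau>) sequentially"
    by (rule order_tendstoD(2)) (use tau in simp)
  moreover have "eventually (\<lambda>n. tail R (\<psi> n) \<le> t) sequentially" using R1 Rs by blast
  moreover have "eventually (\<lambda>n. p0 \<le> mass R (\<psi> n)) sequentially" using R3 Rs by blast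
  ultimately show "eventually (\<lambda>n. u < overlap n) sequentially"
    using eventually_capped eventually_energy_le[OF d(1)]
  proof eventually_elim
    fix n
    assume 1: "2 * deficit n / (box_bound R * (pi * d)) < \<tau>" and 2: "tail R (\<psi> n) \<le> t" and 3: "p0 \<le> mass R (\<psi> n)"
      and 4: "capped n"
      and 5: "energy (cauchy d) (\<psi> n) (\<psi> n) \<le> form_cap \<and> energy (cauchy d) \<phi> \<phi> \<le> form_cap"
    note 4 = 4[unfolded capped_def]
    have "1 - overlap n \<le> 4 * form_cap * d + 2 * deficit n / (box_bound R * (pi * d)) + 8 * sqrt t"
      by (rule one_minus_overlap_le) (use 2 3 4 5 R2[OF Rs(2)] R3(1) d in auto)
    also have "\<dots> < \<tau> + \<tau> + \<tau>" using 1 d t by linarith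
    also have "\<dots> = 1 - u" by (simp add: \<tau>_def field_simps)
    finally show "u < overlap n" by simp
  qed
qed

end

section \<open>Poisson means of square integrable functions\<close>

definition shift_modulus :: "(real \<Rightarrow> real) \<Rightarrow> real \<Rightarrow> real" where
  "shift_modulus H h = (\<integral>x. \<bar>H (x + h) - H x\<bar> \<partial>lborel)"

lemma integrable_shift:
  fixes H :: "real \<Rightarrow> 'b :: {banach, second_countable_topology}"
  assumes "integrable lborel H" shows "integrable lborel (\<lambda>x. H (x + h))"
  using lborel_integrable_real_affine[OF assms, of 1 h] by (simp add: add.commute)

lemma integral_shift:
  fixes H :: "real \<Rightarrow> 'b :: {banach, second_countable_topology}"
  shows "(\<integral>x. H (x + h) \<partial>lborel) = (\<integral>x. H x \<partial>lborel)"
  using lborel_integral_real_affine[of 1 H h] by (simp add: add.commute)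

lemma shift_modulus_triangle:
  assumes H: "integrable lborel H" and G: "integrable lborel G"
  shows "shift_modulus H h \<le> shift_modulus G h + 2 * (\<integral>x. \<bar>H x - G x\<bar> \<partial>lborel)"
proof -
  let ?D = "\<lambda>x. \<bar>H x - G x\<bar>"
  have D: "integrable lborel ?D" using H G by simp
  have s: "integrable lborel (\<lambda>x. \<bar>G (x + h) - G x\<bar>)" "integrable lborel (\<lambda>x. \<bar>H (x + h) - H x\<bar>)"
    using integrable_shift[OF G, of h] integrable_shift[OF H, of h] G H by auto
  have "shift_modulus H h \<le> (\<integral>x. \<bar>G (x + h) - G x\<bar> + (?D (x + h) + ?D x) \<partial>lborel)"
    unfolding shift_modulus_def
    by (rule integral_mono[OF s(2)]) (use s integrable_shift[OF D, of h] D in auto)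
  also have "\<dots> = shift_modulus G h + ((\<integral>x. ?D (x + h) \<partial>lborel) + (\<integral>x. ?D x \<partial>lborel))"
    unfolding shift_modulus_def using s integrable_shift[OF D, of h] D
    by (subst Bochner_Integration.integral_add) (auto simp del: integral_mult_right_zero)
  also have "(\<integral>x. ?D (x + h) \<partial>lborel) = (\<integral>x. ?D x \<partial>lborel)" by (rule integral_shift)
  finally show ?thesis by simp
qed

lemma shift_modulus_nonneg: "0 \<le> shift_modulus H h"
  unfolding shift_modulus_def by simp

lemma shift_modulus_le: "integrable lborel H \<Longrightarrow> shift_modulus H h \<le> 2 * (\<integral>x. \<bar>H x\<bar> \<partial>lborel)"
  using shift_modulus_triangle[of H "\<lambda>_. 0" h] by (simp add: shift_modulus_def)

text \<open>If \<open>x\<close> lies in the open set \<open>U\<close>, then so does \<open>x + h\<close> for small \<open>h\<close>; hence \<open>U\<close> and its shift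
  intersect in almost all of \<open>U\<close>.\<close>
lemma shift_modulus_open:
  fixes U :: "real set"
  assumes U: "open U" "emeasure lborel U < \<infinity>" and h: "h \<longlonglongrightarrow> 0"
  shows "(\<lambda>n. shift_modulus (indicator U) (h n)) \<longlonglongrightarrow> 0"
proof -
  have [measurable]: "U \<in> sets borel" using U by simp
  have i: "integrable lborel (indicator U :: real \<Rightarrow> real)" using U by (intro integrable_real_indicator) auto
  let ?p = "\<lambda>n x. indicator U (x + h n) * indicator U x :: real"
  have pi: "integrable lborel (?p n)" for n
    by (rule Bochner_Integration.integrable_bound[OF i]) (auto split: split_indicator)
  have eq: "shift_modulus (indicator U) (h n) = 2 * (\<integral>x. indicator U x \<partial>lborel) - 2 * (\<integral>x. ?p n x \<partial>lborel)" for n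
  proof -
    have "shift_modulus (indicator U) (h n) = (\<integral>x. (indicator U (x + h n) + indicator U x) - 2 * ?p n x \<partial>lborel)"
      unfolding shift_modulus_def by (rule Bochner_Integration.integral_cong) (auto split: split_indicator)
    also have "\<dots> = (\<integral>x. indicator U (x + h n) \<partial>lborel) + (\<integral>x. indicator U x \<partial>lborel) - 2 * (\<integral>x. ?p n x \<partial>lborel)"
      using integrable_shift[OF i, of "h n"] i pi[of n] by (simp del: integral_indicator)
    also have "(\<integral>x. indicator U (x + h n) \<partial>lborel) = (\<integral>x. indicator U x \<partial>lborel :: real)" by (rule integral_shift)
    finally show ?thesis by linarith
  qed
  have "(\<lambda>n. \<integral>x. ?p n x \<partial>lborel) \<longlonglongrightarrow> (\<integral>x. indicator U x \<partial>lborel)"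
  proof (rule integral_dominated_convergence[OF _ _ i])
    show "AE x in lborel. (\<lambda>n. ?p n x) \<longlonglongrightarrow> indicator U x"
    proof (intro AE_I2)
      fix x
      show "(\<lambda>n. ?p n x) \<longlonglongrightarrow> indicator U x"
      proof (cases "x \<in> U")
        case True
        have "(\<lambda>n. x + h n) \<longlonglongrightarrow> x + 0" by (intro tendsto_intros h)
        then have "eventually (\<lambda>n. x + h n \<in> U) sequentially"
          using topological_tendstoD[OF _ U(1)] True by simp
        then have "eventually (\<lambda>n. ?p n x = indicator U x) sequentially" by eventually_elim (simp add: True)
        then show ?thesis by (rule tendsto_eventually)
      qed simp
    qed
  qed (auto split: split_indicator)
  then have "(\<lambda>n. shift_modulus (indicator U) (h n)) \<longlonglongrightarrow> 2 * (\<integral>x. indicator U x \<partial>lborel) - 2 * (\<integral>x. indicator U x \<partial>lborel)"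
    unfolding eq by (intro tendsto_intros)
  then show ?thesis by simp
qed

lemma tendsto_zero_approx:
  fixes u :: "nat \<Rightarrow> real"
  assumes nn: "\<And>n. 0 \<le> u n" and ap: "\<And>e. 0 < e \<Longrightarrow> \<exists>v. v \<longlonglongrightarrow> 0 \<and> (\<forall>n. u n \<le> v n + e)"
  shows "u \<longlonglongrightarrow> 0"
proof (rule order_tendstoI)
  fix y :: real assume "0 < y"
  then obtain v where v: "v \<longlonglongrightarrow> 0" "\<And>n. u n \<le> v n + y / 2" using ap[of "y / 2"] by auto
  have "eventually (\<lambda>n. v n < y / 2) sequentially" by (rule order_tendstoD(2)[OF v(1)]) (use \<open>0 < y\<close> in simp)
  then show "eventually (\<lambda>n. u n < y) sequentially"
  proof eventually_elim
    fix n assume "v n < y / 2" then show "u n < y" using v(2)[of n] by linarith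
  qed
next
  fix y :: real assume "y < 0" then show "eventually (\<lambda>n. y < u n) sequentially"
    using nn by (intro always_eventually) (auto intro: less_le_trans)
qed

text \<open>Continuity of translations in \<open>L\<^sup>1\<close>. Indicators of measurable sets are approximated by those of
  open sets; sums and limits are handled by the triangle inequality.\<close>
lemma shift_modulus_tendsto:
  assumes H: "integrable lborel H" and h: "h \<longlonglongrightarrow> 0"
  shows "(\<lambda>n. shift_modulus H (h n)) \<longlonglongrightarrow> 0"
  using H
proof (induction rule: integrable_induct)
  case (base A c)
  then have A: "A \<in> sets borel" by simp
  have iA: "integrable lborel (indicator A :: real \<Rightarrow> real)" using base by (intro integrable_real_indicator) auto
  have "(\<lambda>n. shift_modulus (indicator A) (h n)) \<longlonglongrightarrow> 0"
  proof (rule tendsto_zero_approx[OF shift_modulus_nonneg])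
    fix e :: real assume e: "0 < e"
    obtain U where U: "open U" "A \<subseteq> U" "emeasure lborel (U - A) < ennreal (e / 2)"
      using outer_regular_lborel[OF A, of "e / 2"] e by auto
    have mU: "U \<in> sets borel" using U by simp
    have "emeasure lborel U \<le> emeasure lborel A + emeasure lborel (U - A)"
      using emeasure_subadditive[of A lborel "U - A"] U(2) A mU by (simp add: Un_absorb1)
    also have "\<dots> < \<infinity>"
    proof -
      have "emeasure lborel (U - A) < top" by (rule less_trans[OF U(3) ennreal_less_top])
      moreover have "emeasure lborel A < top" using base(2) by simp
      ultimately show ?thesis using ennreal_add_eq_top[of "emeasure lborel A" "emeasure lborel (U - A)"] less_top
        by (metis infinity_ennreal_def)
    qed
    finally have fU: "emeasure lborel U < \<infinity>" .
    have iU: "integrable lborel (indicator U :: real \<Rightarrow> real)" using fU mU by (intro integrable_real_indicator) auto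
    have "(\<integral>x. \<bar>indicator A x - indicator U x :: real\<bar> \<partial>lborel) = (\<integral>x. indicator (U - A) x \<partial>lborel)"
      by (rule Bochner_Integration.integral_cong) (use U(2) in \<open>auto split: split_indicator\<close>)
    also have "\<dots> = measure lborel (U - A)" using A mU by simp
    also have "\<dots> \<le> e / 2"
    proof -
      have "ennreal (measure lborel (U - A)) = emeasure lborel (U - A)"
        using U(3) by (intro emeasure_eq_ennreal_measure[symmetric]) (auto simp: top_unique)
      then show ?thesis using U(3) e by (metis ennreal_less_iff less_imp_le measure_nonneg)
    qed
    finally have d: "(\<integral>x. \<bar>indicator A x - indicator U x :: real\<bar> \<partial>lborel) \<le> e / 2" .
    show "\<exists>v. v \<longlonglongrightarrow> 0 \<and> (\<forall>n. shift_modulus (indicator A) (h n) \<le> v n + e)"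
    proof (intro exI conjI allI)
      show "(\<lambda>n. shift_modulus (indicator U) (h n)) \<longlonglongrightarrow> 0" by (rule shift_modulus_open[OF U(1) fU h])
      show "shift_modulus (indicator A) (h n) \<le> shift_modulus (indicator U) (h n) + e" for n
        using shift_modulus_triangle[OF iA iU, of "h n"] d by linarith
    qed
  qed
  then have "(\<lambda>n. \<bar>c\<bar> * shift_modulus (indicator A) (h n)) \<longlonglongrightarrow> \<bar>c\<bar> * 0" by (rule tendsto_mult_left)
  moreover have "shift_modulus (\<lambda>x. indicator A x *\<^sub>R c) t = \<bar>c\<bar> * shift_modulus (indicator A) t" for t
  proof -
    have "\<bar>indicator A (x + t) *\<^sub>R c - indicator A x *\<^sub>R c\<bar> = \<bar>c\<bar> * \<bar>indicator A (x + t) - indicator A x :: real\<bar>" for x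
      by (auto split: split_indicator)
    then show ?thesis unfolding shift_modulus_def by simp
  qed
  ultimately show ?case by simp
next
  case (add f g)
  have le: "shift_modulus (\<lambda>x. f x + g x) t \<le> shift_modulus f t + shift_modulus g t" for t
  proof -
    have s: "integrable lborel (\<lambda>x. \<bar>f (x + t) - f x\<bar>)" "integrable lborel (\<lambda>x. \<bar>g (x + t) - g x\<bar>)"
       "integrable lborel (\<lambda>x. \<bar>(f (x + t) + g (x + t)) - (f x + g x)\<bar>)"
      using integrable_shift[OF add(1), of t] integrable_shift[OF add(2), of t] add(1,2) by auto
    have "shift_modulus (\<lambda>x. f x + g x) t \<le> (\<integral>x. \<bar>f (x + t) - f x\<bar> + \<bar>g (x + t) - g x\<bar> \<partial>lborel)"
      unfolding shift_modulus_def by (rule integral_mono[OF s(3)]) (use s in auto)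
    then show ?thesis unfolding shift_modulus_def using s by simp
  qed
  have "(\<lambda>n. shift_modulus f (h n) + shift_modulus g (h n)) \<longlonglongrightarrow> 0 + 0" using add by (intro tendsto_add)
  then have "(\<lambda>n. shift_modulus f (h n) + shift_modulus g (h n)) \<longlonglongrightarrow> 0" by simp
  then show ?case by (rule Lim_null_comparison[rotated]) (use le shift_modulus_nonneg in auto)
next
  case (lim f s)
  have s_int: "integrable lborel (s i)" and f_int: "integrable lborel f"
    and s_le: "norm (s i x) \<le> 2 * norm (f x)" and s_lim: "(\<lambda>i. s i x) \<longlonglongrightarrow> f x"
    and IH: "(\<lambda>n. shift_modulus (s i) (h n)) \<longlonglongrightarrow> 0" for i x
    using lim by auto
  show ?case
  proof (rule tendsto_zero_approx[OF shift_modulus_nonneg])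
    fix e :: real assume e: "0 < e"
    have "(\<lambda>i. \<integral>x. \<bar>f x - s i x\<bar> \<partial>lborel) \<longlonglongrightarrow> (\<integral>x. 0 \<partial>(lborel :: real measure))"
    proof (rule integral_dominated_convergence)
      show "integrable lborel (\<lambda>x. 3 * \<bar>f x\<bar>)" using f_int by simp
      show "AE x in lborel. (\<lambda>i. \<bar>f x - s i x\<bar>) \<longlonglongrightarrow> 0"
      proof (intro AE_I2)
        fix x
        have "(\<lambda>i. \<bar>f x - s i x\<bar>) \<longlonglongrightarrow> \<bar>f x - f x\<bar>" by (intro tendsto_intros s_lim)
        then show "(\<lambda>i. \<bar>f x - s i x\<bar>) \<longlonglongrightarrow> 0" by simp
      qed
      show "AE x in lborel. norm \<bar>f x - s i x\<bar> \<le> 3 * \<bar>f x\<bar>" for i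
      proof (intro AE_I2)
        fix x have "\<bar>s i x\<bar> \<le> 2 * \<bar>f x\<bar>" using s_le[of i x] by simp
        then show "norm \<bar>f x - s i x\<bar> \<le> 3 * \<bar>f x\<bar>" by simp
      qed
      show "(\<lambda>x. \<bar>f x - s i x\<bar>) \<in> borel_measurable lborel" for i using s_int[of i] f_int by auto
    qed simp
    then have "(\<lambda>i. \<integral>x. \<bar>f x - s i x\<bar> \<partial>lborel) \<longlonglongrightarrow> 0" by simp
    then have "eventually (\<lambda>i. (\<integral>x. \<bar>f x - s i x\<bar> \<partial>lborel) < e / 2) sequentially"
      by (rule order_tendstoD(2)) (use e in simp)
    then obtain i where i: "(\<integral>x. \<bar>f x - s i x\<bar> \<partial>lborel) < e / 2" by (auto simp: eventually_sequentially)
    show "\<exists>v. v \<longlonglongrightarrow> 0 \<and> (\<forall>n. shift_modulus f (h n) \<le> v n + e)"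
    proof (intro exI conjI allI)
      show "(\<lambda>n. shift_modulus (s i) (h n)) \<longlonglongrightarrow> 0" by (rule IH)
      show "shift_modulus f (h n) \<le> shift_modulus (s i) (h n) + e" for n
        using shift_modulus_triangle[OF f_int s_int[of i], of "h n"] i by linarith
    qed
  qed
qed

text \<open>This reduces continuity of translations in \<open>L\<^sup>2\<close>, for \<open>f\<close>, to continuity in \<open>L\<^sup>1\<close>, for \<open>f \<bar>f\<bar>\<close>.\<close>
lemma diff_square_le_signed_squares: "(u - v)\<^sup>2 \<le> 2 * \<bar>u * \<bar>u\<bar> - v * \<bar>v\<bar>\<bar>" for u v :: real
proof -
  have same: "(u - v)\<^sup>2 \<le> 2 * \<bar>u * u - v * v\<bar>" if "0 \<le> u" "0 \<le> v" for u v :: real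
  proof -
    have "(u - v)\<^sup>2 = \<bar>u - v\<bar> * \<bar>u - v\<bar>" by (simp add: power2_eq_square)
    also have "\<dots> \<le> \<bar>u - v\<bar> * \<bar>u + v\<bar>" using that by (intro mult_left_mono) auto
    also have "\<dots> = \<bar>u * u - v * v\<bar>" by (simp flip: abs_mult add: algebra_simps)
    finally show ?thesis by (rule order_trans) simp
  qed
  have opp: "(u - v)\<^sup>2 \<le> 2 * (u * u + v * v)" for u v :: real
    using zero_le_power2[of "u + v"] by (simp add: power2_eq_square algebra_simps)
  consider "0 \<le> u" "0 \<le> v" | "u \<le> 0" "v \<le> 0" | "0 \<le> u" "v \<le> 0" | "u \<le> 0" "0 \<le> v" by linarith
  then show ?thesis
  proof cases
    case 1 then show ?thesis using same[of u v] by simp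
  next
    case 2 then show ?thesis using same[of "- u" "- v"] by (simp add: power2_commute abs_minus_commute)
  next
    case 3
    then have "\<bar>u * \<bar>u\<bar> - v * \<bar>v\<bar>\<bar> = u * u + v * v" by (simp add: abs_of_nonneg)
    then show ?thesis using opp[of u v] by simp
  next
    case 4
    then have "u * \<bar>u\<bar> - v * \<bar>v\<bar> = - (u * u + v * v)" by simp
    then have "\<bar>u * \<bar>u\<bar> - v * \<bar>v\<bar>\<bar> = u * u + v * v" by (simp del: minus_add_distrib)
    then show ?thesis using opp[of u v] by simp
  qed
qed

text \<open>The Poisson means converge in \<open>L\<^sup>2\<close>, in the form in which it is needed: \<open>a\<close> times the Dirichlet
  form is \<open>\<langle>f, f - P\<^sub>a f\<rangle>\<close>. After the substitution \<open>y = x + a z\<close> it is bounded by the mean, over the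
  fixed density \<open>1 / (\<pi> (1 + z\<^sup>2))\<close>, of the \<open>L\<^sup>1\<close> distance between \<open>f \<bar>f\<bar>\<close> and its shift by \<open>a z\<close>.\<close>
lemma scaled_energy_tendsto_zero:
  assumes f: "sq_int f" and a: "\<And>n. 0 < a n" "a \<longlonglongrightarrow> 0"
  shows "(\<lambda>n. a n * energy (cauchy (a n)) f f) \<longlonglongrightarrow> 0"
proof -
  note [measurable] = sq_int_measurable[OF f]
  \<comment> \<open>An integrable function whose increments dominate the squared increments of \<open>f\<close>.\<close>
  define H where "H = (\<lambda>x. f x * \<bar>f x\<bar>)"
  have [measurable]: "H \<in> borel_measurable borel" unfolding H_def by measurable
  have H: "integrable lborel H"
    by (rule Bochner_Integration.integrable_bound[OF sq_int_square[OF f]]) (auto simp: H_def power2_eq_square abs_mult)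
  define N where "N = (\<integral>x. \<bar>H x\<bar> \<partial>lborel)"
  have sm [measurable]: "(\<lambda>z. shift_modulus H (a n * z)) \<in> borel_measurable borel" for n
    unfolding shift_modulus_def by measurable
  have dom: "integrable lborel (\<lambda>z. cauchy 1 0 z * (2 * N))" by (intro integrable_mult_left cauchy_integral) simp
  have bnd: "\<bar>cauchy 1 0 z * shift_modulus H (a n * z)\<bar> \<le> cauchy 1 0 z * (2 * N)" for n z
    using shift_modulus_le[OF H, of "a n * z"] cauchy_nonneg[of 1 0 z] shift_modulus_nonneg[of H "a n * z"]
    by (simp add: abs_mult N_def mult_left_mono)
  have cm [measurable]: "cauchy 1 0 \<in> borel_measurable borel"
    using borel_measurable_integrable[OF cauchy_integral(1)[of 1 0]] by simp
  have int: "integrable lborel (\<lambda>z. cauchy 1 0 z * shift_modulus H (a n * z))" for n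
    by (rule Bochner_Integration.integrable_bound[OF dom]) (use bnd in \<open>auto intro: order_trans[OF _ abs_ge_self]\<close>)
  have lim: "(\<lambda>n. \<integral>z. cauchy 1 0 z * shift_modulus H (a n * z) \<partial>lborel) \<longlonglongrightarrow> (\<integral>z. 0 \<partial>(lborel :: real measure))"
  proof (rule integral_dominated_convergence[OF _ _ dom])
    show "AE z in lborel. (\<lambda>n. cauchy 1 0 z * shift_modulus H (a n * z)) \<longlonglongrightarrow> 0"
    proof (intro AE_I2)
      fix z :: real
      have "(\<lambda>n. a n * z) \<longlonglongrightarrow> 0 * z" by (intro tendsto_intros a)
      then have "(\<lambda>n. cauchy 1 0 z * shift_modulus H (a n * z)) \<longlonglongrightarrow> cauchy 1 0 z * 0"
        by (intro tendsto_mult_left shift_modulus_tendsto[OF H]) simp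
      then show "(\<lambda>n. cauchy 1 0 z * shift_modulus H (a n * z)) \<longlonglongrightarrow> 0" by simp
    qed
  qed (use bnd in auto)
  have le: "a n * energy (cauchy (a n)) f f \<le> (\<integral>z. cauchy 1 0 z * shift_modulus H (a n * z) \<partial>lborel)" for n
  proof -
    let ?q = "cauchy (a n)"
    have an: "0 < a n" by (rule a)
    have qm [measurable]: "(\<lambda>p. ?q (fst p) (snd p)) \<in> borel_measurable plane" by (rule sym_kernel_measurable[OF sym_kernel_cauchy[OF an]])
    have "ennreal (a n * energy ?q f f) = ennreal (a n / 2 * (\<integral>(x, y). ?q x y * ((f x - f y) * (f x - f y)) \<partial>plane))"
      by (simp add: energy_def)
    also have "\<dots> = ennreal (\<integral>p. a n / 2 * (case p of (x, y) \<Rightarrow> ?q x y * ((f x - f y) * (f x - f y))) \<partial>plane)"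
      by (simp only: integral_mult_right_zero)
    also have "\<dots> = (\<integral>\<^sup>+p. ennreal (a n / 2 * (case p of (x, y) \<Rightarrow> ?q x y * ((f x - f y) * (f x - f y)))) \<partial>plane)"
      using energy_eq(1)[OF sym_kernel_cauchy[OF an] f f] an cauchy_nonneg
      by (intro nn_integral_eq_integral[symmetric] integrable_mult_right AE_I2) (auto simp: case_prod_beta')
    also have "\<dots> \<le> (\<integral>\<^sup>+p. ennreal (a n * (?q (fst p) (snd p) * \<bar>H (fst p) - H (snd p)\<bar>)) \<partial>plane)"
    proof (intro nn_integral_mono ennreal_leI)
      fix p :: "real \<times> real"
      obtain x y where p: "p = (x, y)" by (cases p)
      have "(f x - f y) * (f x - f y) \<le> 2 * \<bar>H x - H y\<bar>"
        using diff_square_le_signed_squares[of "f x" "f y"] by (simp add: H_def power2_eq_square)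
      then have "a n / 2 * (?q x y * ((f x - f y) * (f x - f y))) \<le> a n / 2 * (?q x y * (2 * \<bar>H x - H y\<bar>))"
        using an by (intro mult_left_mono cauchy_nonneg) auto
      then show "a n / 2 * (case p of (x, y) \<Rightarrow> ?q x y * ((f x - f y) * (f x - f y))) \<le> a n * (?q (fst p) (snd p) * \<bar>H (fst p) - H (snd p)\<bar>)"
        by (simp add: p)
    qed
    also have "\<dots> = (\<integral>\<^sup>+x. \<integral>\<^sup>+y. ennreal (a n * (?q x y * \<bar>H x - H y\<bar>)) \<partial>lborel \<partial>lborel)"
      by (subst lborel.nn_integral_fst[symmetric]) auto
    also have "\<dots> = (\<integral>\<^sup>+x. \<integral>\<^sup>+z. ennreal (cauchy 1 0 z * \<bar>H (x + a n * z) - H x\<bar>) \<partial>lborel \<partial>lborel)"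
    proof (rule nn_integral_cong)
      fix x :: real
      have [measurable]: "?q x \<in> borel_measurable borel"
        using borel_measurable_integrable[OF cauchy_integral(1)[OF an]] by simp
      have "(\<integral>\<^sup>+y. ennreal (a n * (?q x y * \<bar>H x - H y\<bar>)) \<partial>lborel)
         = ennreal \<bar>a n\<bar> * (\<integral>\<^sup>+z. ennreal (a n * (?q x (x + a n * z) * \<bar>H x - H (x + a n * z)\<bar>)) \<partial>lborel)"
        by (rule nn_integral_real_affine) (use an in auto)
      also have "\<dots> = (\<integral>\<^sup>+z. ennreal \<bar>a n\<bar> * ennreal (a n * (?q x (x + a n * z) * \<bar>H x - H (x + a n * z)\<bar>)) \<partial>lborel)"
        by (rule nn_integral_cmult[symmetric]) simp
      also have "\<dots> = (\<integral>\<^sup>+z. ennreal (cauchy 1 0 z * \<bar>H (x + a n * z) - H x\<bar>) \<partial>lborel)"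
      proof (rule nn_integral_cong)
        fix z :: real
        have "a n * (a n * ?q x (x + a n * z)) = cauchy 1 0 z"
        proof -
          have "(a n)\<^sup>2 + (x - (x + a n * z))\<^sup>2 = (a n)\<^sup>2 * (1 + z\<^sup>2)" by (simp add: power2_eq_square algebra_simps)
          then show ?thesis unfolding cauchy_def using an by (simp add: power2_eq_square)
        qed
        then show "ennreal \<bar>a n\<bar> * ennreal (a n * (?q x (x + a n * z) * \<bar>H x - H (x + a n * z)\<bar>)) = ennreal (cauchy 1 0 z * \<bar>H (x + a n * z) - H x\<bar>)"
          using an cauchy_nonneg[of "a n" x] by (simp flip: ennreal_mult add: abs_minus_commute mult.assoc[symmetric])
      qed
      finally show "(\<integral>\<^sup>+y. ennreal (a n * (?q x y * \<bar>H x - H y\<bar>)) \<partial>lborel) = (\<integral>\<^sup>+z. ennreal (cauchy 1 0 z * \<bar>H (x + a n * z) - H x\<bar>) \<partial>lborel)" .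
    qed
    also have "\<dots> = (\<integral>\<^sup>+z. \<integral>\<^sup>+x. ennreal (cauchy 1 0 z * \<bar>H (x + a n * z) - H x\<bar>) \<partial>lborel \<partial>lborel)"
      by (rule lborel_pair.Fubini') measurable
    also have "\<dots> = (\<integral>\<^sup>+z. ennreal (cauchy 1 0 z * shift_modulus H (a n * z)) \<partial>lborel)"
    proof (rule nn_integral_cong)
      fix z :: real
      have "integrable lborel (\<lambda>x. \<bar>H (x + a n * z) - H x\<bar>)" using integrable_shift[OF H, of "a n * z"] H by simp
      then have "integrable lborel (\<lambda>x. cauchy 1 0 z * \<bar>H (x + a n * z) - H x\<bar>)" by (rule integrable_mult_right)
      then have "(\<integral>\<^sup>+x. ennreal (cauchy 1 0 z * \<bar>H (x + a n * z) - H x\<bar>) \<partial>lborel) = ennreal (\<integral>x. cauchy 1 0 z * \<bar>H (x + a n * z) - H x\<bar> \<partial>lborel)"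
        by (rule nn_integral_eq_integral) (use cauchy_nonneg[of 1 0 z] in simp)
      then show "(\<integral>\<^sup>+x. ennreal (cauchy 1 0 z * \<bar>H (x + a n * z) - H x\<bar>) \<partial>lborel) = ennreal (cauchy 1 0 z * shift_modulus H (a n * z))"
        by (simp add: shift_modulus_def)
    qed
    also have "\<dots> = ennreal (\<integral>z. cauchy 1 0 z * shift_modulus H (a n * z) \<partial>lborel)"
      by (rule nn_integral_eq_integral[OF int]) (use cauchy_nonneg shift_modulus_nonneg in auto)
    finally show ?thesis
      using cauchy_nonneg shift_modulus_nonneg by (simp add: integral_nonneg_AE)
  qed
  from lim have "(\<lambda>n. \<integral>z. cauchy 1 0 z * shift_modulus H (a n * z) \<partial>lborel) \<longlonglongrightarrow> 0" by simp
  then show ?thesis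
    by (rule Lim_null_comparison[rotated])
      (use le a energy_nonneg[OF sym_kernel_cauchy[OF a(1)]] in \<open>auto simp: abs_mult less_imp_le\<close>)
qed

section \<open>The Fourier transform and the generator of the Poisson semigroup\<close>

lemma cnj_measurable [measurable]: "cnj \<in> borel_measurable borel"
  by (intro borel_measurable_continuous_onI continuous_intros)

lemma exp_half_line:
  fixes c :: complex assumes c: "0 < Re c"
  shows "integrable lborel (\<lambda>\<xi>. indicator {0<..} \<xi> *\<^sub>R exp (- (c * complex_of_real \<xi>)))"
    and "(\<integral>\<xi>. indicator {0<..} \<xi> *\<^sub>R exp (- (c * complex_of_real \<xi>)) \<partial>lborel) = 1 / c"
proof -
  define r where "r = Re c"
  have r: "0 < r" using c by (simp add: r_def)
  have c0: "c \<noteq> 0" using c by auto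
  have e: "einterval 0 \<infinity> = {0<..}" by (auto simp: einterval_def)
  have lim0: "((\<lambda>x. exp (- (r * x))) \<longlongrightarrow> 0) at_top"
  proof -
    have "filterlim (\<lambda>x. r * x) at_top at_top"
      using r by (intro filterlim_tendsto_pos_mult_at_top[OF tendsto_const]) (auto simp: filterlim_ident)
    then have "filterlim (\<lambda>x. - (r * x)) at_bot at_top" by (simp add: filterlim_uminus_at_bot)
    then show ?thesis by (rule filterlim_compose[OF exp_at_bot])
  qed
  have "set_integrable lborel (einterval 0 \<infinity>) (\<lambda>x. exp (- (r * x)))"
  proof (rule interval_integral_FTC_nonneg(1))
    show "DERIV (\<lambda>x. - (exp (- (r * x)) / r)) x :> exp (- (r * x))" for x
      using r by (auto intro!: derivative_eq_intros)
    have "((\<lambda>x. - (exp (- (r * x)) / r)) \<longlongrightarrow> - (exp (- (r * 0)) / r)) (at_right 0)"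
      using r by (intro tendsto_intros) auto
    then show "(((\<lambda>x. - (exp (- (r * x)) / r)) \<circ> real_of_ereal) \<longlongrightarrow> - (exp (- (r * 0)) / r)) (at_right 0)"
      unfolding zero_ereal_def ereal_tendsto_simps .
    have "((\<lambda>x. - (exp (- (r * x)) / r)) \<longlongrightarrow> - (0 / r)) at_top"
      using r by (intro tendsto_intros lim0) auto
    then show "(((\<lambda>x. - (exp (- (r * x)) / r)) \<circ> real_of_ereal) \<longlongrightarrow> - (0 / r)) (at_left \<infinity>)"
      unfolding ereal_tendsto_simps .
  qed auto
  then have ri: "integrable lborel (\<lambda>\<xi>. indicator {0<..} \<xi> *\<^sub>R exp (- (r * \<xi>)))"
    by (simp add: set_integrable_def e)
  show int: "integrable lborel (\<lambda>\<xi>. indicator {0<..} \<xi> *\<^sub>R exp (- (c * complex_of_real \<xi>)))"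
    by (rule Bochner_Integration.integrable_bound[OF ri]) (auto simp: r_def split: split_indicator)
  have "(LBINT \<xi>=0..\<infinity>. exp (- (c * complex_of_real \<xi>))) = 0 - (- (1 / c))"
  proof (rule interval_integral_FTC_integrable)
    show "((\<lambda>x. - (exp (- (c * complex_of_real x)) / c)) has_vector_derivative exp (- (c * complex_of_real x))) (at x)" for x
    proof -
      have "((\<lambda>z. - (exp (- (c * z)) / c)) has_field_derivative exp (- (c * complex_of_real x))) (at (complex_of_real x))"
        using c0 by (auto intro!: derivative_eq_intros)
      then show ?thesis by (rule has_vector_derivative_real_field)
    qed
    show "set_integrable lborel (einterval 0 \<infinity>) (\<lambda>x. exp (- (c * complex_of_real x)))"
      using int by (simp add: set_integrable_def e)
    have "((\<lambda>x. - (exp (- (c * complex_of_real x)) / c)) \<longlongrightarrow> - (exp (- (c * complex_of_real 0)) / c)) (at_right 0)"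
      using c0 by (intro tendsto_intros) auto
    then have "((\<lambda>x. - (exp (- (c * complex_of_real x)) / c)) \<longlongrightarrow> - (1 / c)) (at_right 0)" by simp
    then show "(((\<lambda>x. - (exp (- (c * complex_of_real x)) / c)) \<circ> real_of_ereal) \<longlongrightarrow> - (1 / c)) (at_right 0)"
      unfolding zero_ereal_def ereal_tendsto_simps .
    have "((\<lambda>x. exp (- (r * x)) / cmod c) \<longlongrightarrow> 0 / cmod c) at_top" using c0 by (intro tendsto_intros lim0) auto
    then have "((\<lambda>x. exp (- (r * x)) / cmod c) \<longlongrightarrow> 0) at_top" by simp
    then have "((\<lambda>x. - (exp (- (c * complex_of_real x)) / c)) \<longlongrightarrow> 0) at_top"
      by (rule Lim_null_comparison[rotated]) (auto simp: norm_divide r_def)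
    then show "(((\<lambda>x. - (exp (- (c * complex_of_real x)) / c)) \<circ> real_of_ereal) \<longlongrightarrow> 0) (at_left \<infinity>)"
      unfolding ereal_tendsto_simps .
  qed auto
  then show "(\<integral>\<xi>. indicator {0<..} \<xi> *\<^sub>R exp (- (c * complex_of_real \<xi>)) \<partial>lborel) = 1 / c"
    by (simp add: interval_lebesgue_integral_def set_lebesgue_integral_def e)
qed

text \<open>The two half-lines contribute \<open>1 / (a + i z)\<close> and \<open>1 / (a - i z)\<close>.\<close>
lemma exp_abs_Fourier:
  fixes a z :: real assumes a: "0 < a"
  shows "integrable lborel (\<lambda>\<xi>. exp (- (\<i> * complex_of_real \<xi> * complex_of_real z)) * complex_of_real (exp (- (a * \<bar>\<xi>\<bar>))))"
    and "(\<integral>\<xi>. exp (- (\<i> * complex_of_real \<xi> * complex_of_real z)) * complex_of_real (exp (- (a * \<bar>\<xi>\<bar>))) \<partial>lborel)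
       = complex_of_real (2 * a / (a\<^sup>2 + z\<^sup>2))"
proof -
  let ?f = "\<lambda>\<xi>. exp (- (\<i> * complex_of_real \<xi> * complex_of_real z)) * complex_of_real (exp (- (a * \<bar>\<xi>\<bar>)))"
  let ?c = "Complex a z" and ?d = "Complex a (- z)"
  let ?g = "\<lambda>c \<xi>. indicator {0<..} \<xi> *\<^sub>R exp (- (c * complex_of_real \<xi>))"
  have cd: "0 < Re ?c" "0 < Re ?d" using a by auto
  have g: "integrable lborel (?g ?c)" "integral\<^sup>L lborel (?g ?c) = 1 / ?c"
    by (intro exp_half_line cd)+
  have h: "integrable lborel (\<lambda>\<xi>. ?g ?d (0 + (-1) * \<xi>))" "(\<integral>\<xi>. ?g ?d (0 + (-1) * \<xi>) \<partial>lborel) = 1 / ?d"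
  proof -
    show "integrable lborel (\<lambda>\<xi>. ?g ?d (0 + (-1) * \<xi>))"
      by (rule lborel_integrable_real_affine[OF exp_half_line(1)[OF cd(2)]]) simp
    show "(\<integral>\<xi>. ?g ?d (0 + (-1) * \<xi>) \<partial>lborel) = 1 / ?d"
      using lborel_integral_real_affine[of "-1" "?g ?d" 0] exp_half_line(2)[OF cd(2)] by simp
  qed
  have eq: "AE \<xi> in lborel. ?g ?c \<xi> + ?g ?d (0 + (-1) * \<xi>) = ?f \<xi>"
    using AE_lborel_singleton[of 0]
  proof eventually_elim
    fix \<xi> :: real assume "\<xi> \<noteq> 0"
    have Cc: "Complex u v = complex_of_real u + \<i> * complex_of_real v" for u v by (simp add: complex_eq_iff)
    have "exp (- (?c * complex_of_real \<xi>)) = ?f \<xi>" if "0 < \<xi>"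
      using that unfolding Cc by (simp add: exp_of_real[symmetric] exp_add[symmetric] algebra_simps)
    moreover have "exp (- (?d * complex_of_real (- \<xi>))) = ?f \<xi>" if "\<xi> < 0"
      using that unfolding Cc by (simp add: exp_of_real[symmetric] exp_add[symmetric] algebra_simps)
    ultimately show "?g ?c \<xi> + ?g ?d (0 + (-1) * \<xi>) = ?f \<xi>"
      using \<open>\<xi> \<noteq> 0\<close> by (cases "0 < \<xi>") auto
  qed
  have sum: "integrable lborel (\<lambda>\<xi>. ?g ?c \<xi> + ?g ?d (0 + (-1) * \<xi>))" using g(1) h(1) by (rule Bochner_Integration.integrable_add)
  show "integrable lborel ?f"
    by (rule Bochner_Integration.integrable_cong_AE_imp[OF sum _ eq]) measurable
  have "integral\<^sup>L lborel ?f = (\<integral>\<xi>. ?g ?c \<xi> + ?g ?d (0 + (-1) * \<xi>) \<partial>lborel)"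
    by (rule integral_cong_AE) (use eq in \<open>auto elim: eventually_mono\<close>)
  also have "\<dots> = 1 / ?c + 1 / ?d" unfolding Bochner_Integration.integral_add[OF g(1) h(1)] g(2) h(2) ..
  also have "\<dots> = (?c + ?d) / (?c * ?d)"
  proof -
    have "?c \<noteq> 0" "?d \<noteq> 0" using a by (auto simp: complex_eq_iff)
    then show ?thesis by (simp add: add_frac_eq add.commute)
  qed
  also have "?c + ?d = complex_of_real (2 * a)" by (simp add: complex_eq_iff)
  also have "?c * ?d = complex_of_real (a\<^sup>2 + z\<^sup>2)" by (simp add: complex_eq_iff power2_eq_square)
  also have "complex_of_real (2 * a) / complex_of_real (a\<^sup>2 + z\<^sup>2) = complex_of_real (2 * a / (a\<^sup>2 + z\<^sup>2))"
    by (rule of_real_divide[symmetric])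
  finally show "integral\<^sup>L lborel ?f = complex_of_real (2 * a / (a\<^sup>2 + z\<^sup>2))" .
qed

abbreviation FT :: "(real \<Rightarrow> real) \<Rightarrow> real \<Rightarrow> complex" where
  "FT f \<equiv> fourier_integral (\<lambda>x. complex_of_real (f x))"

lemma FT_lborel:
  assumes [measurable]: "f \<in> borel_measurable borel"
  shows "FT f \<xi> = complex_of_real (1 / sqrt (2 * pi)) * (\<integral>x. exp (- (\<i> * of_real \<xi> * of_real x)) * complex_of_real (f x) \<partial>lborel)"
  unfolding fourier_integral_def by (subst integral_completion) auto

lemma FT_measurable:
  assumes [measurable]: "f \<in> borel_measurable borel"
  shows "FT f \<in> borel_measurable borel"
proof -
  have "(\<lambda>\<xi>. complex_of_real (1 / sqrt (2 * pi)) * (\<integral>x. exp (- (\<i> * of_real \<xi> * of_real x)) * complex_of_real (f x) \<partial>lborel)) \<in> borel_measurable borel"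
    by measurable
  then show ?thesis by (simp add: FT_lborel[OF assms, abs_def] cong: measurable_cong)
qed

lemma FT_bounded:
  assumes f: "integrable lborel f"
  shows "cmod (FT f \<xi>) \<le> (\<integral>x. \<bar>f x\<bar> \<partial>lborel)"
proof -
  have [measurable]: "f \<in> borel_measurable borel" using f by simp
  have "cmod (\<integral>x. exp (- (\<i> * of_real \<xi> * of_real x)) * complex_of_real (f x) \<partial>lborel) \<le> (\<integral>x. \<bar>f x\<bar> \<partial>lborel)"
    by (rule order_trans[OF integral_norm_bound]) (simp add: norm_mult)
  moreover have "1 / sqrt (2 * pi) \<le> 1" using pi_ge_two by (simp add: real_le_rsqrt)
  ultimately have "1 / sqrt (2 * pi) * cmod (\<integral>x. exp (- (\<i> * of_real \<xi> * of_real x)) * complex_of_real (f x) \<partial>lborel) \<le> 1 * (\<integral>x. \<bar>f x\<bar> \<partial>lborel)"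
    by (intro mult_mono) auto
  then show ?thesis by (simp add: FT_lborel norm_mult norm_divide)
qed

text \<open>Fubini's theorem, with the Fourier transform of \<open>exp (- a \<bar>\<xi>\<bar>)\<close> computed above. The factor makes
  the integral over \<open>\<xi>\<close> absolutely convergent.\<close>
lemma Parseval_Poisson:
  assumes f: "integrable lborel f" and g: "integrable lborel g" and a: "0 < a"
  shows "integrable lborel (\<lambda>\<xi>. complex_of_real (exp (- (a * \<bar>\<xi>\<bar>))) * (FT f \<xi> * cnj (FT g \<xi>)))"
    and "(\<integral>\<xi>. complex_of_real (exp (- (a * \<bar>\<xi>\<bar>))) * (FT f \<xi> * cnj (FT g \<xi>)) \<partial>lborel) = complex_of_real (a * form (cauchy a) f g)"
proof -
  have [measurable]: "f \<in> borel_measurable borel" "g \<in> borel_measurable borel" using f g by auto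
  note [measurable] = FT_measurable[of f] FT_measurable[of g]
  define e where "e \<xi> = exp (- (a * \<bar>\<xi>\<bar>))" for \<xi>
  have [measurable]: "e \<in> borel_measurable borel" unfolding e_def by measurable
  have ei: "integrable lborel e"
    using integrable_norm[OF exp_abs_Fourier(1)[OF a, of 0]] by (simp add: e_def[abs_def])
  define I where "I = (\<integral>x. \<bar>f x\<bar> \<partial>lborel) * (\<integral>x. \<bar>g x\<bar> \<partial>lborel)"
  have bnd: "cmod (FT f \<xi> * cnj (FT g \<xi>)) \<le> I" for \<xi>
    unfolding norm_mult complex_mod_cnj I_def
    by (intro mult_mono FT_bounded f g) auto
  show "integrable lborel (\<lambda>\<xi>. complex_of_real (exp (- (a * \<bar>\<xi>\<bar>))) * (FT f \<xi> * cnj (FT g \<xi>)))"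
    unfolding e_def[symmetric]
  proof (rule Bochner_Integration.integrable_bound[OF integrable_mult_left[OF ei, of I]])
    show "AE \<xi> in lborel. norm (complex_of_real (e \<xi>) * (FT f \<xi> * cnj (FT g \<xi>))) \<le> norm (e \<xi> * I)"
      using bnd by (intro AE_I2) (auto simp: norm_mult e_def I_def abs_mult intro!: mult_left_mono)
  qed measurable
  define E where "E \<xi> x = exp (- (\<i> * complex_of_real \<xi> * complex_of_real x))" for \<xi> x
  define h where "h p \<xi> = complex_of_real (e \<xi>) * (E \<xi> (fst p) * complex_of_real (f (fst p)) * cnj (E \<xi> (snd p) * complex_of_real (g (snd p))))" for p \<xi>
  have hm [measurable]: "(\<lambda>q. h (fst q) (snd q)) \<in> borel_measurable (plane \<Otimes>\<^sub>M lborel)"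
    unfolding h_def E_def by measurable
  have Ef: "integrable lborel (\<lambda>x. E \<xi> x * complex_of_real (f x))" "integrable lborel (\<lambda>x. cnj (E \<xi> x * complex_of_real (g x)))" for \<xi>
    by (rule Bochner_Integration.integrable_bound[OF f], unfold E_def, measurable, simp add: norm_mult)
       (rule Bochner_Integration.integrable_bound[OF g], measurable, simp add: norm_mult)
  have prod: "FT f \<xi> * cnj (FT g \<xi>) = complex_of_real (1 / (2 * pi)) * (\<integral>p. E \<xi> (fst p) * complex_of_real (f (fst p)) * cnj (E \<xi> (snd p) * complex_of_real (g (snd p))) \<partial>plane)" for \<xi>
  proof -
    have c: "complex_of_real (1 / sqrt (2 * pi)) * complex_of_real (1 / sqrt (2 * pi)) = complex_of_real (1 / (2 * pi))"
      by (simp flip: of_real_mult of_real_divide add: real_sqrt_mult_self)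
    have "cnj (\<integral>x. E \<xi> x * complex_of_real (g x) \<partial>lborel) = (\<integral>x. cnj (E \<xi> x * complex_of_real (g x)) \<partial>lborel)"
      by (subst Bochner_Integration.integral_cnj) (rule refl)
    then have "FT f \<xi> * cnj (FT g \<xi>) = (complex_of_real (1 / sqrt (2 * pi)) * complex_of_real (1 / sqrt (2 * pi)))
        * ((\<integral>x. E \<xi> x * complex_of_real (f x) \<partial>lborel) * (\<integral>x. cnj (E \<xi> x * complex_of_real (g x)) \<partial>lborel))"
      unfolding FT_lborel[of f, simplified] FT_lborel[of g, simplified] E_def by (simp add: mult_ac)
    also have "(\<integral>x. E \<xi> x * complex_of_real (f x) \<partial>lborel) * (\<integral>x. cnj (E \<xi> x * complex_of_real (g x)) \<partial>lborel)
      = (\<integral>p. E \<xi> (fst p) * complex_of_real (f (fst p)) * cnj (E \<xi> (snd p) * complex_of_real (g (snd p))) \<partial>plane)"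
      using integral_product_real_line(2)[OF Ef(1) Ef(2), of \<xi> \<xi>] by (simp add: case_prod_beta')
    finally show ?thesis unfolding c .
  qed
  have fg: "integrable plane (\<lambda>p. \<bar>f (fst p)\<bar> * \<bar>g (snd p)\<bar>)"
    using integral_product_real_line(1)[of "\<lambda>x. \<bar>f x\<bar>" "\<lambda>x. \<bar>g x\<bar>"] f g by (simp add: case_prod_beta')
  have hnorm: "norm (h p \<xi>) = e \<xi> * (\<bar>f (fst p)\<bar> * \<bar>g (snd p)\<bar>)" for p \<xi>
    by (simp add: h_def E_def norm_mult e_def)
  have hi: "integrable ((lborel :: (real \<times> real) measure) \<Otimes>\<^sub>M lborel) (\<lambda>(p, \<xi>). h p \<xi>)"
  proof (rule lborel_pair.Fubini_integrable)
    show "(\<lambda>(p, \<xi>). h p \<xi>) \<in> borel_measurable (lborel \<Otimes>\<^sub>M lborel)"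
      using hm by (simp add: lborel_prod case_prod_beta')
    have "integrable plane (\<lambda>p. (\<bar>f (fst p)\<bar> * \<bar>g (snd p)\<bar>) * integral\<^sup>L lborel e)" by (rule integrable_mult_left[OF fg])
    then show "integrable lborel (\<lambda>p. \<integral>\<xi>. norm (case (p, \<xi>) of (p, \<xi>) \<Rightarrow> h p \<xi>) \<partial>lborel)"
      by (simp add: hnorm lborel_prod mult.commute)
    show "AE p in lborel. integrable lborel (\<lambda>\<xi>. case (p, \<xi>) of (p, \<xi>) \<Rightarrow> h p \<xi>)"
    proof (intro AE_I2)
      fix p :: "real \<times> real"
      show "integrable lborel (\<lambda>\<xi>. case (p, \<xi>) of (p, \<xi>) \<Rightarrow> h p \<xi>)"
      proof (rule Bochner_Integration.integrable_bound[OF integrable_mult_left[OF ei, of "\<bar>f (fst p)\<bar> * \<bar>g (snd p)\<bar>"]])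
        show "(\<lambda>\<xi>. case (p, \<xi>) of (p, \<xi>) \<Rightarrow> h p \<xi>) \<in> borel_measurable lborel" unfolding h_def E_def by simp
      qed (use hnorm in \<open>simp add: abs_mult e_def\<close>)
    qed
  qed
  have inner: "(\<integral>\<xi>. h p \<xi> \<partial>lborel) = complex_of_real (2 * pi * a * (cauchy a (fst p) (snd p) * (f (fst p) * g (snd p))))" for p
  proof -
    have "h p \<xi> = complex_of_real (f (fst p) * g (snd p)) * (exp (- (\<i> * complex_of_real \<xi> * complex_of_real (fst p - snd p))) * complex_of_real (exp (- (a * \<bar>\<xi>\<bar>))))" for \<xi>
    proof -
      have "E \<xi> x * cnj (E \<xi> y) = exp (- (\<i> * complex_of_real \<xi> * complex_of_real (x - y)))" for x y
        unfolding E_def exp_cnj by (simp add: exp_add[symmetric] algebra_simps)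
      then show ?thesis unfolding h_def e_def by (simp add: mult_ac)
    qed
    then have "(\<integral>\<xi>. h p \<xi> \<partial>lborel) = complex_of_real (f (fst p) * g (snd p)) * complex_of_real (2 * a / (a\<^sup>2 + (fst p - snd p)\<^sup>2))"
      unfolding exp_abs_Fourier(2)[OF a, symmetric] by simp
    also have "\<dots> = complex_of_real (2 * pi * a * (cauchy a (fst p) (snd p) * (f (fst p) * g (snd p))))"
      unfolding cauchy_def of_real_mult[symmetric] by simp
    finally show ?thesis .
  qed
  have "(\<integral>\<xi>. complex_of_real (e \<xi>) * (FT f \<xi> * cnj (FT g \<xi>)) \<partial>lborel) = (\<integral>\<xi>. complex_of_real (1 / (2 * pi)) * (\<integral>p. h p \<xi> \<partial>lborel) \<partial>lborel)"
    unfolding prod h_def by (simp add: lborel_prod mult.left_commute)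
  also have "\<dots> = complex_of_real (1 / (2 * pi)) * (\<integral>\<xi>. (\<integral>p. h p \<xi> \<partial>lborel) \<partial>lborel)" by simp
  also have "(\<integral>\<xi>. (\<integral>p. h p \<xi> \<partial>lborel) \<partial>lborel) = (\<integral>p. (\<integral>\<xi>. h p \<xi> \<partial>lborel) \<partial>lborel)"
    by (rule lborel_pair.Fubini_integral[OF hi])
  also have "\<dots> = complex_of_real (2 * pi * a * form (cauchy a) f g)"
    unfolding inner form_def integral_complex_of_real integral_mult_right_zero by (simp only: lborel_prod case_prod_beta')
  finally show "(\<integral>\<xi>. complex_of_real (exp (- (a * \<bar>\<xi>\<bar>))) * (FT f \<xi> * cnj (FT g \<xi>)) \<partial>lborel) = complex_of_real (a * form (cauchy a) f g)"
    by (simp add: e_def)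
qed

lemma Cauchy_Schwarz_complex:
  fixes u v :: "real \<Rightarrow> complex"
  assumes [measurable]: "u \<in> borel_measurable borel" "v \<in> borel_measurable borel"
    and u: "integrable lborel (\<lambda>x. (cmod (u x))\<^sup>2)" and v: "integrable lborel (\<lambda>x. (cmod (v x))\<^sup>2)"
  shows "integrable lborel (\<lambda>x. u x * v x)"
    and "cmod (\<integral>x. u x * v x \<partial>lborel) \<le> sqrt (\<integral>x. (cmod (u x))\<^sup>2 \<partial>lborel) * sqrt (\<integral>x. (cmod (v x))\<^sup>2 \<partial>lborel)"
proof -
  have i: "integrable lborel (\<lambda>x. cmod (u x) * cmod (v x))"
    by (rule Cauchy_Schwarz_integral(1)) (use u v in auto)
  show "integrable lborel (\<lambda>x. u x * v x)"
    by (rule Bochner_Integration.integrable_bound[OF i]) (auto simp: norm_mult)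
  have "cmod (\<integral>x. u x * v x \<partial>lborel) \<le> (\<integral>x. cmod (u x * v x) \<partial>lborel)" by (rule integral_norm_bound)
  then have 1: "cmod (\<integral>x. u x * v x \<partial>lborel) \<le> (\<integral>x. cmod (u x) * cmod (v x) \<partial>lborel)" by (simp add: norm_mult)
  have "(\<integral>x. cmod (u x) * cmod (v x) \<partial>lborel)\<^sup>2 \<le> (\<integral>x. (cmod (u x))\<^sup>2 \<partial>lborel) * (\<integral>x. (cmod (v x))\<^sup>2 \<partial>lborel)"
    by (rule Cauchy_Schwarz_integral(3)) (use u v in auto)
  then have "\<bar>\<integral>x. cmod (u x) * cmod (v x) \<partial>lborel\<bar> \<le> sqrt ((\<integral>x. (cmod (u x))\<^sup>2 \<partial>lborel) * (\<integral>x. (cmod (v x))\<^sup>2 \<partial>lborel))"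
    by (rule real_le_rsqrt[of "\<bar>_\<bar>", unfolded power2_abs])
  with 1 show "cmod (\<integral>x. u x * v x \<partial>lborel) \<le> sqrt (\<integral>x. (cmod (u x))\<^sup>2 \<partial>lborel) * sqrt (\<integral>x. (cmod (v x))\<^sup>2 \<partial>lborel)"
    by (simp add: real_sqrt_mult)
qed

lemma inverse_Suc_tendsto: "(\<lambda>n. 1 / (1 + real n)) \<longlonglongrightarrow> 0"
  using LIMSEQ_inverse_real_of_nat by (simp add: inverse_eq_divide add.commute)

text \<open>The form of the Cauchy kernel on the right-hand side of \<open>Parseval_Poisson\<close> is bounded by the Schur
  test, and Fatou's lemma removes the convergence factor.\<close>
lemma Bessel_inequality:
  assumes g: "sq_int g" and gi: "integrable lborel g"
  shows "integrable lborel (\<lambda>\<xi>. (cmod (FT g \<xi>))\<^sup>2)" and "(\<integral>\<xi>. (cmod (FT g \<xi>))\<^sup>2 \<partial>lborel) \<le> ip g g"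
proof -
  note [measurable] = sq_int_measurable[OF g] FT_measurable[OF sq_int_measurable[OF g]]
  let ?a = "\<lambda>n. 1 / (1 + real n)"
  let ?h = "\<lambda>n \<xi>. exp (- (?a n * \<bar>\<xi>\<bar>)) * (cmod (FT g \<xi>))\<^sup>2"
  have a: "0 < ?a n" for n by simp
  have hc: "complex_of_real (exp (- (?a n * \<bar>\<xi>\<bar>))) * (FT g \<xi> * cnj (FT g \<xi>)) = complex_of_real (?h n \<xi>)" for n \<xi>
    by (simp only: of_real_mult complex_norm_square)
  have hi: "integrable lborel (?h n)" "integral\<^sup>L lborel (?h n) = ?a n * form (cauchy (?a n)) g g" for n
    using Parseval_Poisson[OF gi gi a[of n]] unfolding hc complex_of_real_integrable_eq integral_complex_of_real of_real_eq_iff by blast+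
  have le: "(\<integral>\<^sup>+\<xi>. ennreal (?h n \<xi>) \<partial>lborel) \<le> ennreal (ip g g)" for n
  proof -
    have "?a n * form (cauchy (?a n)) g g \<le> ?a n * (1 / ?a n * (sqrt (ip g g) * sqrt (ip g g)))"
      using form_bound[OF sym_kernel_cauchy[OF a[of n]] g g] a[of n] by (intro mult_left_mono) auto
    also have "\<dots> = ip g g" using a[of n] ip_nonneg by simp
    finally show ?thesis
      unfolding hi(2)[symmetric]
      by (subst nn_integral_eq_integral[OF hi(1)]) (auto intro!: ennreal_leI)
  qed
  have lim: "liminf (\<lambda>n. ennreal (?h n \<xi>)) = ennreal ((cmod (FT g \<xi>))\<^sup>2)" for \<xi>
  proof -
    have "(\<lambda>n. ?h n \<xi>) \<longlonglongrightarrow> exp (- (0 * \<bar>\<xi>\<bar>)) * (cmod (FT g \<xi>))\<^sup>2"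
      by (intro tendsto_intros inverse_Suc_tendsto)
    then have "(\<lambda>n. ennreal (?h n \<xi>)) \<longlonglongrightarrow> ennreal ((cmod (FT g \<xi>))\<^sup>2)" by (intro tendsto_ennrealI) simp
    then show ?thesis by (rule lim_imp_Liminf[OF sequentially_bot])
  qed
  have "(\<integral>\<^sup>+\<xi>. ennreal ((cmod (FT g \<xi>))\<^sup>2) \<partial>lborel) = (\<integral>\<^sup>+\<xi>. liminf (\<lambda>n. ennreal (?h n \<xi>)) \<partial>lborel)"
    by (simp only: lim)
  also have "\<dots> \<le> liminf (\<lambda>n. \<integral>\<^sup>+\<xi>. ennreal (?h n \<xi>) \<partial>lborel)" by (rule nn_integral_liminf) measurable
  also have "\<dots> \<le> liminf (\<lambda>n. ennreal (ip g g))" by (rule Liminf_mono) (use le in auto)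
  finally have nn: "(\<integral>\<^sup>+\<xi>. ennreal ((cmod (FT g \<xi>))\<^sup>2) \<partial>lborel) \<le> ennreal (ip g g)" by (simp add: Liminf_const)
  show int: "integrable lborel (\<lambda>\<xi>. (cmod (FT g \<xi>))\<^sup>2)"
  proof (rule integrableI_bounded)
    show "(\<integral>\<^sup>+\<xi>. ennreal (norm ((cmod (FT g \<xi>))\<^sup>2)) \<partial>lborel) < \<infinity>"
      using le_less_trans[OF nn ennreal_less_top] by simp
  qed measurable
  show "(\<integral>\<xi>. (cmod (FT g \<xi>))\<^sup>2 \<partial>lborel) \<le> ip g g"
    using nn by (subst (asm) nn_integral_eq_integral[OF int]) (auto simp: ip_nonneg)
qed

definition trunc :: "real \<Rightarrow> (real \<Rightarrow> real) \<Rightarrow> real \<Rightarrow> real" where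
  "trunc R f x = indicator {-R..R} x * f x"

lemma trunc_sq_int: "sq_int f \<Longrightarrow> sq_int (trunc R f)"
  unfolding trunc_def[abs_def] by (rule sq_int_indicator) auto

lemma trunc_integrable: "sq_int f \<Longrightarrow> integrable lborel (trunc R f)"
  using Bochner_Integration.integrable_bound[OF integrable_on_interval[of f R], of "trunc R f"] sq_int_measurable[OF trunc_sq_int]
  by (auto simp: trunc_def abs_mult)

lemma ip_trunc_diff: "ip (\<lambda>x. f x - trunc R f x) (\<lambda>x. f x - trunc R f x) = tail R f"
  unfolding ip_same tail_def trunc_def by (rule Bochner_Integration.integral_cong) (auto split: split_indicator)

lemma tail_nat_tendsto: "sq_int f \<Longrightarrow> (\<lambda>n. tail (real n) f) \<longlonglongrightarrow> 0"
  by (rule filterlim_compose[OF tail_tendsto_zero filterlim_real_sequentially])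

lemma ip_diff_left:
  assumes "sq_int f" "sq_int g" "sq_int h" shows "ip (\<lambda>x. f x - g x) h = ip f h - ip g h"
  unfolding ip_def left_diff_distrib
  by (rule Bochner_Integration.integral_diff) (intro sq_int_mult assms)+

lemma ip_trunc_tendsto:
  assumes f: "sq_int f" and h: "sq_int h"
  shows "(\<lambda>n. ip (trunc (real n) f) h) \<longlonglongrightarrow> ip f h"
proof -
  have le: "norm (ip f h - ip (trunc (real n) f) h) \<le> sqrt (tail (real n) f) * sqrt (ip h h)" for n
    using ip_Cauchy_Schwarz[OF sq_int_diff[OF f trunc_sq_int[OF f]] h, of "real n"]
    by (simp add: ip_diff_left[OF f trunc_sq_int[OF f] h] ip_trunc_diff)
  have "(\<lambda>n. sqrt (tail (real n) f) * sqrt (ip h h)) \<longlonglongrightarrow> sqrt 0 * sqrt (ip h h)"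
    by (intro tendsto_intros tail_nat_tendsto f)
  then have "(\<lambda>n. sqrt (tail (real n) f) * sqrt (ip h h)) \<longlonglongrightarrow> 0" by simp
  then have "(\<lambda>n. ip f h - ip (trunc (real n) f) h) \<longlonglongrightarrow> 0"
    by (rule Lim_null_comparison[rotated]) (use le in auto)
  from tendsto_diff[OF tendsto_const[of "ip f h"] this] show ?thesis by simp
qed

lemma form_trunc_tendsto:
  assumes K: "sym_kernel K B" and f: "sq_int f" and h: "sq_int h"
  shows "(\<lambda>n. form K (trunc (real n) f) h) \<longlonglongrightarrow> form K f h"
proof -
  have le: "norm (form K f h - form K (trunc (real n) f) h) \<le> B * (sqrt (tail (real n) f) * sqrt (ip h h))" for n
  proof -
    note d = sq_int_diff[OF f trunc_sq_int[OF f]]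
    have "form K f h = form K (trunc (real n) f) h + form K (\<lambda>x. f x - trunc (real n) f x) h"
      using form_add_left[OF K trunc_sq_int[OF f] d h, of "real n" "real n"] by simp
    then show ?thesis using form_bound[OF K d h, of "real n"] by (simp add: ip_trunc_diff)
  qed
  have "(\<lambda>n. B * (sqrt (tail (real n) f) * sqrt (ip h h))) \<longlonglongrightarrow> B * (sqrt 0 * sqrt (ip h h))"
    by (intro tendsto_intros tail_nat_tendsto f)
  then have "(\<lambda>n. B * (sqrt (tail (real n) f) * sqrt (ip h h))) \<longlonglongrightarrow> 0" by simp
  then have "(\<lambda>n. form K f h - form K (trunc (real n) f) h) \<longlonglongrightarrow> 0"
    by (rule Lim_null_comparison[rotated]) (use le in auto)
  from tendsto_diff[OF tendsto_const[of "form K f h"] this] show ?thesis by simp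
qed

text \<open>The \<open>L\<^sup>2\<close> Fourier transform for real Borel functions, as a limit along integer truncations.\<close>
definition has_L2_Fourier :: "(real \<Rightarrow> real) \<Rightarrow> (real \<Rightarrow> complex) \<Rightarrow> bool" where
  "has_L2_Fourier f v \<longleftrightarrow> sq_int f \<and> v \<in> borel_measurable borel \<and> integrable lborel (\<lambda>\<xi>. (cmod (v \<xi>))\<^sup>2) \<and>
     (\<lambda>n. \<integral>\<xi>. (cmod (FT (trunc (real n) f) \<xi> - v \<xi>))\<^sup>2 \<partial>lborel) \<longlonglongrightarrow> 0"

lemma cmod_square_integrable_diff:
  fixes u v :: "real \<Rightarrow> complex"
  assumes [measurable]: "u \<in> borel_measurable borel" "v \<in> borel_measurable borel"
    and u: "integrable lborel (\<lambda>x. (cmod (u x))\<^sup>2)" and v: "integrable lborel (\<lambda>x. (cmod (v x))\<^sup>2)"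
  shows "integrable lborel (\<lambda>x. (cmod (u x - v x))\<^sup>2)"
proof (rule Bochner_Integration.integrable_bound)
  show "integrable lborel (\<lambda>x. 2 * (cmod (u x))\<^sup>2 + 2 * (cmod (v x))\<^sup>2)" using u v by simp
  show "AE x in lborel. norm ((cmod (u x - v x))\<^sup>2) \<le> norm (2 * (cmod (u x))\<^sup>2 + 2 * (cmod (v x))\<^sup>2)"
  proof (intro AE_I2)
    fix x
    have "(cmod (u x - v x))\<^sup>2 \<le> (cmod (u x) + cmod (v x))\<^sup>2" by (intro power_mono norm_triangle_ineq4) simp
    also have "\<dots> \<le> 2 * (cmod (u x))\<^sup>2 + 2 * (cmod (v x))\<^sup>2"
      using zero_le_power2[of "cmod (u x) - cmod (v x)"] by (simp add: power2_sum power2_diff)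
    finally show "norm ((cmod (u x - v x))\<^sup>2) \<le> norm (2 * (cmod (u x))\<^sup>2 + 2 * (cmod (v x))\<^sup>2)" by simp
  qed
qed measurable

lemma Parseval_Poisson_Plancherel:
  assumes F: "has_L2_Fourier f v" and g: "sq_int g" "integrable lborel g" and a: "0 < a"
  shows "(\<integral>\<xi>. v \<xi> * (complex_of_real (exp (- (a * \<bar>\<xi>\<bar>))) * cnj (FT g \<xi>)) \<partial>lborel) = complex_of_real (a * form (cauchy a) f g)"
proof -
  have f: "sq_int f" and [measurable]: "v \<in> borel_measurable borel" and v: "integrable lborel (\<lambda>\<xi>. (cmod (v \<xi>))\<^sup>2)"
    and conv: "(\<lambda>n. \<integral>\<xi>. (cmod (FT (trunc (real n) f) \<xi> - v \<xi>))\<^sup>2 \<partial>lborel) \<longlonglongrightarrow> 0"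
    using F by (auto simp: has_L2_Fourier_def)
  note [measurable] = FT_measurable[OF sq_int_measurable[OF g(1)]] FT_measurable[OF sq_int_measurable[OF trunc_sq_int[OF f]]]
  define G where "G \<xi> = complex_of_real (exp (- (a * \<bar>\<xi>\<bar>))) * cnj (FT g \<xi>)" for \<xi>
  have [measurable]: "G \<in> borel_measurable borel" unfolding G_def by measurable
  have G: "integrable lborel (\<lambda>\<xi>. (cmod (G \<xi>))\<^sup>2)"
    by (rule Bochner_Integration.integrable_bound[OF Bessel_inequality(1)[OF g]])
      (use a in \<open>auto simp: G_def norm_mult power_mult_distrib power_le_one intro!: mult_left_le_one_le\<close>)
  let ?u = "\<lambda>n. FT (trunc (real n) f)"
  have u: "integrable lborel (\<lambda>\<xi>. (cmod (?u n \<xi>))\<^sup>2)" for n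
    by (rule Bessel_inequality(1)[OF trunc_sq_int[OF f] trunc_integrable[OF f]])
  have val: "(\<integral>\<xi>. ?u n \<xi> * G \<xi> \<partial>lborel) = complex_of_real (a * form (cauchy a) (trunc (real n) f) g)" for n
    using Parseval_Poisson(2)[OF trunc_integrable[OF f] g(2) a, of "real n"] by (simp add: G_def mult_ac)
  have le: "norm ((\<integral>\<xi>. ?u n \<xi> * G \<xi> \<partial>lborel) - (\<integral>\<xi>. v \<xi> * G \<xi> \<partial>lborel))
      \<le> sqrt (\<integral>\<xi>. (cmod (?u n \<xi> - v \<xi>))\<^sup>2 \<partial>lborel) * sqrt (\<integral>\<xi>. (cmod (G \<xi>))\<^sup>2 \<partial>lborel)" for n
  proof -
    have "(\<integral>\<xi>. ?u n \<xi> * G \<xi> \<partial>lborel) - (\<integral>\<xi>. v \<xi> * G \<xi> \<partial>lborel) = (\<integral>\<xi>. (?u n \<xi> - v \<xi>) * G \<xi> \<partial>lborel)"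
      unfolding left_diff_distrib
      by (rule Bochner_Integration.integral_diff[symmetric]) (rule Cauchy_Schwarz_complex(1); use u v G in simp)+
    also have "cmod \<dots> \<le> sqrt (\<integral>\<xi>. (cmod (?u n \<xi> - v \<xi>))\<^sup>2 \<partial>lborel) * sqrt (\<integral>\<xi>. (cmod (G \<xi>))\<^sup>2 \<partial>lborel)"
      by (rule Cauchy_Schwarz_complex(2)) (use u v G in \<open>auto intro!: cmod_square_integrable_diff\<close>)
    finally show ?thesis .
  qed
  have "(\<lambda>n. sqrt (\<integral>\<xi>. (cmod (?u n \<xi> - v \<xi>))\<^sup>2 \<partial>lborel) * sqrt (\<integral>\<xi>. (cmod (G \<xi>))\<^sup>2 \<partial>lborel)) \<longlonglongrightarrow> sqrt 0 * sqrt (\<integral>\<xi>. (cmod (G \<xi>))\<^sup>2 \<partial>lborel)"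
    by (intro tendsto_intros conv)
  then have "(\<lambda>n. sqrt (\<integral>\<xi>. (cmod (?u n \<xi> - v \<xi>))\<^sup>2 \<partial>lborel) * sqrt (\<integral>\<xi>. (cmod (G \<xi>))\<^sup>2 \<partial>lborel)) \<longlonglongrightarrow> 0" by simp
  then have "(\<lambda>n. (\<integral>\<xi>. ?u n \<xi> * G \<xi> \<partial>lborel) - (\<integral>\<xi>. v \<xi> * G \<xi> \<partial>lborel)) \<longlonglongrightarrow> 0"
    by (rule Lim_null_comparison[rotated]) (use le in auto)
  then have 1: "(\<lambda>n. complex_of_real (a * form (cauchy a) (trunc (real n) f) g)) \<longlonglongrightarrow> (\<integral>\<xi>. v \<xi> * G \<xi> \<partial>lborel)"
    unfolding val by (simp add: LIM_zero_iff)
  have 2: "(\<lambda>n. complex_of_real (a * form (cauchy a) (trunc (real n) f) g)) \<longlonglongrightarrow> complex_of_real (a * form (cauchy a) f g)"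
    by (intro tendsto_of_real tendsto_mult_left form_trunc_tendsto[OF sym_kernel_cauchy[OF a] f g(1)])
  show ?thesis using LIMSEQ_unique[OF 1 2] by (simp add: G_def)
qed

text \<open>As \<open>a\<close> tends to 0 in \<open>Parseval_Poisson_Plancherel\<close>, the factor \<open>exp (- a \<bar>\<xi>\<bar>)\<close> disappears by
  dominated convergence on the left; on the right \<open>\<langle>P\<^sub>a f, g\<rangle>\<close> tends to \<open>\<langle>f, g\<rangle>\<close> by
  \<open>scaled_energy_tendsto_zero\<close>.\<close>
lemma Parseval_Plancherel:
  assumes F: "has_L2_Fourier f v" and g: "sq_int g" "integrable lborel g"
  shows "(\<integral>\<xi>. v \<xi> * cnj (FT g \<xi>) \<partial>lborel) = complex_of_real (ip f g)"
proof -
  have f: "sq_int f" and [measurable]: "v \<in> borel_measurable borel" and v: "integrable lborel (\<lambda>\<xi>. (cmod (v \<xi>))\<^sup>2)"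
    using F by (auto simp: has_L2_Fourier_def)
  note [measurable] = FT_measurable[OF sq_int_measurable[OF g(1)]]
  let ?a = "\<lambda>n. 1 / (1 + real n)"
  have a: "0 < ?a n" for n by simp
  have int: "integrable lborel (\<lambda>\<xi>. v \<xi> * cnj (FT g \<xi>))"
    by (rule Cauchy_Schwarz_complex(1)) (use v Bessel_inequality(1)[OF g] in auto)
  have 1: "(\<lambda>n. \<integral>\<xi>. v \<xi> * (complex_of_real (exp (- (?a n * \<bar>\<xi>\<bar>))) * cnj (FT g \<xi>)) \<partial>lborel) \<longlonglongrightarrow> (\<integral>\<xi>. v \<xi> * cnj (FT g \<xi>) \<partial>lborel)"
  proof (rule integral_dominated_convergence[OF _ _ integrable_norm[OF int]])
    show "AE \<xi> in lborel. (\<lambda>n. v \<xi> * (complex_of_real (exp (- (?a n * \<bar>\<xi>\<bar>))) * cnj (FT g \<xi>))) \<longlonglongrightarrow> v \<xi> * cnj (FT g \<xi>)"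
    proof (intro AE_I2)
      fix \<xi> :: real
      have "(\<lambda>n. v \<xi> * (complex_of_real (exp (- (?a n * \<bar>\<xi>\<bar>))) * cnj (FT g \<xi>))) \<longlonglongrightarrow> v \<xi> * (complex_of_real (exp (- (0 * \<bar>\<xi>\<bar>))) * cnj (FT g \<xi>))"
        by (intro tendsto_intros inverse_Suc_tendsto)
      then show "(\<lambda>n. v \<xi> * (complex_of_real (exp (- (?a n * \<bar>\<xi>\<bar>))) * cnj (FT g \<xi>))) \<longlonglongrightarrow> v \<xi> * cnj (FT g \<xi>)" by simp
    qed
    show "AE \<xi> in lborel. norm (v \<xi> * (complex_of_real (exp (- (?a n * \<bar>\<xi>\<bar>))) * cnj (FT g \<xi>))) \<le> norm (v \<xi> * cnj (FT g \<xi>))" for n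
    proof (intro AE_I2)
      fix \<xi> :: real
      have "exp (- (?a n * \<bar>\<xi>\<bar>)) \<le> 1" by simp
      then have "exp (- (?a n * \<bar>\<xi>\<bar>)) * (cmod (v \<xi>) * cmod (FT g \<xi>)) \<le> cmod (v \<xi>) * cmod (FT g \<xi>)" by (intro mult_left_le_one_le) auto
      then show "norm (v \<xi> * (complex_of_real (exp (- (?a n * \<bar>\<xi>\<bar>))) * cnj (FT g \<xi>))) \<le> norm (v \<xi> * cnj (FT g \<xi>))"
        by (simp add: norm_mult mult_ac)
    qed
  qed measurable
  have "(\<lambda>n. ?a n * form (cauchy (?a n)) f g) \<longlonglongrightarrow> ip f g"
  proof -
    have eq: "ip f g - ?a n * form (cauchy (?a n)) f g = ?a n * energy (cauchy (?a n)) f g" for n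
      unfolding form_cauchy_energy[OF a f g(1)] using a[of n] by (simp add: field_simps)
    have le: "norm (?a n * energy (cauchy (?a n)) f g) \<le> sqrt (?a n * energy (cauchy (?a n)) f f) * sqrt (?a n * energy (cauchy (?a n)) g g)" for n
    proof -
      have sq: "sqrt (t * y) * sqrt (t * z) = t * (sqrt y * sqrt z)" if "0 \<le> t" for t y z :: real
        using that by (simp add: real_sqrt_mult)
      have "?a n * \<bar>energy (cauchy (?a n)) f g\<bar> \<le> ?a n * (sqrt (energy (cauchy (?a n)) f f) * sqrt (energy (cauchy (?a n)) g g))"
        by (rule mult_left_mono[OF energy_Cauchy_Schwarz[OF sym_kernel_cauchy[OF a[of n]] f g(1)]]) simp
      then show ?thesis unfolding sq[OF less_imp_le[OF a]] by (simp add: abs_mult)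
    qed
    have "(\<lambda>n. sqrt (?a n * energy (cauchy (?a n)) f f) * sqrt (?a n * energy (cauchy (?a n)) g g)) \<longlonglongrightarrow> sqrt 0 * sqrt 0"
      by (intro tendsto_mult tendsto_real_sqrt scaled_energy_tendsto_zero[OF f a inverse_Suc_tendsto] scaled_energy_tendsto_zero[OF g(1) a inverse_Suc_tendsto])
    then have "(\<lambda>n. sqrt (?a n * energy (cauchy (?a n)) f f) * sqrt (?a n * energy (cauchy (?a n)) g g)) \<longlonglongrightarrow> 0" by simp
    then have "(\<lambda>n. ip f g - ?a n * form (cauchy (?a n)) f g) \<longlonglongrightarrow> 0"
      unfolding eq by (rule Lim_null_comparison[rotated]) (use le in auto)
    from tendsto_diff[OF tendsto_const[of "ip f g"] this] show ?thesis by simp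
  qed
  then have 2: "(\<lambda>n. complex_of_real (?a n * form (cauchy (?a n)) f g)) \<longlonglongrightarrow> complex_of_real (ip f g)" by (rule tendsto_of_real)
  show ?thesis
    using LIMSEQ_unique[OF 1[unfolded Parseval_Poisson_Plancherel[OF F g a]] 2] .
qed

definition multiplier_error :: "(real \<Rightarrow> complex) \<Rightarrow> real \<Rightarrow> real" where
  "multiplier_error v a = (\<integral>\<xi>. (cmod (complex_of_real ((1 - exp (- (a * \<bar>\<xi>\<bar>))) / a - \<bar>\<xi>\<bar>) * v \<xi>))\<^sup>2 \<partial>lborel)"

lemma multiplier_bound:
  fixes a t :: real assumes a: "0 < a" and t: "0 \<le> t"
  shows "\<bar>(1 - exp (- (a * t))) / a - t\<bar> \<le> t"
proof -
  have "1 + - (a * t) \<le> exp (- (a * t))" by (rule exp_ge_add_one_self)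
  then have "1 - exp (- (a * t)) \<le> a * t" by simp
  then have 1: "(1 - exp (- (a * t))) / a \<le> t" using a by (simp add: divide_simps mult.commute)
  have "exp (- (a * t)) \<le> 1" using a t by simp
  then have "0 \<le> (1 - exp (- (a * t))) / a" using a by simp
  with 1 show ?thesis by simp
qed

lemma multiplier_tendsto:
  fixes t :: real assumes a: "\<And>n. 0 < a n" "a \<longlonglongrightarrow> 0"
  shows "(\<lambda>n. (1 - exp (- (a n * t))) / a n - t) \<longlonglongrightarrow> 0"
proof -
  have d: "((\<lambda>s. exp (- (s * t))) has_field_derivative - t) (at 0)"
    by (auto intro!: derivative_eq_intros)
  have "filterlim a (at 0) sequentially"
    unfolding filterlim_at using a by (auto simp: less_imp_neq[symmetric])
  then have "(\<lambda>n. (exp (- (a n * t)) - exp (- (0 * t))) / (a n - 0)) \<longlonglongrightarrow> - t"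
    using filterlim_compose[OF d[unfolded has_field_derivative_iff]] by simp
  then have "(\<lambda>n. - ((exp (- (a n * t)) - exp (- (0 * t))) / (a n - 0)) - t) \<longlonglongrightarrow> - (- t) - t"
    by (intro tendsto_intros)
  then show ?thesis by (simp add: minus_divide_left)
qed

lemma multiplier_square_le:
  assumes a: "0 < a"
  shows "(cmod (complex_of_real ((1 - exp (- (a * \<bar>\<xi>\<bar>))) / a - \<bar>\<xi>\<bar>) * z))\<^sup>2 \<le> (cmod (complex_of_real \<bar>\<xi>\<bar> * z))\<^sup>2"
  unfolding norm_mult norm_of_real by (simp, intro power_mono mult_right_mono multiplier_bound a; simp)

lemma multiplier_error_tendsto:
  assumes [measurable]: "v \<in> borel_measurable borel"
    and v: "integrable lborel (\<lambda>\<xi>. (cmod (complex_of_real \<bar>\<xi>\<bar> * v \<xi>))\<^sup>2)"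
    and a: "\<And>n. 0 < a n" "a \<longlonglongrightarrow> 0"
  shows "(\<lambda>n. multiplier_error v (a n)) \<longlonglongrightarrow> 0"
proof -
  have "(\<lambda>n. multiplier_error v (a n)) \<longlonglongrightarrow> (\<integral>\<xi>. 0 \<partial>(lborel :: real measure))"
    unfolding multiplier_error_def
  proof (rule integral_dominated_convergence[OF _ _ v])
    show "AE \<xi> in lborel. (\<lambda>n. (cmod (complex_of_real ((1 - exp (- (a n * \<bar>\<xi>\<bar>))) / a n - \<bar>\<xi>\<bar>) * v \<xi>))\<^sup>2) \<longlonglongrightarrow> 0"
    proof (intro AE_I2)
      fix \<xi> :: real
      have "(\<lambda>n. (cmod (complex_of_real ((1 - exp (- (a n * \<bar>\<xi>\<bar>))) / a n - \<bar>\<xi>\<bar>) * v \<xi>))\<^sup>2) \<longlonglongrightarrow> (cmod (complex_of_real 0 * v \<xi>))\<^sup>2"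
        by (intro tendsto_intros multiplier_tendsto a)
      then show "(\<lambda>n. (cmod (complex_of_real ((1 - exp (- (a n * \<bar>\<xi>\<bar>))) / a n - \<bar>\<xi>\<bar>) * v \<xi>))\<^sup>2) \<longlonglongrightarrow> 0" by simp
    qed
    show "AE \<xi> in lborel. norm ((cmod (complex_of_real ((1 - exp (- (a n * \<bar>\<xi>\<bar>))) / a n - \<bar>\<xi>\<bar>) * v \<xi>))\<^sup>2) \<le> (cmod (complex_of_real \<bar>\<xi>\<bar> * v \<xi>))\<^sup>2" for n
      unfolding real_norm_def abs_power2 by (intro AE_I2 multiplier_square_le a)
  qed measurable
  then show ?thesis by simp
qed

text \<open>The left-hand side is \<open>\<langle>(f - P\<^sub>a f) / a - w, g\<rangle>\<close>. On the Fourier side it is the integral of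
  \<open>(1 - exp (- a \<bar>\<xi>\<bar>)) / a - \<bar>\<xi>\<bar>\<close> times the transforms of \<open>f\<close> and \<open>g\<close>, and the transform of \<open>g\<close> is
  controlled by Bessel's inequality. It suffices to treat truncations of \<open>g\<close>, which are integrable.\<close>
theorem form_generator_estimate:
  assumes F: "has_L2_Fourier f v" and W: "has_L2_Fourier w (\<lambda>\<xi>. complex_of_real \<bar>\<xi>\<bar> * v \<xi>)"
    and g: "sq_int g" and a: "0 < a"
  shows "\<bar>ip f g / a - form (cauchy a) f g - ip w g\<bar> \<le> sqrt (multiplier_error v a) * sqrt (ip g g)"
proof -
  have f: "sq_int f" and w: "sq_int w" and vm [measurable]: "v \<in> borel_measurable borel" and v: "integrable lborel (\<lambda>\<xi>. (cmod (v \<xi>))\<^sup>2)"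
    and wv: "integrable lborel (\<lambda>\<xi>. (cmod (complex_of_real \<bar>\<xi>\<bar> * v \<xi>))\<^sup>2)"
    using F W by (auto simp: has_L2_Fourier_def)
  define M where "M \<xi> = complex_of_real ((1 - exp (- (a * \<bar>\<xi>\<bar>))) / a - \<bar>\<xi>\<bar>) * v \<xi>" for \<xi>
  have [measurable]: "M \<in> borel_measurable borel" unfolding M_def by measurable
  have M: "integrable lborel (\<lambda>\<xi>. (cmod (M \<xi>))\<^sup>2)"
    by (rule Bochner_Integration.integrable_bound[OF wv])
      (unfold M_def, measurable, intro AE_I2 norm_mono_nonneg multiplier_square_le a, simp)
  have special: "\<bar>ip f h / a - form (cauchy a) f h - ip w h\<bar> \<le> sqrt (multiplier_error v a) * sqrt (ip h h)"
    if h: "sq_int h" "integrable lborel h" for h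
  proof -
    note [measurable] = FT_measurable[OF sq_int_measurable[OF h(1)]]
    have hF: "integrable lborel (\<lambda>\<xi>. (cmod (cnj (FT h \<xi>)))\<^sup>2)" "(\<integral>\<xi>. (cmod (cnj (FT h \<xi>)))\<^sup>2 \<partial>lborel) \<le> ip h h"
      using Bessel_inequality[OF h] by simp_all
    let ?e = "\<lambda>\<xi>. v \<xi> * (complex_of_real (exp (- (a * \<bar>\<xi>\<bar>))) * cnj (FT h \<xi>))"
    have i1: "integrable lborel (\<lambda>\<xi>. v \<xi> * cnj (FT h \<xi>))"
      by (rule Cauchy_Schwarz_complex(1)) (use v hF in auto)
    have i2: "integrable lborel ?e"
    proof (rule Bochner_Integration.integrable_bound[OF i1])
      show "AE \<xi> in lborel. norm (?e \<xi>) \<le> norm (v \<xi> * cnj (FT h \<xi>))"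
      proof (intro AE_I2)
        fix \<xi> :: real
        have "exp (- (a * \<bar>\<xi>\<bar>)) \<le> 1" using a by simp
        then have "exp (- (a * \<bar>\<xi>\<bar>)) * (cmod (v \<xi>) * cmod (FT h \<xi>)) \<le> cmod (v \<xi>) * cmod (FT h \<xi>)" by (intro mult_left_le_one_le) auto
        then show "norm (?e \<xi>) \<le> norm (v \<xi> * cnj (FT h \<xi>))" by (simp add: norm_mult mult_ac)
      qed
    qed measurable
    have i3: "integrable lborel (\<lambda>\<xi>. complex_of_real \<bar>\<xi>\<bar> * v \<xi> * cnj (FT h \<xi>))"
      by (rule Cauchy_Schwarz_complex(1)) (use wv hF in auto)
    have "complex_of_real (ip f h / a - form (cauchy a) f h - ip w h)
        = (complex_of_real (ip f h) - complex_of_real (a * form (cauchy a) f h)) / complex_of_real a - complex_of_real (ip w h)"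
      using a by (simp add: diff_divide_distrib)
    also have "\<dots> = ((\<integral>\<xi>. v \<xi> * cnj (FT h \<xi>) \<partial>lborel) - integral\<^sup>L lborel ?e) / complex_of_real a - (\<integral>\<xi>. complex_of_real \<bar>\<xi>\<bar> * v \<xi> * cnj (FT h \<xi>) \<partial>lborel)"
      by (simp only: Parseval_Plancherel[OF F h] Parseval_Plancherel[OF W h] Parseval_Poisson_Plancherel[OF F h a])
    also have "\<dots> = (\<integral>\<xi>. (v \<xi> * cnj (FT h \<xi>) - ?e \<xi>) / complex_of_real a - complex_of_real \<bar>\<xi>\<bar> * v \<xi> * cnj (FT h \<xi>) \<partial>lborel)"
      using i1 i2 i3 by simp
    also have "\<dots> = (\<integral>\<xi>. M \<xi> * cnj (FT h \<xi>) \<partial>lborel)"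
    proof (rule Bochner_Integration.integral_cong[OF refl])
      fix \<xi> :: real
      have "(u * c - u * (e * c)) / b - t * u * c = ((1 - e) / b - t) * u * c" for u c e b t :: complex
      proof -
        have "(u * c - u * (e * c)) / b = (1 - e) / b * u * c" by (simp add: left_diff_distrib diff_divide_distrib)
        then show ?thesis by (simp only: left_diff_distrib)
      qed
      then show "(v \<xi> * cnj (FT h \<xi>) - ?e \<xi>) / complex_of_real a - complex_of_real \<bar>\<xi>\<bar> * v \<xi> * cnj (FT h \<xi>) = M \<xi> * cnj (FT h \<xi>)"
        unfolding M_def by simp
    qed
    finally have eq: "complex_of_real (ip f h / a - form (cauchy a) f h - ip w h) = (\<integral>\<xi>. M \<xi> * cnj (FT h \<xi>) \<partial>lborel)" .
    have "\<bar>ip f h / a - form (cauchy a) f h - ip w h\<bar> = cmod (\<integral>\<xi>. M \<xi> * cnj (FT h \<xi>) \<partial>lborel)"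
      unfolding eq[symmetric] norm_of_real ..
    also have "\<dots> \<le> sqrt (\<integral>\<xi>. (cmod (M \<xi>))\<^sup>2 \<partial>lborel) * sqrt (\<integral>\<xi>. (cmod (cnj (FT h \<xi>)))\<^sup>2 \<partial>lborel)"
      by (rule Cauchy_Schwarz_complex(2)) (use M hF in auto)
    also have "\<dots> \<le> sqrt (\<integral>\<xi>. (cmod (M \<xi>))\<^sup>2 \<partial>lborel) * sqrt (ip h h)"
      using hF(2) by (intro mult_left_mono) auto
    finally show ?thesis by (simp add: multiplier_error_def M_def)
  qed
  let ?g = "\<lambda>n. trunc (real n) g"
  have "(\<lambda>n. \<bar>ip (?g n) f / a - form (cauchy a) (?g n) f - ip (?g n) w\<bar>) \<longlonglongrightarrow> \<bar>ip g f / a - form (cauchy a) g f - ip g w\<bar>"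
    using a by (intro tendsto_intros ip_trunc_tendsto form_trunc_tendsto[OF sym_kernel_cauchy[OF a]] f g w) auto
  moreover have "\<bar>ip (?g n) f / a - form (cauchy a) (?g n) f - ip (?g n) w\<bar> \<le> sqrt (multiplier_error v a) * sqrt (ip g g)" for n
  proof -
    note tg = trunc_sq_int[OF g, of "real n"]
    have "ip (?g n) (?g n) \<le> ip g g"
      unfolding ip_same by (rule integral_mono[OF sq_int_square[OF tg] sq_int_square[OF g]]) (auto simp: trunc_def split: split_indicator)
    moreover have "0 \<le> multiplier_error v a" unfolding multiplier_error_def by simp
    ultimately have "sqrt (multiplier_error v a) * sqrt (ip (?g n) (?g n)) \<le> sqrt (multiplier_error v a) * sqrt (ip g g)"
      by (intro mult_left_mono) auto
    with special[OF tg trunc_integrable[OF g]] show ?thesis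
      unfolding ip_commute[of "?g n" f] ip_commute[of "?g n" w] form_commute[OF sym_kernel_cauchy[OF a] tg f] by linarith
  qed
  ultimately have "\<bar>ip g f / a - form (cauchy a) g f - ip g w\<bar> \<le> sqrt (multiplier_error v a) * sqrt (ip g g)"
    by (intro LIMSEQ_le_const2) auto
  then show ?thesis unfolding ip_commute[of f g] ip_commute[of w g] form_commute[OF sym_kernel_cauchy[OF a] f g] .
qed

section \<open>Borel representatives and the theorem\<close>

text \<open>Integrals of Lebesgue measurable functions are evaluated on Borel measurable representatives,
  for which Fubini's theorem is available.\<close>
lemma lebesgue_eq_lborel:
  fixes f g :: "real \<Rightarrow> 'b :: euclidean_space"
  assumes g: "g \<in> borel_measurable borel" and ae: "AE x in lborel. f x = g x"
  shows "f \<in> borel_measurable lebesgue" "integral\<^sup>L lebesgue f = integral\<^sup>L lborel g"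
    "integrable lebesgue f \<longleftrightarrow> integrable lborel g"
proof -
  have gl: "g \<in> borel_measurable lebesgue" using g by (simp add: measurable_completion)
  have ae': "AE x in lebesgue. f x = g x" by (rule AE_completion[OF ae])
  then have "AE x in lebesgue. g x = f x" by eventually_elim simp
  then show fl: "f \<in> borel_measurable lebesgue" by (rule borel_measurable_AE[OF gl])
  have "integral\<^sup>L lebesgue f = integral\<^sup>L lebesgue g" by (rule integral_cong_AE[OF fl gl ae'])
  then show "integral\<^sup>L lebesgue f = integral\<^sup>L lborel g" using g by (simp add: integral_completion)
  have "integrable lebesgue f \<longleftrightarrow> integrable lebesgue g" by (rule integrable_cong_AE[OF fl gl ae'])
  then show "integrable lebesgue f \<longleftrightarrow> integrable lborel g" using g by (simp add: integrable_completion)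
qed

lemma real_representative:
  fixes u :: "real \<Rightarrow> complex"
  assumes u: "u \<in> borel_measurable lebesgue" and ae: "AE x in lebesgue. u x \<in> \<real> \<and> Re (u x) \<in> S"
    and S: "S \<in> sets borel" "d \<in> S"
  obtains p where "p \<in> borel_measurable borel" "\<And>x. p x \<in> S" "AE x in lborel. u x = complex_of_real (p x)"
proof -
  have "(\<lambda>x. Re (u x)) \<in> borel_measurable lebesgue" using u by measurable
  then obtain r where r: "r \<in> borel_measurable lborel" "AE x in lborel. Re (u x) = r x"
    using completion_ex_borel_measurable_real by blast
  then have [measurable]: "r \<in> borel_measurable borel" by simp
  note [measurable] = S(1)
  define p where "p x = (if r x \<in> S then r x else d)" for x
  show thesis
  proof
    show "p \<in> borel_measurable borel" unfolding p_def by measurable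
    show "p x \<in> S" for x using S by (simp add: p_def)
    have "AE x in lborel. u x \<in> \<real> \<and> Re (u x) \<in> S" using ae by (simp add: AE_completion_iff)
    with r(2) show "AE x in lborel. u x = complex_of_real (p x)"
      by eventually_elim (metis of_real_Re p_def)
  qed
qed

lemma complex_representative:
  fixes u :: "real \<Rightarrow> complex"
  assumes u: "u \<in> borel_measurable lebesgue"
  obtains v where "v \<in> borel_measurable borel" "AE x in lborel. u x = v x"
proof -
  have "(\<lambda>x. Re (u x)) \<in> borel_measurable lebesgue" "(\<lambda>x. Im (u x)) \<in> borel_measurable lebesgue"
    using u by measurable
  then obtain r s where r: "r \<in> borel_measurable lborel" "AE x in lborel. Re (u x) = r x"
    and s: "s \<in> borel_measurable lborel" "AE x in lborel. Im (u x) = s x"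
    using completion_ex_borel_measurable_real by metis
  then have [measurable]: "r \<in> borel_measurable borel" "s \<in> borel_measurable borel" by simp_all
  show thesis
  proof
    show "(\<lambda>x. complex_of_real (r x) + \<i> * complex_of_real (s x)) \<in> borel_measurable borel" by measurable
    show "AE x in lborel. u x = complex_of_real (r x) + \<i> * complex_of_real (s x)"
      using r(2) s(2) by eventually_elim (simp add: complex_eq_iff)
  qed
qed

lemma L2_real:
  assumes f [measurable]: "f \<in> borel_measurable borel" and ae: "AE x in lborel. u x = complex_of_real (f x)"
  shows "u \<in> L2 \<longleftrightarrow> sq_int f" "L2_norm u = sqrt (ip f f)"
proof -
  have ae2: "AE x in lborel. (cmod (u x))\<^sup>2 = (f x)\<^sup>2" using ae by eventually_elim simp
  have m: "(\<lambda>x. (f x)\<^sup>2) \<in> borel_measurable borel" "(\<lambda>x. complex_of_real (f x)) \<in> borel_measurable borel" by measurable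
  show "u \<in> L2 \<longleftrightarrow> sq_int f"
    using lebesgue_eq_lborel(1)[OF m(2) ae] lebesgue_eq_lborel(3)[OF m(1) ae2] f by (simp add: L2_def sq_int_def)
  show "L2_norm u = sqrt (ip f f)"
    using lebesgue_eq_lborel(2)[OF m(1) ae2] by (simp add: L2_norm_def ip_same)
qed

lemma fourier_transform_Plancherel:
  assumes FTu: "fourier_transform u z"
    and f [measurable]: "f \<in> borel_measurable borel" and uf: "AE x in lborel. u x = complex_of_real (f x)"
    and v [measurable]: "v \<in> borel_measurable borel" and zv: "AE \<xi> in lborel. z \<xi> = v \<xi>"
  shows "has_L2_Fourier f v"
proof -
  have fq: "sq_int f" using FTu L2_real(1)[OF f uf] by (simp add: fourier_transform_def)
  have z: "z \<in> L2" and conv: "((\<lambda>R. L2_norm (\<lambda>\<xi>. fourier_integral (\<lambda>x. indicator {-R..R} x * u x) \<xi> - z \<xi>)) \<longlongrightarrow> 0) at_top"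
    using FTu by (auto simp: fourier_transform_def L2_tendsto_def)
  have "AE \<xi> in lborel. (cmod (z \<xi>))\<^sup>2 = (cmod (v \<xi>))\<^sup>2" using zv by eventually_elim simp
  then have vi: "integrable lborel (\<lambda>\<xi>. (cmod (v \<xi>))\<^sup>2)"
    using z lebesgue_eq_lborel(3)[of "\<lambda>\<xi>. (cmod (v \<xi>))\<^sup>2" "\<lambda>\<xi>. (cmod (z \<xi>))\<^sup>2"] by (simp add: L2_def)
  have tm [measurable]: "trunc R f \<in> borel_measurable borel" for R using trunc_sq_int[OF fq] by (rule sq_int_measurable)
  have FT: "fourier_integral (\<lambda>x. indicator {-R..R} x * u x) \<xi> = FT (trunc R f) \<xi>" for R \<xi>
  proof -
    have "AE x in lborel. exp (- (\<i> * of_real \<xi> * of_real x)) * (indicator {-R..R} x * u x) = exp (- (\<i> * of_real \<xi> * of_real x)) * complex_of_real (trunc R f x)"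
      using uf by eventually_elim (simp add: trunc_def split: split_indicator)
    then have "(\<integral>x. exp (- (\<i> * of_real \<xi> * of_real x)) * (indicator {-R..R} x * u x) \<partial>lebesgue)
       = (\<integral>x. exp (- (\<i> * of_real \<xi> * of_real x)) * complex_of_real (trunc R f x) \<partial>lborel)"
      by (intro lebesgue_eq_lborel) measurable
    then show ?thesis by (simp add: FT_lborel) (simp add: fourier_integral_def)
  qed
  have norm: "L2_norm (\<lambda>\<xi>. FT (trunc R f) \<xi> - z \<xi>) = sqrt (\<integral>\<xi>. (cmod (FT (trunc R f) \<xi> - v \<xi>))\<^sup>2 \<partial>lborel)" for R
  proof -
    note [measurable] = FT_measurable[OF tm[of R]]
    have "AE \<xi> in lborel. (cmod (FT (trunc R f) \<xi> - z \<xi>))\<^sup>2 = (cmod (FT (trunc R f) \<xi> - v \<xi>))\<^sup>2"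
      using zv by eventually_elim simp
    then show ?thesis unfolding L2_norm_def by (subst lebesgue_eq_lborel(2)[rotated]) auto
  qed
  have "((\<lambda>R. sqrt (\<integral>\<xi>. (cmod (FT (trunc R f) \<xi> - v \<xi>))\<^sup>2 \<partial>lborel)) \<longlongrightarrow> 0) at_top"
    using conv unfolding FT norm .
  then have "((\<lambda>R. (sqrt (\<integral>\<xi>. (cmod (FT (trunc R f) \<xi> - v \<xi>))\<^sup>2 \<partial>lborel))\<^sup>2) \<longlongrightarrow> 0\<^sup>2) at_top"
    by (rule tendsto_power)
  then have "((\<lambda>R. \<integral>\<xi>. (cmod (FT (trunc R f) \<xi> - v \<xi>))\<^sup>2 \<partial>lborel) \<longlongrightarrow> 0) at_top" by simp
  then have "(\<lambda>n. \<integral>\<xi>. (cmod (FT (trunc (real n) f) \<xi> - v \<xi>))\<^sup>2 \<partial>lborel) \<longlonglongrightarrow> 0"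
    by (rule filterlim_compose[OF _ filterlim_real_sequentially])
  then show ?thesis using fq vi v by (simp add: has_L2_Fourier_def)
qed

text \<open>The hypotheses of the theorem on \<open>\<Theta>\<close>, with the constants as parameters.\<close>
locale homogeneous_potential =
  fixes \<gamma> :: real and \<Theta> :: "real \<Rightarrow> real \<Rightarrow> real" and c C \<epsilon> L :: real
  assumes gamma: "\<gamma> \<ge> 1"
    and Theta_measurable: "(\<lambda>(x, y). \<Theta> x y) \<in> borel_measurable (lebesgue :: (real \<times> real) measure)"
    and Theta_nonneg: "\<And>x y. 0 \<le> \<Theta> x y"
    and Theta_homogeneous: "\<And>x y t. 0 < t \<Longrightarrow> \<Theta> (t * x) (t * y) = t powr \<gamma> * \<Theta> x y"
    and c: "0 < c" "c \<le> C" and Theta_bounds: "\<And>x y. x\<^sup>2 + y\<^sup>2 = 1 \<Longrightarrow> c \<le> \<Theta> x y \<and> \<Theta> x y \<le> C"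
    and Theta_symmetric: "\<And>x y. \<Theta> x y = \<Theta> y x"
    and \<epsilon>: "0 < \<epsilon>" and L: "0 < L"
    and lipschitz_right: "\<And>t. \<bar>t - 1\<bar> < \<epsilon> \<Longrightarrow> \<bar>\<Theta> t 1 - \<Theta> 1 1\<bar> \<le> L * \<bar>t - 1\<bar>"
    and lipschitz_left: "\<And>t. \<bar>t + 1\<bar> < \<epsilon> \<Longrightarrow> \<bar>\<Theta> t (-1) - \<Theta> (-1) (-1)\<bar> \<le> L * \<bar>t + 1\<bar>"
begin

lemma Theta_zero: "\<Theta> 0 0 = 0"
proof -
  have "\<Theta> 0 0 = 2 powr \<gamma> * \<Theta> 0 0" using Theta_homogeneous[of 2 0 0] by simp
  moreover have "(2 :: real) powr 0 < 2 powr \<gamma>" using gamma by (intro powr_less_mono) auto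
  ultimately show ?thesis by auto
qed

lemma Theta_growth:
  "c * (max \<bar>x\<bar> \<bar>y\<bar>) powr \<gamma> \<le> \<Theta> x y" "\<Theta> x y \<le> C * (\<bar>x\<bar> + \<bar>y\<bar>) powr \<gamma>"
proof -
  define r where "r = sqrt (x\<^sup>2 + y\<^sup>2)"
  have "c * (max \<bar>x\<bar> \<bar>y\<bar>) powr \<gamma> \<le> \<Theta> x y \<and> \<Theta> x y \<le> C * (\<bar>x\<bar> + \<bar>y\<bar>) powr \<gamma>"
  proof (cases "x = 0 \<and> y = 0")
    case True then show ?thesis by (simp add: Theta_zero)
  next
    case False
    then have pos: "0 < x\<^sup>2 + y\<^sup>2" by (simp add: sum_power2_gt_zero_iff)
    then have r: "0 < r" by (simp add: r_def)
    have r2: "r\<^sup>2 = x\<^sup>2 + y\<^sup>2" using pos by (simp add: r_def)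
    have "(x / r)\<^sup>2 + (y / r)\<^sup>2 = 1" 
      unfolding power_divide add_divide_distrib[symmetric] r2 using pos by (intro divide_self) (metis less_irrefl)
    then have b: "c \<le> \<Theta> (x / r) (y / r)" "\<Theta> (x / r) (y / r) \<le> C" using Theta_bounds by auto
    have eq: "\<Theta> x y = r powr \<gamma> * \<Theta> (x / r) (y / r)" using Theta_homogeneous[OF r, of "x / r" "y / r"] r by simp
    have "max \<bar>x\<bar> \<bar>y\<bar> \<le> r" unfolding r_def by (simp add: real_le_rsqrt)
    then have 1: "(max \<bar>x\<bar> \<bar>y\<bar>) powr \<gamma> \<le> r powr \<gamma>" using gamma by (intro powr_mono2) auto
    have "r \<le> \<bar>x\<bar> + \<bar>y\<bar>" unfolding r_def by (rule sqrt_sum_squares_le_sum_abs)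
    then have 2: "r powr \<gamma> \<le> (\<bar>x\<bar> + \<bar>y\<bar>) powr \<gamma>" using gamma r by (intro powr_mono2) auto
    have "c * (max \<bar>x\<bar> \<bar>y\<bar>) powr \<gamma> \<le> \<Theta> (x / r) (y / r) * r powr \<gamma>"
      using 1 b c by (intro mult_mono) auto
    moreover have "\<Theta> (x / r) (y / r) * r powr \<gamma> \<le> C * (\<bar>x\<bar> + \<bar>y\<bar>) powr \<gamma>"
      using 2 b c by (intro mult_mono) auto
    ultimately show ?thesis unfolding eq by (simp add: mult.commute)
  qed
  then show "c * (max \<bar>x\<bar> \<bar>y\<bar>) powr \<gamma> \<le> \<Theta> x y" "\<Theta> x y \<le> C * (\<bar>x\<bar> + \<bar>y\<bar>) powr \<gamma>" by auto
qed

text \<open>The diagonal is a null set of the plane, so measurability of \<open>\<Theta>\<close> says nothing about it; the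
  values are determined by homogeneity instead.\<close>
lemma diagonal_measurable: "(\<lambda>x. \<Theta> x x) \<in> borel_measurable borel"
proof -
  have "\<Theta> x x = \<bar>x\<bar> powr \<gamma> * (if 0 < x then \<Theta> 1 1 else \<Theta> (-1) (-1))" for x
    using Theta_homogeneous[of "\<bar>x\<bar>" 1 1] Theta_homogeneous[of "\<bar>x\<bar>" "-1" "-1"] Theta_zero
    by (cases "x = 0"; cases "0 < x") auto
  then have "(\<lambda>x. \<Theta> x x) = (\<lambda>x. \<bar>x\<bar> powr \<gamma> * (if 0 < x then \<Theta> 1 1 else \<Theta> (-1) (-1)))" by (rule ext)
  then show ?thesis by (rule ssubst) measurable
qed

lemma Theta_near_diagonal:
  assumes "x \<noteq> 0" "\<bar>x - y\<bar> < \<epsilon> * \<bar>x\<bar>"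
  shows "\<bar>\<Theta> x y - \<Theta> x x\<bar> \<le> (\<bar>x\<bar> powr \<gamma> * L / \<bar>x\<bar>) * \<bar>x - y\<bar>"
proof -
  define r where "r = \<bar>x\<bar>"
  have r: "0 < r" using assms by (simp add: r_def)
  define s :: real where "s = (if 0 < x then 1 else -1)"
  have xs: "x = r * s" using assms by (auto simp: r_def s_def)
  have "\<Theta> (r * (y / r)) (r * s) = r powr \<gamma> * \<Theta> (y / r) s" by (rule Theta_homogeneous[OF r])
  moreover have "r * (y / r) = y" using r by simp
  ultimately have 1: "\<Theta> x y = r powr \<gamma> * \<Theta> (y / r) s" using Theta_symmetric[of x y] by (simp only: xs[symmetric])
  have 2: "\<Theta> x x = r powr \<gamma> * \<Theta> s s" using Theta_homogeneous[OF r, of s s] xs by simp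
  have d: "\<bar>y / r - s\<bar> = \<bar>x - y\<bar> / r"
  proof -
    have "y / r - s = (y - x) / r" using xs r by (simp add: field_simps)
    then show ?thesis using r by (simp add: abs_divide abs_minus_commute)
  qed
  have "\<bar>x - y\<bar> / r < \<epsilon>" using assms(2) r by (simp add: r_def pos_divide_less_eq)
  then have "\<bar>y / r - s\<bar> < \<epsilon>" using d by simp
  then have "\<bar>\<Theta> (y / r) s - \<Theta> s s\<bar> \<le> L * \<bar>y / r - s\<bar>"
    using lipschitz_right[of "y / r"] lipschitz_left[of "y / r"] by (auto simp: s_def split: if_splits)
  then have "r powr \<gamma> * \<bar>\<Theta> (y / r) s - \<Theta> s s\<bar> \<le> r powr \<gamma> * (L * (\<bar>x - y\<bar> / r))"
    unfolding d by (rule mult_left_mono) simp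
  moreover have "\<bar>\<Theta> x y - \<Theta> x x\<bar> = r powr \<gamma> * \<bar>\<Theta> (y / r) s - \<Theta> s s\<bar>"
    unfolding 1 2 right_diff_distrib[symmetric] by (simp add: abs_mult)
  ultimately show ?thesis by (simp add: r_def mult_ac)
qed

text \<open>A Borel version of \<open>\<Theta>\<close> is symmetrized and clamped between the growth bounds of \<open>\<Theta>\<close>, so that these
  properties hold everywhere. Neither operation changes it outside a null set.\<close>
lemma Borel_version:
  obtains T where "homogeneous_weight T c C \<gamma> (\<lambda>x. \<Theta> x x)" "AE x in lborel. AE y in lborel. \<Theta> x y = T x y"
proof -
  obtain T0 where T0m: "T0 \<in> borel_measurable lborel" and T0: "AE p in lborel. (case p of (x, y) \<Rightarrow> \<Theta> x y) = T0 p"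
    using completion_ex_borel_measurable_real[OF Theta_measurable] by blast
  have T0m' [measurable]: "T0 \<in> borel_measurable plane" using T0m by (simp add: lborel_prod)
  define lo where "lo x y = c * (max \<bar>x\<bar> \<bar>y\<bar>) powr \<gamma>" for x y :: real
  define hi where "hi x y = C * (\<bar>x\<bar> + \<bar>y\<bar>) powr \<gamma>" for x y :: real
  \<comment> \<open>The mean of the two values restores symmetry, which \<open>T0\<close> has only almost everywhere.\<close>
  define T where "T x y = max (lo x y) (min (hi x y) ((T0 (x, y) + T0 (y, x)) / 2))" for x y
  have Tm: "(\<lambda>(x, y). T x y) \<in> borel_measurable plane"
  proof -
    have [measurable]: "(\<lambda>p. T0 (snd p, fst p)) \<in> borel_measurable plane"
      by (rule measurable_compose[OF _ T0m']) measurable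
    have [measurable]: "(\<lambda>p. T0 (fst p, snd p)) \<in> borel_measurable plane" by simp
    show ?thesis unfolding T_def lo_def hi_def case_prod_beta' by measurable
  qed
  have ae: "AE p in plane. \<Theta> (fst p) (snd p) = T0 p" unfolding lborel_prod using T0 by (simp add: case_prod_beta')
  have swap: "plane = distr plane plane (\<lambda>(x, y). (y, x))" by (rule lborel_pair.distr_pair_swap)
  have swapped: "AE p in distr plane plane (\<lambda>(x, y). (y, x)). \<Theta> (fst p) (snd p) = T0 p"
    by (subst swap[symmetric]) (rule ae)
  have ae': "AE p in plane. \<Theta> (snd p) (fst p) = T0 (snd p, fst p)"
    using AE_distrD[OF measurable_pair_swap' swapped] by (simp add: case_prod_beta')
  have "AE p in plane. \<Theta> (fst p) (snd p) = T (fst p) (snd p)"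
    using ae ae'
  proof eventually_elim
    fix p :: "real \<times> real"
    assume "\<Theta> (fst p) (snd p) = T0 p" "\<Theta> (snd p) (fst p) = T0 (snd p, fst p)"
    then have "(T0 (fst p, snd p) + T0 (snd p, fst p)) / 2 = \<Theta> (fst p) (snd p)"
      using Theta_symmetric[of "snd p" "fst p"] by simp
    then show "\<Theta> (fst p) (snd p) = T (fst p) (snd p)"
      using Theta_growth[of "fst p" "snd p"] by (simp add: T_def lo_def hi_def)
  qed
  then have Tae: "AE x in lborel. AE y in lborel. \<Theta> x y = T x y"
    by (rule lborel_pair.AE_pair[where Q = "\<lambda>p. \<Theta> (fst p) (snd p) = T (fst p) (snd p)", simplified])
  show thesis
  proof (rule that[OF _ Tae], unfold_locales)
    show "(\<lambda>(x, y). T x y) \<in> borel_measurable plane" by (rule Tm)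
    show "T x y = T y x" for x y by (simp add: T_def lo_def hi_def max.commute add.commute)
    show "0 < c" "1 \<le> \<gamma>" "0 < C" using c gamma by auto
    show "c * \<bar>x\<bar> powr \<gamma> \<le> T x y" for x y
    proof -
      have "\<bar>x\<bar> powr \<gamma> \<le> (max \<bar>x\<bar> \<bar>y\<bar>) powr \<gamma>" using gamma by (intro powr_mono2) auto
      then have "c * \<bar>x\<bar> powr \<gamma> \<le> lo x y" unfolding lo_def using c by (intro mult_left_mono) auto
      then show ?thesis by (simp add: T_def)
    qed
    show "T x y \<le> C * (\<bar>x\<bar> + \<bar>y\<bar>) powr \<gamma>" for x y
    proof -
      have "lo x y \<le> hi x y" using Theta_growth[of x y] by (simp add: lo_def hi_def)
      then show ?thesis by (simp add: T_def hi_def)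
    qed
    show "(\<lambda>x. \<Theta> x x) \<in> borel_measurable borel" by (rule diagonal_measurable)
    show "0 \<le> \<Theta> x x" for x by (rule Theta_nonneg)
    show "AE x in lborel. \<exists>\<delta>>0. \<exists>L\<ge>0. AE y in lborel. \<bar>x - y\<bar> < \<delta> \<longrightarrow> \<bar>T x y - \<Theta> x x\<bar> \<le> L * \<bar>x - y\<bar>"
      using Tae AE_lborel_singleton[of 0]
    proof eventually_elim
      fix x :: real assume ae: "AE y in lborel. \<Theta> x y = T x y" and x: "x \<noteq> 0"
      show "\<exists>\<delta>>0. \<exists>L\<ge>0. AE y in lborel. \<bar>x - y\<bar> < \<delta> \<longrightarrow> \<bar>T x y - \<Theta> x x\<bar> \<le> L * \<bar>x - y\<bar>"
      proof (intro exI conjI)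
        show "0 < \<epsilon> * \<bar>x\<bar>" using \<epsilon> x by simp
        show "0 \<le> \<bar>x\<bar> powr \<gamma> * L / \<bar>x\<bar>" using L by simp
        show "AE y in lborel. \<bar>x - y\<bar> < \<epsilon> * \<bar>x\<bar> \<longrightarrow> \<bar>T x y - \<Theta> x x\<bar> \<le> (\<bar>x\<bar> powr \<gamma> * L / \<bar>x\<bar>) * \<bar>x - y\<bar>"
          using ae
        proof eventually_elim
          fix y assume "\<Theta> x y = T x y"
          from Theta_near_diagonal[OF x, of y, unfolded this]
          show "\<bar>x - y\<bar> < \<epsilon> * \<bar>x\<bar> \<longrightarrow> \<bar>T x y - \<Theta> x x\<bar> \<le> (\<bar>x\<bar> powr \<gamma> * L / \<bar>x\<bar>) * \<bar>x - y\<bar>" by blast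
        qed
      qed
    qed
  qed
qed

lemma eigenfunction_Borel:
  assumes Tae: "AE x in lborel. AE y in lborel. \<Theta> x y = T x y"
    and T: "homogeneous_weight T c C \<gamma> (\<lambda>x. \<Theta> x x)"
    and a: "0 < a" and eig: "eigenfunction (B_operator \<Theta> a) (complex_of_real \<mu>) u"
    and pos: "AE x in lebesgue. u x \<in> \<real> \<and> 0 < Re (u x)"
  obtains p where "sq_int p" "\<And>x. 0 < p x" "AE x in lborel. u x = complex_of_real (p x)"
    "AE x in lborel. (\<integral>y. wcauchy T a x y * p y \<partial>lborel) = (1 / a - (1 - \<mu>) / a) * p x"
proof -
  interpret homogeneous_weight T c C \<gamma> "\<lambda>x. \<Theta> x x" by (rule T)
  have uL: "u \<in> L2" and ueig: "AE x in lebesgue. complex_of_real \<mu> * u x = (\<integral>y. complex_of_real (B_kernel \<Theta> a x y) * u y \<partial>lebesgue)"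
    using eig by (auto simp: eigenfunction_def B_operator_def)
  have "u \<in> borel_measurable lebesgue" using uL by (simp add: L2_def)
  then obtain p where pm: "p \<in> borel_measurable borel" and pp: "\<And>x. p x \<in> {0<..}" and up: "AE x in lborel. u x = complex_of_real (p x)"
    using real_representative[of u "{0<..}" 1] pos by auto
  note [measurable] = pm
  have [measurable]: "wcauchy T a x \<in> borel_measurable borel" for x
    using sym_kernel_row_measurable[OF sym_kernel_wcauchy[OF a], of x] by simp
  have "AE x in lborel. (\<integral>y. wcauchy T a x y * p y \<partial>lborel) = (1 / a - (1 - \<mu>) / a) * p x"
    using ueig[unfolded AE_completion_iff] up Tae
  proof eventually_elim
    fix x assume 1: "complex_of_real \<mu> * u x = (\<integral>y. complex_of_real (B_kernel \<Theta> a x y) * u y \<partial>lebesgue)"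
      and 2: "u x = complex_of_real (p x)" and 3: "AE y in lborel. \<Theta> x y = T x y"
    have "AE y in lborel. complex_of_real (B_kernel \<Theta> a x y) * u y = complex_of_real (a * (wcauchy T a x y * p y))"
      using 3 up by eventually_elim (simp add: B_kernel_def wcauchy_def)
    then have "(\<integral>y. complex_of_real (B_kernel \<Theta> a x y) * u y \<partial>lebesgue) = (\<integral>y. complex_of_real (a * (wcauchy T a x y * p y)) \<partial>lborel)"
      by (intro lebesgue_eq_lborel) measurable
    also have "\<dots> = complex_of_real (a * (\<integral>y. wcauchy T a x y * p y \<partial>lborel))"
      unfolding integral_complex_of_real integral_mult_right_zero ..
    finally have "complex_of_real (\<mu> * p x) = complex_of_real (a * (\<integral>y. wcauchy T a x y * p y \<partial>lborel))"
      using 1 2 by simp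
    then have "\<mu> * p x = a * (\<integral>y. wcauchy T a x y * p y \<partial>lborel)" unfolding of_real_eq_iff .
    then show "(\<integral>y. wcauchy T a x y * p y \<partial>lborel) = (1 / a - (1 - \<mu>) / a) * p x"
      using a by (simp add: field_simps)
  qed
  then show thesis using that[of p] pp up uL L2_real(1)[OF pm up] by auto
qed

text \<open>Since the eigenfunction \<open>u\<close> and \<open>\<theta>\<close> are real, the eigenvalue equation shows that \<open>\<bar>D\<bar> u\<close> is real as
  well; it may therefore be replaced by \<open>w = lam f - \<theta> f / 2\<close>.\<close>
lemma ground_state_Borel:
  assumes T: "homogeneous_weight T c C \<gamma> (\<lambda>x. \<Theta> x x)"
    and eig: "eigenfunction (A_operator \<Theta> \<gamma>) (complex_of_real lam) u"
    and nonneg: "AE x in lebesgue. u x \<in> \<real> \<and> 0 \<le> Re (u x)"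
  obtains f w v where "sq_int f" "\<And>x. 0 \<le> f x" "AE x in lborel. u x = complex_of_real (f x)"
    "sq_int (\<lambda>x. homogeneous_weight.weight_bound C \<gamma> x * f x)"
    "AE x in lborel. w x + 1 / 2 * \<Theta> x x * f x = lam * f x"
    "has_L2_Fourier f v" "has_L2_Fourier w (\<lambda>\<xi>. complex_of_real \<bar>\<xi>\<bar> * v \<xi>)"
proof -
  interpret homogeneous_weight T c C \<gamma> "\<lambda>x. \<Theta> x x" by (rule T)
  obtain w0 where uL: "u \<in> L2" and abs: "abs_D u w0" and dom: "u \<in> A_domain \<gamma>"
    and ueig: "AE x in lebesgue. complex_of_real lam * u x = w0 x + complex_of_real (1 / 2 * \<Theta> x x) * u x"
    using eig by (auto simp: eigenfunction_def A_operator_def)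
  have "u \<in> borel_measurable lebesgue" using uL by (simp add: L2_def)
  then obtain f where fm [measurable]: "f \<in> borel_measurable borel" and fn: "\<And>x. f x \<in> {0..}" and uf: "AE x in lborel. u x = complex_of_real (f x)"
    using real_representative[of u "{0..}" 1] nonneg by auto
  have fq: "sq_int f" using uL L2_real(1)[OF fm uf] by simp
  define w where "w x = lam * f x - 1 / 2 * \<Theta> x x * f x" for x
  have wm [measurable]: "w \<in> borel_measurable borel" unfolding w_def by measurable
  have w0w: "AE x in lborel. w0 x = complex_of_real (w x)"
    using ueig[unfolded AE_completion_iff] uf by eventually_elim (simp add: w_def algebra_simps)
  obtain z where FTu: "fourier_transform u z" and FTw: "fourier_transform w0 (\<lambda>\<xi>. complex_of_real \<bar>\<xi>\<bar> * z \<xi>)"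
    using abs by (auto simp: abs_D_def)
  have "z \<in> borel_measurable lebesgue" using FTu by (simp add: fourier_transform_def L2_tendsto_def L2_def)
  then obtain v where vm [measurable]: "v \<in> borel_measurable borel" and zv: "AE \<xi> in lborel. z \<xi> = v \<xi>"
    using complex_representative by blast
  have F: "has_L2_Fourier f v" by (rule fourier_transform_Plancherel[OF FTu fm uf vm zv])
  have W: "has_L2_Fourier w (\<lambda>\<xi>. complex_of_real \<bar>\<xi>\<bar> * v \<xi>)"
    by (rule fourier_transform_Plancherel[OF FTw wm w0w]) (measurable, use zv in \<open>auto elim: eventually_mono\<close>)
  have wt: "integrable lborel (\<lambda>x. \<bar>x\<bar> powr (2 * \<gamma>) * (f x)\<^sup>2)"
  proof -
    have "AE x in lborel. \<bar>x\<bar> powr (2 * \<gamma>) * (cmod (u x))\<^sup>2 = \<bar>x\<bar> powr (2 * \<gamma>) * (f x)\<^sup>2"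
      using uf by eventually_elim simp
    then show ?thesis using dom lebesgue_eq_lborel(3)[of "\<lambda>x. \<bar>x\<bar> powr (2 * \<gamma>) * (f x)\<^sup>2"] by (simp add: A_domain_def)
  qed
  have "sq_int (\<lambda>x. weight_bound x * f x)"
  proof -
    have [measurable]: "weight_bound \<in> borel_measurable borel" unfolding weight_bound_def[abs_def] by measurable
    have le: "(weight_bound x * f x)\<^sup>2 \<le> (C * 6 powr \<gamma>)\<^sup>2 * ((f x)\<^sup>2 + \<bar>x\<bar> powr (2 * \<gamma>) * (f x)\<^sup>2)" for x
    proof -
      define M where "M = max 1 \<bar>x\<bar>"
      have "(3 + 3 * \<bar>x\<bar>) powr \<gamma> \<le> (6 * M) powr \<gamma>" using gamma by (intro powr_mono2) (auto simp: M_def)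
      also have "\<dots> = 6 powr \<gamma> * M powr \<gamma>" by (rule powr_mult)
      finally have "weight_bound x \<le> C * 6 powr \<gamma> * M powr \<gamma>" unfolding weight_bound_def using C_pos by (simp add: mult.assoc)
      then have "(weight_bound x)\<^sup>2 \<le> (C * 6 powr \<gamma> * M powr \<gamma>)\<^sup>2" using weight_bound_nonneg by (intro power_mono)
      also have "\<dots> = (C * 6 powr \<gamma>)\<^sup>2 * (M powr \<gamma>)\<^sup>2" by (simp add: power_mult_distrib)
      also have "(M powr \<gamma>)\<^sup>2 = M powr (2 * \<gamma>)" by (simp add: power2_eq_square powr_add[symmetric])
      finally have 1: "(weight_bound x)\<^sup>2 \<le> (C * 6 powr \<gamma>)\<^sup>2 * M powr (2 * \<gamma>)" .
      have "M powr (2 * \<gamma>) \<le> 1 + \<bar>x\<bar> powr (2 * \<gamma>)" by (auto simp: M_def max_def)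
      then have "(C * 6 powr \<gamma>)\<^sup>2 * M powr (2 * \<gamma>) \<le> (C * 6 powr \<gamma>)\<^sup>2 * (1 + \<bar>x\<bar> powr (2 * \<gamma>))" by (rule mult_left_mono) simp
      with 1 have "(weight_bound x)\<^sup>2 \<le> (C * 6 powr \<gamma>)\<^sup>2 * (1 + \<bar>x\<bar> powr (2 * \<gamma>))" by (rule order_trans)
      then have "(weight_bound x)\<^sup>2 * (f x)\<^sup>2 \<le> (C * 6 powr \<gamma>)\<^sup>2 * (1 + \<bar>x\<bar> powr (2 * \<gamma>)) * (f x)\<^sup>2" by (rule mult_right_mono) simp
      then show ?thesis by (simp add: power_mult_distrib algebra_simps)
    qed
    have "integrable lborel (\<lambda>x. (weight_bound x * f x)\<^sup>2)"
    proof (rule Bochner_Integration.integrable_bound)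
      show "integrable lborel (\<lambda>x. (C * 6 powr \<gamma>)\<^sup>2 * ((f x)\<^sup>2 + \<bar>x\<bar> powr (2 * \<gamma>) * (f x)\<^sup>2))"
        by (intro integrable_mult_right Bochner_Integration.integrable_add sq_int_square fq wt)
      show "AE x in lborel. norm ((weight_bound x * f x)\<^sup>2) \<le> norm ((C * 6 powr \<gamma>)\<^sup>2 * ((f x)\<^sup>2 + \<bar>x\<bar> powr (2 * \<gamma>) * (f x)\<^sup>2))"
        by (intro AE_I2 norm_mono_nonneg le) simp
    qed measurable
    then show ?thesis unfolding sq_int_def by simp
  qed
  then show thesis using that[of f w v] fq fn uf F W by (auto simp: w_def)
qed

end

theorem theorem3:
  fixes \<gamma> :: real and \<Theta> :: "real \<Rightarrow> real \<Rightarrow> real"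
    and \<mu> :: "real \<Rightarrow> real" and \<psi> :: "real \<Rightarrow> real \<Rightarrow> complex"
    and lam\<^sub>1 :: real and \<phi>\<^sub>1 :: "real \<Rightarrow> complex"
  assumes gamma: "\<gamma> \<ge> 1"
    and Theta_measurable: "(\<lambda>(x, y). \<Theta> x y) \<in> borel_measurable (lebesgue :: (real \<times> real) measure)"
    and Theta_nonneg: "\<And>x y. 0 \<le> \<Theta> x y"
    and Theta_homogeneous: "\<And>x y t. 0 < t \<Longrightarrow> \<Theta> (t * x) (t * y) = t powr \<gamma> * \<Theta> x y"
    and Theta_bounds: "\<exists>c C. 0 < c \<and> c \<le> C \<and> (\<forall>x y. x\<^sup>2 + y\<^sup>2 = 1 \<longrightarrow> c \<le> \<Theta> x y \<and> \<Theta> x y \<le> C)"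
    and Theta_symmetric: "\<And>x y. \<Theta> x y = \<Theta> y x"
    and Theta_lipschitz: "\<exists>\<epsilon> C. 0 < \<epsilon> \<and> 0 < C \<and>
          (\<forall>t\<in>{1 - \<epsilon><..<1 + \<epsilon>}. \<bar>\<Theta> t 1 - \<Theta> 1 1\<bar> \<le> C * \<bar>t - 1\<bar>) \<and>
          (\<forall>t\<in>{-1 - \<epsilon><..<-1 + \<epsilon>}. \<bar>\<Theta> t (-1) - \<Theta> (-1) (-1)\<bar> \<le> C * \<bar>t + 1\<bar>)"
    and mu: "\<And>\<alpha>. 0 < \<alpha> \<Longrightarrow> maximal_eigenvalue (B_operator \<Theta> \<alpha>) (\<mu> \<alpha>)"
    and psi_eigen: "\<And>\<alpha>. 0 < \<alpha> \<Longrightarrow> eigenfunction (B_operator \<Theta> \<alpha>) (complex_of_real (\<mu> \<alpha>)) (\<psi> \<alpha>)"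
    and psi_normalized: "\<And>\<alpha>. 0 < \<alpha> \<Longrightarrow> L2_norm (\<psi> \<alpha>) = 1"
    and psi_positive: "\<And>\<alpha>. 0 < \<alpha> \<Longrightarrow> AE x in lebesgue. \<psi> \<alpha> x \<in> \<real> \<and> 0 < Re (\<psi> \<alpha> x)"
    and lambda: "lowest_eigenvalue (A_operator \<Theta> \<gamma>) lam\<^sub>1"
    and phi_eigen: "eigenfunction (A_operator \<Theta> \<gamma>) (complex_of_real lam\<^sub>1) \<phi>\<^sub>1"
    and phi_normalized: "L2_norm \<phi>\<^sub>1 = 1"
    and phi_nonneg: "AE x in lebesgue. \<phi>\<^sub>1 x \<in> \<real> \<and> 0 \<le> Re (\<phi>\<^sub>1 x)"
  shows "((\<lambda>\<alpha>. (1 - \<mu> \<alpha>) / \<alpha>) \<longlongrightarrow> lam\<^sub>1) (at_right 0) \<and> L2_tendsto \<psi> \<phi>\<^sub>1 (at_right 0)"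
proof -
  obtain c C where cC: "0 < c" "c \<le> C" "\<And>x y. x\<^sup>2 + y\<^sup>2 = 1 \<Longrightarrow> c \<le> \<Theta> x y \<and> \<Theta> x y \<le> C"
    using Theta_bounds by blast
  obtain \<epsilon> L where \<epsilon>L: "0 < \<epsilon>" "0 < L"
    "\<And>t. t \<in> {1 - \<epsilon><..<1 + \<epsilon>} \<Longrightarrow> \<bar>\<Theta> t 1 - \<Theta> 1 1\<bar> \<le> L * \<bar>t - 1\<bar>"
    "\<And>t. t \<in> {-1 - \<epsilon><..<-1 + \<epsilon>} \<Longrightarrow> \<bar>\<Theta> t (-1) - \<Theta> (-1) (-1)\<bar> \<le> L * \<bar>t + 1\<bar>"
    using Theta_lipschitz by blast
  interpret homogeneous_potential \<gamma> \<Theta> c C \<epsilon> L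
  proof unfold_locales
    show "\<bar>\<Theta> t 1 - \<Theta> 1 1\<bar> \<le> L * \<bar>t - 1\<bar>" if "\<bar>t - 1\<bar> < \<epsilon>" for t
      using that by (intro \<epsilon>L(3)) auto
    show "\<bar>\<Theta> t (-1) - \<Theta> (-1) (-1)\<bar> \<le> L * \<bar>t + 1\<bar>" if "\<bar>t + 1\<bar> < \<epsilon>" for t
      using that by (intro \<epsilon>L(4)) auto
  qed (use assms cC \<epsilon>L in auto)
  obtain T where T: "homogeneous_weight T c C \<gamma> (\<lambda>x. \<Theta> x x)" and Tae: "AE x in lborel. AE y in lborel. \<Theta> x y = T x y"
    by (rule Borel_version)
  obtain f w v where f: "sq_int f" "\<And>x. 0 \<le> f x" "AE x in lborel. \<phi>\<^sub>1 x = complex_of_real (f x)"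
    and fw: "sq_int (\<lambda>x. homogeneous_weight.weight_bound C \<gamma> x * f x)"
    and feig: "AE x in lborel. w x + 1 / 2 * \<Theta> x x * f x = lam\<^sub>1 * f x"
    and F: "has_L2_Fourier f v" and W: "has_L2_Fourier w (\<lambda>\<xi>. complex_of_real \<bar>\<xi>\<bar> * v \<xi>)"
    by (rule ground_state_Borel[OF T phi_eigen phi_nonneg]) (rule that)
  have fnorm: "ip f f = 1"
    using phi_normalized L2_real(2)[OF sq_int_measurable[OF f(1)] f(3)] by simp
  have "\<forall>\<alpha>\<in>{0<..}. \<exists>p. sq_int p \<and> (\<forall>x. 0 < p x) \<and> (AE x in lborel. \<psi> \<alpha> x = complex_of_real (p x)) \<and>
      (AE x in lborel. (\<integral>y. wcauchy T \<alpha> x y * p y \<partial>lborel) = (1 / \<alpha> - (1 - \<mu> \<alpha>) / \<alpha>) * p x)"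
  proof
    fix \<alpha> :: real assume "\<alpha> \<in> {0<..}"
    then have \<alpha>: "0 < \<alpha>" by simp
    show "\<exists>p. sq_int p \<and> (\<forall>x. 0 < p x) \<and> (AE x in lborel. \<psi> \<alpha> x = complex_of_real (p x)) \<and>
      (AE x in lborel. (\<integral>y. wcauchy T \<alpha> x y * p y \<partial>lborel) = (1 / \<alpha> - (1 - \<mu> \<alpha>) / \<alpha>) * p x)"
      by (rule eigenfunction_Borel[OF Tae T \<alpha> psi_eigen[OF \<alpha>] psi_positive[OF \<alpha>]]) blast
  qed
  from bchoice[OF this] obtain p where p': "\<forall>\<alpha>\<in>{0<..}. sq_int (p \<alpha>) \<and> (\<forall>x. 0 < p \<alpha> x) \<and> (AE x in lborel. \<psi> \<alpha> x = complex_of_real (p \<alpha> x)) \<and>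
      (AE x in lborel. (\<integral>y. wcauchy T \<alpha> x y * p \<alpha> y \<partial>lborel) = (1 / \<alpha> - (1 - \<mu> \<alpha>) / \<alpha>) * p \<alpha> x)"
    by (elim exE)
  have p: "sq_int (p \<alpha>)" "0 < p \<alpha> x" "AE x in lborel. \<psi> \<alpha> x = complex_of_real (p \<alpha> x)"
     "AE x in lborel. (\<integral>y. wcauchy T \<alpha> x y * p \<alpha> y \<partial>lborel) = (1 / \<alpha> - (1 - \<mu> \<alpha>) / \<alpha>) * p \<alpha> x"
    if "0 < \<alpha>" for \<alpha> x
    using p' that by simp_all
  have pnorm: "ip (p \<alpha>) (p \<alpha>) = 1" if "0 < \<alpha>" for \<alpha>
    using psi_normalized[OF that] L2_real(2)[OF sq_int_measurable[OF p(1)[OF that]] p(3)[OF that]] by simp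
  have vm: "v \<in> borel_measurable borel" and wv: "integrable lborel (\<lambda>\<xi>. (cmod (complex_of_real \<bar>\<xi>\<bar> * v \<xi>))\<^sup>2)" and wq: "sq_int w"
    using F W by (auto simp: has_L2_Fourier_def)
  have seq: "(\<lambda>n. (1 - \<mu> (a n)) / a n) \<longlonglongrightarrow> lam\<^sub>1" "(\<lambda>n. ip f (p (a n))) \<longlonglongrightarrow> 1"
    if a: "\<And>n. 0 < a n" "a \<longlonglongrightarrow> 0" for a :: "nat \<Rightarrow> real"
  proof -
    have eta: "(\<lambda>n. sqrt (multiplier_error v (a n))) \<longlonglongrightarrow> 0"
      using tendsto_real_sqrt[OF multiplier_error_tendsto[OF vm wv a]] by simp
    have "eigenvalue_asymptotics T c C \<gamma> (\<lambda>x. \<Theta> x x) a (\<lambda>n. (1 - \<mu> (a n)) / a n) (\<lambda>n. sqrt (multiplier_error v (a n)))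
       (\<lambda>n. p (a n)) f w lam\<^sub>1"
      by (intro eigenvalue_asymptotics.intro T eigenvalue_asymptotics_axioms.intro)
        (use a p pnorm f fnorm fw feig wq eta form_generator_estimate[OF F W] in auto)
    then interpret eigenvalue_asymptotics T c C \<gamma> "\<lambda>x. \<Theta> x x" a "\<lambda>n. (1 - \<mu> (a n)) / a n" "\<lambda>n. sqrt (multiplier_error v (a n))"
       "\<lambda>n. p (a n)" f w lam\<^sub>1 .
    show "(\<lambda>n. (1 - \<mu> (a n)) / a n) \<longlonglongrightarrow> lam\<^sub>1" by (rule E_tendsto)
    show "(\<lambda>n. ip f (p (a n))) \<longlonglongrightarrow> 1" by (rule overlap_tendsto)
  qed
  have right: "(X \<longlongrightarrow> l) (at_right 0)" if "\<And>a. (\<And>n. 0 < a n) \<Longrightarrow> a \<longlonglongrightarrow> 0 \<Longrightarrow> (\<lambda>n. X (a n)) \<longlonglongrightarrow> l" for X :: "real \<Rightarrow> real" and l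
    by (rule tendsto_at_right_sequentially[of 0 1]) (use that in auto)
  have "((\<lambda>\<alpha>. (1 - \<mu> \<alpha>) / \<alpha>) \<longlongrightarrow> lam\<^sub>1) (at_right 0)" by (rule right) (rule seq)
  moreover have "L2_tendsto \<psi> \<phi>\<^sub>1 (at_right 0)"
    unfolding L2_tendsto_def
  proof (intro conjI)
    show "\<forall>\<^sub>F \<alpha> in at_right 0. \<psi> \<alpha> \<in> L2"
      using eventually_at_right_less[of 0] by eventually_elim (use psi_eigen in \<open>auto simp: eigenfunction_def\<close>)
    show "\<phi>\<^sub>1 \<in> L2" using phi_eigen by (simp add: eigenfunction_def)
    have norm: "L2_norm (\<lambda>x. \<psi> \<alpha> x - \<phi>\<^sub>1 x) = sqrt (2 - 2 * ip f (p \<alpha>))" if "0 < \<alpha>" for \<alpha>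
    proof -
      have m: "(\<lambda>x. 1 * p \<alpha> x - 1 * f x) \<in> borel_measurable borel"
        using sq_int_measurable[OF p(1)[OF that]] sq_int_measurable[OF f(1)] by simp
      have "AE x in lborel. \<psi> \<alpha> x - \<phi>\<^sub>1 x = complex_of_real (1 * p \<alpha> x - 1 * f x)"
        using p(3)[OF that] f(3) by eventually_elim simp
      from L2_real(2)[OF m this] show ?thesis
        unfolding ip_linear_combination[OF p(1)[OF that] f(1)] by (simp add: pnorm[OF that] fnorm ip_commute[of "p \<alpha>" f])
    qed
    have "((\<lambda>\<alpha>. sqrt (2 - 2 * ip f (p \<alpha>))) \<longlongrightarrow> sqrt (2 - 2 * 1)) (at_right 0)"
      by (intro tendsto_intros right seq)
    then have lim: "((\<lambda>\<alpha>. sqrt (2 - 2 * ip f (p \<alpha>))) \<longlongrightarrow> 0) (at_right 0)" by simp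
    show "((\<lambda>\<alpha>. L2_norm (\<lambda>x. \<psi> \<alpha> x - \<phi>\<^sub>1 x)) \<longlongrightarrow> 0) (at_right 0)"
    proof (rule Lim_transform_eventually[OF lim])
      show "\<forall>\<^sub>F \<alpha> in at_right 0. sqrt (2 - 2 * ip f (p \<alpha>)) = L2_norm (\<lambda>x. \<psi> \<alpha> x - \<phi>\<^sub>1 x)"
        using eventually_at_right_less[of 0] by eventually_elim (simp add: norm)
    qed
  qed
  ultimately show ?thesis by blast
qed

end
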